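(* For all $0\le\alpha\le1$ and $0\le\gamma\le\alpha$, the alpha-gamma splitting rule $q_{\alpha,\gamma}^{\rm seq}$ is sampling consistent. Moreover, for $0\le\alpha<1$ and $0\le\gamma\le\alpha$, the dislocation measure $\nu$ in the integral representation of the splitting rule can be chosen as $$\nu_{\alpha,\gamma}(ds)=\left(\gamma+(1-\alpha-\gamma)\sum_{i\neq j}s_is_j\right){\rm PD}^*_{\alpha,-\alpha-\gamma}(ds),$$ where the sum is over ordered pairs $(i,j)$ of distinct positive integers; that is, the partition probability function $p^{\rm seq}_{\alpha,\gamma}$ associated with $q^{\rm seq}_{\alpha,\gamma}$ satisfies, for all $k\ge2$, $n_1,\ldots,n_k\ge1$ and $n=n_1+\ldots+n_k$, $$p^{\rm seq}_{\alpha,\gamma}(n_1,\ldots,n_k)=\frac{1}{\widetilde{Z}_n}\int_{\mathcal{S}^\downarrow}\ \sum_{i_1,\ldots,i_k\ge1\ \text{distinct}}\ \prod_{j=1}^ks_{i_j}^{n_j}\,\nu_{\alpha,\gamma}(ds),\qquad \widetilde{Z}_n=\int_{\mathcal{S}^\downarrow}\Big(1-\sum_{i\ge1}s_i^n\Big)\nu_{\alpha,\gamma}(ds).$$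
   Context: Trees. Write $[n]=\{1,\ldots,n\}$. Let $\mathbb{T}_n$ be the set of combinatorial trees without degree-2 vertices that have one degree-1 vertex called the root and exactly $n$ further degree-1 vertices, called leaves, labelled by $[n]$; the other vertices are called branch points. Edges are directed away from the root. Alpha-gamma trees. For $0\le\alpha\le 1$, $0\le\gamma\le\alpha$, the random trees $T_n\in\mathbb{T}_n$, $n\ge1$, are defined as follows. $T_1,T_2$ are the unique elements of $\mathbb{T}_1,\mathbb{T}_2$. Given $T_n$, $n\ge 2$: (i) assign weight $1-\alpha$ to each of the $n$ edges adjacent to a leaf, weight $\gamma$ to each other edge (including the edge adjacent to the root), and weight $(k-1)\alpha-\gamma$ to each vertex of degree $k+1\ge 3$; (ii) select an edge $a\to c$ or a branch point $v$ at random with probability proportional to weight; (iii) if an edge $a\to c$ was selected, replace it by three edges $a\to b$, $b\to c$, $b\to n+1$, where $b$ is a new branch point and $n+1$ a new leaf; if a vertex $v$ was selected, add an edge $v\to n+1$ to a new leaf $n+1$. The result is $T_{n+1}$. $T_n^\circ$ denotes the unlabelled tree obtained from $T_n$ by forgetting leaf labels. The sequence $(T_n^\circ)_{n\ge1}$ is a Markov branching model: for $n\ge2$, given that the branching at the branch point adjacent to the root is into tree components with $n_1\ge\ldots\ge n_k$ leaves (the first split), these components are independent copies of $T_{n_i}^\circ$. Its splitting rule $q_{\alpha,\gamma}^{\rm seq}(n_1,\ldots,n_k)$, $k\ge 2$, $n_1\ge\ldots\ge n_k\ge1$, is the probability function of the first split of $T_n^\circ$, $n=n_1+\ldots+n_k\ge2$.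 Sampling consistency. A splitting rule $q$ (a probability function for each $n\ge2$) determines the laws of unlabelled Markov branching trees $T_n^\circ$. It is sampling consistent if for all $n\ge2$, the tree obtained from $T_n^\circ$ by removing a uniformly chosen leaf (and the adjacent branch point if its degree is reduced to 2) has the same distribution as $T_{n-1}^\circ$. Partition probability function. With a splitting rule $q$ associate $$p(n_1,\ldots,n_k)=\frac{m_1!\cdots m_n!}{\binom{n}{n_1,\ldots,n_k}}\,q((n_1,\ldots,n_k)^\downarrow),\qquad n_j\ge1,\ k\ge2,\ n=n_1+\ldots+n_k,$$ where $^\downarrow$ denotes decreasing rearrangement and $m_r$ is the number of $r$'s in $(n_1,\ldots,n_k)$. Measures. $\mathcal{S}^\downarrow=\{s=(s_i)_{i\ge1}:s_1\ge s_2\ge\ldots\ge0,\ \sum_is_i\le1\}$. A dislocation measure is a measure $\nu$ on $\mathcal{S}^\downarrow$ with $\nu(\{(1,0,0,\ldots)\})=0$ and $\int(1-s_1)\nu(ds)<\infty$. For $0<\alpha<1$ and $\theta>-2\alpha$, ${\rm PD}^*_{\alpha,\theta}$ is the measure on $\mathcal{S}^\downarrow$ given by $$\int f\,d{\rm PD}^*_{\alpha,\theta}=\mathbb{E}\big(\sigma_1^{-\theta}f(\Delta\sigma_{[0,1]}/\sigma_1)\big),$$ where $\sigma$ is an $\alpha$-stable subordinator with $\mathbb{E}(e^{-\lambda\sigma_1})=e^{-\lambda^\alpha}$ and $\Delta\sigma_{[0,1]}$ is the sequence of its jumps on $[0,1]$ in decreasing order. For $0\le\alpha<1$ and $\theta=-2\alpha$,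 $$\int f\,d{\rm PD}^*_{\alpha,-2\alpha}=\int_{1/2}^1f(x,1-x,0,0,\ldots)x^{-\alpha-1}(1-x)^{-\alpha-1}dx.$$ *)

theory Defs
  imports "HOL-Probability.Probability"
begin

section \<open>Trees\<close>

text \<open>
  A combinatorial tree with a root of degree 1 is given by what hangs below the root edge:
  either a single leaf, or a branch point with the multiset of its child components. The root
  itself is not a node of the datatype. Every subtree therefore stands for the edge directly
  above its topmost vertex (for the whole tree: the edge adjacent to the root), and
  \<open>Branch ts\<close> in addition for a branch point of degree \<open>size ts + 1\<close>.
  Labelled trees have type \<open>nat rtree\<close>, unlabelled ones \<open>unit rtree\<close>.
\<close>

datatype 'a rtree = Leaf 'a | Branch "'a rtree multiset"

definition shape :: "'a rtree \<Rightarrow> unit rtree" where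
  "shape = map_rtree (\<lambda>_. ())"

primrec num_leaves :: "'a rtree \<Rightarrow> nat" where
  "num_leaves (Leaf a) = 1"
| "num_leaves (Branch ts) = sum_mset (image_mset num_leaves ts)"

primrec subtrees :: "'a rtree \<Rightarrow> 'a rtree set" where
  "subtrees (Leaf a) = {Leaf a}"
| "subtrees (Branch ts) = insert (Branch ts) (\<Union>(set_mset (image_mset subtrees ts)))"

text \<open>\<open>replace_subtree u v t\<close> replaces \<open>u\<close> by \<open>v\<close> in \<open>t\<close>. In a tree with
  distinct leaf labels \<open>u\<close> occurs at most once.\<close>

primrec replace_subtree :: "'a rtree \<Rightarrow> 'a rtree \<Rightarrow> 'a rtree \<Rightarrow> 'a rtree" where
  "replace_subtree u v (Leaf a) = (if Leaf a = u then v else Leaf a)"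
| "replace_subtree u v (Branch ts) =
     (if Branch ts = u then v else Branch (image_mset (replace_subtree u v) ts))"

section \<open>Alpha-gamma trees\<close>

text \<open>\<open>Edge u\<close> is the edge directly above the subtree \<open>u\<close>, \<open>Vertex ts\<close> the branch
  point whose child components are \<open>ts\<close>. With distinct leaf labels these determine the edge
  and the branch point.\<close>

datatype 'a site = Edge "'a rtree" | Vertex "'a rtree multiset"

definition sites :: "'a rtree \<Rightarrow> 'a site set" where
  "sites t = Edge ` subtrees t \<union> {Vertex ts | ts. Branch ts \<in> subtrees t}"

fun site_weight :: "real \<Rightarrow> real \<Rightarrow> 'a site \<Rightarrow> real" where
  "site_weight \<alpha> \<gamma> (Edge (Leaf a)) = 1 - \<alpha>"
| "site_weight \<alpha> \<gamma> (Edge (Branch ts)) = \<gamma>"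
| "site_weight \<alpha> \<gamma> (Vertex ts) = (real (size ts) - 1) * \<alpha> - \<gamma>"

fun insert_leaf :: "'a \<Rightarrow> 'a rtree \<Rightarrow> 'a site \<Rightarrow> 'a rtree" where
  "insert_leaf a t (Edge u) = replace_subtree u (Branch {#u, Leaf a#}) t"
| "insert_leaf a t (Vertex ts) = replace_subtree (Branch ts) (Branch (add_mset (Leaf a) ts)) t"

definition weighted_pmf :: "'a set \<Rightarrow> ('a \<Rightarrow> real) \<Rightarrow> 'a pmf" where
  "weighted_pmf A w = embed_pmf (\<lambda>x. if x \<in> A then w x / (\<Sum>y\<in>A. w y) else 0)"

text \<open>\<open>ag_tree \<alpha> \<gamma> n\<close> is the law of \<open>T\<^sub>n\<close>; the value at \<open>n = 0\<close> is a dummy.\<close>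

fun ag_tree :: "real \<Rightarrow> real \<Rightarrow> nat \<Rightarrow> nat rtree pmf" where
  "ag_tree \<alpha> \<gamma> 0 = return_pmf (Leaf 1)"
| "ag_tree \<alpha> \<gamma> (Suc 0) = return_pmf (Leaf 1)"
| "ag_tree \<alpha> \<gamma> (Suc (Suc 0)) = return_pmf (Branch {#Leaf 1, Leaf 2#})"
| "ag_tree \<alpha> \<gamma> (Suc (Suc (Suc n))) =
     bind_pmf (ag_tree \<alpha> \<gamma> (Suc (Suc n))) (\<lambda>t.
       map_pmf (insert_leaf (n + 3) t) (weighted_pmf (sites t) (site_weight \<alpha> \<gamma>)))"

definition ag_tree_unlabelled :: "real \<Rightarrow> real \<Rightarrow> nat \<Rightarrow> unit rtree pmf" where
  "ag_tree_unlabelled \<alpha> \<gamma> n = map_pmf shape (ag_tree \<alpha> \<gamma> n)"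

fun first_split :: "'a rtree \<Rightarrow> nat list" where
  "first_split (Leaf a) = []"
| "first_split (Branch ts) = rev (sorted_list_of_multiset (image_mset num_leaves ts))"

text \<open>Splitting rules are functions of decreasing lists \<open>[n\<^sub>1, \<dots>, n\<^sub>k]\<close>.\<close>

definition q_seq :: "real \<Rightarrow> real \<Rightarrow> nat list \<Rightarrow> real" where
  "q_seq \<alpha> \<gamma> ns = pmf (map_pmf first_split (ag_tree_unlabelled \<alpha> \<gamma> (sum_list ns))) ns"

section \<open>Markov branching trees and sampling consistency\<close>

definition splits :: "nat \<Rightarrow> nat list set" where
  "splits n = {ns. sorted_wrt (\<ge>) ns \<and> 2 \<le> length ns \<and> (\<forall>m\<in>set ns. 1 \<le> m) \<and> sum_list ns = n}"

definition splitting_rule :: "(nat list \<Rightarrow> real) \<Rightarrow> bool" where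
  "splitting_rule q \<longleftrightarrow>
     (\<forall>n\<ge>2. (\<forall>ns\<in>splits n. 0 \<le> q ns) \<and> (\<Sum>ns\<in>splits n. q ns) = 1)"

definition split_pmf :: "(nat list \<Rightarrow> real) \<Rightarrow> nat \<Rightarrow> nat list pmf" where
  "split_pmf q n = embed_pmf (\<lambda>ns. if ns \<in> splits n then q ns else 0)"

primrec indep_list_pmf :: "'a pmf list \<Rightarrow> 'a list pmf" where
  "indep_list_pmf [] = return_pmf []"
| "indep_list_pmf (p # ps) = bind_pmf p (\<lambda>x. map_pmf (\<lambda>xs. x # xs) (indep_list_pmf ps))"

text \<open>The test \<open>m < n\<close> only serves termination: if \<open>q\<close> is a splitting rule and
  \<open>n \<ge> 2\<close>, it holds for all parts \<open>m\<close> of a split drawn from \<open>split_pmf q n\<close>.\<close>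

fun mb_tree :: "(nat list \<Rightarrow> real) \<Rightarrow> nat \<Rightarrow> unit rtree pmf" where
  "mb_tree q n =
     (if n \<le> 1 then return_pmf (Leaf ())
      else bind_pmf (split_pmf q n) (\<lambda>ns.
        map_pmf (\<lambda>ts. Branch (mset ts))
          (indep_list_pmf
            (map (\<lambda>m. if m < n then mb_tree q m else return_pmf (Leaf ())) ns))))"

text \<open>A branch point left with a single child component has degree 2 and is removed.\<close>

definition suppress :: "'a rtree multiset \<Rightarrow> 'a rtree" where
  "suppress ts = (if size ts = 1 then (THE t. ts = {#t#}) else Branch ts)"

text \<open>The multiset of the trees obtained by removing one leaf, with one entry for each leaf of
  the tree. It is empty for the tree with a single leaf, which has no such reduction.\<close>

primrec leaf_removals :: "'a rtree \<Rightarrow> 'a rtree multiset" where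
  "leaf_removals (Leaf a) = {#}"
| "leaf_removals (Branch ts) =
     sum_mset (image_mset
       (\<lambda>(t, removals). case t of
          Leaf a \<Rightarrow> {#suppress (ts - {#t#})#}
        | Branch us \<Rightarrow> image_mset (\<lambda>t'. Branch (add_mset t' (ts - {#t#}))) removals)
       (image_mset (\<lambda>t. (t, leaf_removals t)) ts))"

definition sampling_consistent :: "(nat list \<Rightarrow> real) \<Rightarrow> bool" where
  "sampling_consistent q \<longleftrightarrow>
     (\<forall>n\<ge>2. bind_pmf (mb_tree q n) (\<lambda>t. pmf_of_multiset (leaf_removals t)) = mb_tree q (n - 1))"

section \<open>Partition probability function\<close>

definition partition_pf :: "(nat list \<Rightarrow> real) \<Rightarrow> nat list \<Rightarrow> real" where
  "partition_pf q ns =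
     (let n = sum_list ns;
          multinomial = fact n / (\<Prod>m\<leftarrow>ns. fact m)
      in (\<Prod>r=1..n. fact (count_list ns r)) / multinomial * q (rev (sort ns)))"

section \<open>Dislocation measures\<close>

text \<open>Sequences are indexed from 0.\<close>

definition S_down :: "(nat \<Rightarrow> real) set" where
  "S_down = {s. decseq s \<and> (\<forall>i. 0 \<le> s i) \<and> summable s \<and> (\<Sum>i. s i) \<le> 1}"

definition S_down_space :: "(nat \<Rightarrow> real) measure" where
  "S_down_space = restrict_space (\<Pi>\<^sub>M i\<in>UNIV. borel) S_down"

definition dislocation_measure :: "(nat \<Rightarrow> real) measure \<Rightarrow> bool" where
  "dislocation_measure \<nu> \<longleftrightarrow>
     sets \<nu> = sets S_down_space \<and>
     emeasure \<nu> {\<lambda>i. if i = 0 then 1 else 0} = 0 \<and>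
     (\<integral>\<^sup>+ s. ennreal (1 - s 0) \<partial>\<nu>) < \<infinity>"

text \<open>A stable subordinator of index \<open>\<alpha>\<close>, normalised by
  \<open>E (exp (- u \<sigma>\<^sub>1)) = exp (- u\<^sup>\<alpha>)\<close>: stationary independent increments and
  nondecreasing right-continuous paths started from 0. Left limits exist by monotonicity.\<close>

definition stable_subordinator :: "real \<Rightarrow> 'a measure \<Rightarrow> (real \<Rightarrow> 'a \<Rightarrow> real) \<Rightarrow> bool" where
  "stable_subordinator \<alpha> M \<sigma> \<longleftrightarrow>
     prob_space M \<and>
     (\<forall>t\<ge>0. \<sigma> t \<in> borel_measurable M) \<and>
     (\<forall>\<omega>\<in>space M. \<sigma> 0 \<omega> = 0 \<and> mono_on {0..} (\<lambda>t. \<sigma> t \<omega>) \<and>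
        (\<forall>t\<ge>0. continuous (at_right t) (\<lambda>t. \<sigma> t \<omega>))) \<and>
     (\<forall>s t. 0 \<le> s \<and> s \<le> t \<longrightarrow>
        distr M borel (\<lambda>\<omega>. \<sigma> t \<omega> - \<sigma> s \<omega>) = distr M borel (\<sigma> (t - s))) \<and>
     (\<forall>(t :: nat \<Rightarrow> real) n. 0 \<le> t 0 \<and> incseq t \<longrightarrow>
        prob_space.indep_vars M (\<lambda>_. borel) (\<lambda>i \<omega>. \<sigma> (t (Suc i)) \<omega> - \<sigma> (t i) \<omega>) {..<n}) \<and>
     (\<forall>u\<ge>0. (\<integral>\<omega>. exp (- u * \<sigma> 1 \<omega>) \<partial>M) = exp (- (u powr \<alpha>)))"

definition jump :: "(real \<Rightarrow> real) \<Rightarrow> real \<Rightarrow> real" where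
  "jump x t = x t - Lim (at_left t) x"

text \<open>The jumps of a nondecreasing path on \<open>[0, 1]\<close> in decreasing order: entry \<open>i\<close> is the
  largest \<open>y\<close> such that more than \<open>i\<close> jumps are at least \<open>y\<close>, and 0 if there are at most
  \<open>i\<close> jumps. Only finitely many jumps exceed a given \<open>y > 0\<close>, and time 0 is never a jump
  time.\<close>

definition ranked_jumps :: "(real \<Rightarrow> real) \<Rightarrow> nat \<Rightarrow> real" where
  "ranked_jumps x i = Sup ({0} \<union> {y. 0 < y \<and> i < card {t \<in> {0<..1}. y \<le> jump x t}})"

text \<open>\<open>PD_star \<alpha> \<theta> M \<sigma>\<close> is \<open>PD\<^sup>*\<close> with parameters \<open>\<alpha>\<close> and \<open>\<theta>\<close>. For \<open>\<theta> > - 2 * \<alpha>\<close> it is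
  defined through a stable subordinator \<open>\<sigma>\<close> on \<open>M\<close>; for \<open>\<theta> = - 2 * \<alpha>\<close> these two arguments
  are not used.\<close>

definition PD_star :: "real \<Rightarrow> real \<Rightarrow> 'a measure \<Rightarrow> (real \<Rightarrow> 'a \<Rightarrow> real) \<Rightarrow> (nat \<Rightarrow> real) measure"
  where
  "PD_star \<alpha> \<theta> M \<sigma> =
     (if \<theta> = - 2 * \<alpha> then
        distr
          (density (restrict_space lborel {1/2..1})
            (\<lambda>x. ennreal (x powr (- \<alpha> - 1) * (1 - x) powr (- \<alpha> - 1))))
          S_down_space
          (\<lambda>x i. if i = 0 then x else if i = 1 then 1 - x else 0)
      else
        distr
          (density M (\<lambda>\<omega>. ennreal (\<sigma> 1 \<omega> powr (- \<theta>))))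
          S_down_space
          (\<lambda>\<omega> i. ranked_jumps (\<lambda>t. \<sigma> t \<omega>) i / \<sigma> 1 \<omega>))"

definition nu_ag :: "real \<Rightarrow> real \<Rightarrow> 'a measure \<Rightarrow> (real \<Rightarrow> 'a \<Rightarrow> real) \<Rightarrow> (nat \<Rightarrow> real) measure"
  where
  "nu_ag \<alpha> \<gamma> M \<sigma> =
     density (PD_star \<alpha> (- \<alpha> - \<gamma>) M \<sigma>)
       (\<lambda>s. ennreal (\<gamma> + (1 - \<alpha> - \<gamma>) * (\<Sum>\<^sub>\<infinity>(i, j)\<in>{(i, j). i \<noteq> j}. s i * s j)))"

text \<open>The numerator and the normalising constant in the integral representation of a partition
  probability function. Both are integrals of nonnegative functions.\<close>

definition paintbox_integral :: "(nat \<Rightarrow> real) measure \<Rightarrow> nat list \<Rightarrow> ennreal" where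
  "paintbox_integral \<nu> ns =
     (\<integral>\<^sup>+ s. (\<Sum>\<^sub>\<infinity>is\<in>{is. length is = length ns \<and> distinct is}.
        \<Prod>j<length ns. ennreal (s (is ! j) ^ (ns ! j))) \<partial>\<nu>)"

definition normalisation :: "(nat \<Rightarrow> real) measure \<Rightarrow> nat \<Rightarrow> ennreal" where
  "normalisation \<nu> n = (\<integral>\<^sup>+ s. ennreal (1 - (\<Sum>i. s i ^ n)) \<partial>\<nu>)"

end

(*
  Growing the tree by one leaf changes its first split by a Markov step: a component of m leaves
  grows with weight m - alpha, a new singleton component appears with weight (k - 1) * alpha - gamma,
  and the whole tree becomes one component next to the new leaf with weight gamma. Solving this
  recursion gives, with w(n) = (1 - alpha) * ... * (n - 1 - alpha), the partition probability function
    p(n_1, ..., n_k) = (gamma + (1 - alpha - gamma) * S / (n * (n - 1)))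
                         * (alpha - gamma) * (2 * alpha - gamma) * ... * ((k - 2) * alpha - gamma)
                         * w(n_1) * ... * w(n_k) / w(n),
  where S is the sum of n_i * n_j over i and j distinct. Sampling consistency of a Markov branching
  model amounts to a linear identity between p at n and p at n + 1; it is a polynomial identity for
  alpha < 1 and extends to alpha = 1 by continuity of the recursion in alpha.

  For the integral representation, the increments of the stable subordinator over the dyadic
  intervals of order m are independent, and their moments damped by exp (- u * x) are derivatives of
  exp (- 2^(-m) * u^alpha). Ranking the increments and letting m tend to infinity gives the mixed
  moments of the jumps, damped by exp (- u * sigma_1); a Gamma integral over u turns the damping into
  the power sigma_1^(- n - theta). Since the normalised jumps sum to 1, the density of nu is
  gamma + (1 - alpha - gamma) * (1 - sum of s_i^2), so the moments of nu are combinations of those of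
  PD*, and the normalising constants telescope because
  (sum of s_i^n) - (sum of s_i^(n+1)) is the paintbox sum for the parts (n, 1).
*)

theory Submission
  imports Defs
begin

section \<open>The partition probability function of the alpha-gamma model\<close>

text \<open>At \<alpha> = 1 the closed formula reads 0/0. The combinatorial half therefore carries
  the recursion \<open>ag_comp\<close>, which equals the formula times a multinomial coefficient for
  \<alpha> < 1 and whose denominators stay at least 1. Splits are multisets, and equal parts enter
  through \<open>multiplicity_fact\<close>. Of the subordinator only paths, increments and one
  Laplace transform are given, so the jumps must be extracted from dyadic increments. The i-th
  largest increment (counted from 1) is at most \<open>\<sigma> 1 \<omega>\<close> divided by i.
  This dominates power sums of exponent 2 and more, but not the sum itself: a drift would escape.
  That the jumps exhaust the path is proved separately with the test function z (1 - exp (- K z)),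
  which is quadratic at 0 and tends to z as K grows. Sums over distinct indices are polynomials in
  power sums, and limits are taken there. For \<gamma> = \<alpha>, where PD* charges two blocks
  only, the same moment formula holds up to a constant; a locale covers both cases, and its constant
  cancels in the final quotient.\<close>

definition parts_of :: "nat \<Rightarrow> nat multiset set" where
  "parts_of n = {\<mu>. 2 \<le> size \<mu> \<and> 0 \<notin># \<mu> \<and> \<Sum>\<^sub># \<mu> = n}"

definition inc_part :: "nat \<Rightarrow> nat multiset \<Rightarrow> nat multiset" where
  "inc_part x \<mu> = add_mset (Suc x) (\<mu> - {#x#})"

definition dec_part :: "nat \<Rightarrow> nat multiset \<Rightarrow> nat multiset" where
  "dec_part x \<mu> = add_mset (x - 1) (\<mu> - {#x#})"

text \<open>The weight w(n). For n at least 1 and \<alpha> < 1 it is Gamma (n - \<alpha>) / Gamma (1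
  - \<alpha>), see \<open>Gamma_rising\<close>.\<close>

definition rising :: "real \<Rightarrow> nat \<Rightarrow> real" where
  "rising \<alpha> n = (\<Prod>i=1..<n. real i - \<alpha>)"

text \<open>The factor for j is the weight of a branch point with j children at the moment when
  child j + 1 is attached. Two children come from splitting an edge, so the product starts at j =
  2.\<close>

definition block_coeff :: "real \<Rightarrow> real \<Rightarrow> nat \<Rightarrow> real" where
  "block_coeff \<alpha> \<gamma> k = (\<Prod>j=2..<k. (real j - 1) * \<alpha> - \<gamma>)"

definition cross_sum :: "nat multiset \<Rightarrow> real" where
  "cross_sum \<mu> = (real (\<Sum>\<^sub># \<mu>))\<^sup>2 - (\<Sum>x\<in>#\<mu>. (real x)\<^sup>2)"

definition ag_ppf :: "real \<Rightarrow> real \<Rightarrow> nat multiset \<Rightarrow> real" where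
  "ag_ppf \<alpha> \<gamma> \<mu> = (let n = real (\<Sum>\<^sub># \<mu>) in
     (\<gamma> + (1 - \<alpha> - \<gamma>) * cross_sum \<mu> / (n * (n - 1))) * block_coeff \<alpha> \<gamma> (size \<mu>)
       * (\<Prod>x\<in>#\<mu>. rising \<alpha> x) / rising \<alpha> (\<Sum>\<^sub># \<mu>))"

definition multinom :: "nat multiset \<Rightarrow> real" where
  "multinom \<mu> = fact (\<Sum>\<^sub># \<mu>) / (\<Prod>x\<in>#\<mu>. fact x)"

text \<open>The argument m stands for n = m + 2 leaves, and the denominator is the total weight n -
  \<alpha> of the tree that is about to grow. Each summand undoes one growth step: a part 1 is a new
  leaf at the top branch point, a part x > 1 has grown from x - 1. The value is the probability of
  the split times \<open>multiplicity_fact\<close> (\<open>pmf_component_sizes\<close>).\<close>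

primrec ag_comp_rec :: "real \<Rightarrow> real \<Rightarrow> nat \<Rightarrow> nat multiset \<Rightarrow> real" where
  "ag_comp_rec \<alpha> \<gamma> 0 \<mu> = (if \<mu> = {#1, 1#} then 2 else 0)"
| "ag_comp_rec \<alpha> \<gamma> (Suc m) \<mu> = (if \<mu> \<notin> parts_of (m + 3) then 0 else
    ((\<Sum>x\<in>#\<mu>. if x = 1 then ((real (size \<mu>) - 2) * \<alpha> - \<gamma>) * ag_comp_rec \<alpha> \<gamma> m (\<mu> - {#1#})
                else (real x - 1 - \<alpha>) * ag_comp_rec \<alpha> \<gamma> m (dec_part x \<mu>))
      + (if \<mu> = {#m + 2, 1#} then \<gamma> else 0)) / (real m + 2 - \<alpha>))"

definition ag_comp :: "real \<Rightarrow> real \<Rightarrow> nat \<Rightarrow> nat multiset \<Rightarrow> real" where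
  "ag_comp \<alpha> \<gamma> n = ag_comp_rec \<alpha> \<gamma> (n - 2)"

lemma rising_simps [simp]: "rising \<alpha> 0 = 1" "rising \<alpha> (Suc 0) = 1"
  by (simp_all add: rising_def)

lemma rising_Suc: "1 \<le> n \<Longrightarrow> rising \<alpha> (Suc n) = rising \<alpha> n * (real n - \<alpha>)"
  by (simp add: rising_def)

lemma rising_pos: "\<alpha> < 1 \<Longrightarrow> 0 < rising \<alpha> n"
  unfolding rising_def by (intro prod_pos) auto

lemma block_coeff_simps [simp]: "block_coeff \<alpha> \<gamma> 2 = 1" "block_coeff \<alpha> \<gamma> (Suc (Suc 0)) = 1"
  by (simp_all add: block_coeff_def)

lemma block_coeff_Suc:
  "2 \<le> k \<Longrightarrow> block_coeff \<alpha> \<gamma> (Suc k) = block_coeff \<alpha> \<gamma> k * ((real k - 1) * \<alpha> - \<gamma>)"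
  by (simp add: block_coeff_def)

lemma sum_mset_pos_size: "0 \<notin># \<mu> \<Longrightarrow> size \<mu> \<le> \<Sum>\<^sub># (\<mu> :: nat multiset)"
  by (induction \<mu>) auto

lemma parts_of_ge_2: "\<mu> \<in> parts_of n \<Longrightarrow> 2 \<le> n"
  using sum_mset_pos_size[of \<mu>] by (auto simp: parts_of_def)

lemma parts_of_2: "parts_of 2 = {{#1, 1#}}"
proof -
  have "\<mu> = {#1, 1#}" if "\<mu> \<in> parts_of 2" for \<mu>
  proof -
    have *: "2 \<le> size \<mu>" "0 \<notin># \<mu>" "\<Sum>\<^sub># \<mu> = 2" using that by (auto simp: parts_of_def)
    then obtain x \<nu> where \<mu>: "\<mu> = add_mset x \<nu>" by (cases \<mu>) auto
    with * obtain y \<rho> where \<nu>: "\<nu> = add_mset y \<rho>" by (cases \<nu>) auto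
    have "x > 0" "y > 0" using * \<mu> \<nu> by auto
    moreover have "x + y + \<Sum>\<^sub># \<rho> = 2" using * \<mu> \<nu> by simp
    ultimately have xy: "x = 1" "y = 1" and "\<Sum>\<^sub># \<rho> = 0" by linarith+
    then have "size \<rho> = 0" using sum_mset_pos_size[of \<rho>] * \<mu> \<nu> by (metis add_mset_remove_trivial in_diffD le_zero_eq)
    then show ?thesis using \<mu> \<nu> xy by simp
  qed
  then show ?thesis by (auto simp: parts_of_def)
qed

lemma ag_comp_2: "ag_comp \<alpha> \<gamma> 2 \<mu> = (if \<mu> = {#1, 1#} then 2 else 0)"
  by (simp add: ag_comp_def)

lemma ag_comp_outside: "2 \<le> n \<Longrightarrow> \<mu> \<notin> parts_of n \<Longrightarrow> ag_comp \<alpha> \<gamma> n \<mu> = 0"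
proof (cases "n = 2")
  case False
  assume "2 \<le> n" "\<mu> \<notin> parts_of n"
  then obtain m where "n = m + 3" using False by (metis add.commute le_add_diff_inverse2 le_neq_implies_less numeral_2_eq_2 numeral_3_eq_3 Suc_leI)
  with \<open>\<mu> \<notin> parts_of n\<close> show ?thesis by (simp add: ag_comp_def numeral_3_eq_3)
qed (auto simp: ag_comp_2 parts_of_2)

text \<open>The recursion in terms of n, cleared of its denominator. The branch for n = \<alpha>
  reflects division by zero.\<close>

lemma ag_comp_Suc:
  assumes "2 \<le> n" "\<mu> \<in> parts_of (Suc n)"
  shows "(real n - \<alpha>) * ag_comp \<alpha> \<gamma> (Suc n) \<mu> = 
    (if n = \<alpha> then 0 else
    (\<Sum>x\<in>#\<mu>. if x = 1 then ((real (size \<mu>) - 2) * \<alpha> - \<gamma>) * ag_comp \<alpha> \<gamma> n (\<mu> - {#1#})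
                else (real x - 1 - \<alpha>) * ag_comp \<alpha> \<gamma> n (dec_part x \<mu>))
      + (if \<mu> = {#n, 1#} then \<gamma> else 0))"
proof -
  obtain m where n: "n = m + 2" using assms(1) by (metis add.commute le_Suc_ex)
  show ?thesis using assms(2) unfolding n ag_comp_def add_diff_cancel_right'
    by (simp add: add.commute[of 2] numeral_3_eq_3)
qed

lemma inc_dec_part:
  "x \<in># \<mu> \<Longrightarrow> x \<noteq> 0 \<Longrightarrow> inc_part (x - 1) (dec_part x \<mu>) = \<mu>"
  "x \<in># \<mu> \<Longrightarrow> dec_part (Suc x) (inc_part x \<mu>) = \<mu>"
  by (auto simp: inc_part_def dec_part_def)

lemma cross_sum_add:
  "cross_sum (add_mset x \<mu>) = cross_sum \<mu> + 2 * real x * real (\<Sum>\<^sub># \<mu>)"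
  by (simp add: cross_sum_def power2_eq_square algebra_simps)

lemma cross_sum_inc:
  assumes "x \<in># \<mu>"
  shows "cross_sum (inc_part x \<mu>) = cross_sum \<mu> + 2 * (real (\<Sum>\<^sub># \<mu>) - real x)"
proof -
  from assms obtain \<nu> where \<mu>: "\<mu> = add_mset x \<nu>" by (metis multi_member_split)
  show ?thesis unfolding \<mu> inc_part_def by (simp add: cross_sum_add algebra_simps)
qed

lemma sum_mset_weighted:
  "(\<Sum>x\<in>#\<mu>. a * real x + b * (real x)\<^sup>2 + c) =
     a * real (\<Sum>\<^sub># \<mu>) + b * ((real (\<Sum>\<^sub># \<mu>))\<^sup>2 - cross_sum \<mu>) + c * real (size \<mu>)"
  unfolding cross_sum_def by (induction \<mu>) (auto simp: algebra_simps)

lemma inc_part_simps: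
  assumes "x \<in># \<mu>"
  shows "size (inc_part x \<mu>) = size \<mu>" "\<Sum>\<^sub># (inc_part x \<mu>) = Suc (\<Sum>\<^sub># \<mu>)"
    "\<mu> \<in> parts_of n \<Longrightarrow> inc_part x \<mu> \<in> parts_of (Suc n)"
proof -
  from assms obtain \<nu> where \<mu>: "\<mu> = add_mset x \<nu>" by (metis multi_member_split)
  show "size (inc_part x \<mu>) = size \<mu>" "\<Sum>\<^sub># (inc_part x \<mu>) = Suc (\<Sum>\<^sub># \<mu>)"
    "\<mu> \<in> parts_of n \<Longrightarrow> inc_part x \<mu> \<in> parts_of (Suc n)"
    unfolding \<mu> inc_part_def parts_of_def by auto
qed

section \<open>The closed formula solves the growth recursion\<close>

definition prod_rising where "prod_rising \<alpha> \<mu> = (\<Prod>x\<in>#\<mu>. rising \<alpha> x)"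
definition prod_fact :: "nat multiset \<Rightarrow> real" where "prod_fact \<mu> = (\<Prod>x\<in>#\<mu>. fact x)"

lemma prod_fact_pos: "0 < prod_fact \<mu>"
  unfolding prod_fact_def by (induction \<mu>) auto

lemma prod_rising_inc:
  "x \<in># \<mu> \<Longrightarrow> x \<noteq> 0 \<Longrightarrow> prod_rising \<alpha> (inc_part x \<mu>) = prod_rising \<alpha> \<mu> * (real x - \<alpha>)"
  by (auto dest!: multi_member_split simp: prod_rising_def inc_part_def rising_Suc)

lemma prod_fact_inc:
  "x \<in># \<mu> \<Longrightarrow> prod_fact (inc_part x \<mu>) = prod_fact \<mu> * (real x + 1)"
  by (auto dest!: multi_member_split simp: prod_fact_def inc_part_def algebra_simps)

lemma ag_ppf_eq: "\<Sum>\<^sub># \<mu> = n \<Longrightarrow> ag_ppf \<alpha> \<gamma> \<mu> = 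
   (\<gamma> + (1 - \<alpha> - \<gamma>) * cross_sum \<mu> / (real n * (real n - 1))) * block_coeff \<alpha> \<gamma> (size \<mu>)
       * prod_rising \<alpha> \<mu> / rising \<alpha> n"
  by (simp add: ag_ppf_def prod_rising_def Let_def)

lemma multinom_eq: "\<Sum>\<^sub># \<mu> = n \<Longrightarrow> multinom \<mu> = fact n / prod_fact \<mu>"
  by (simp add: multinom_def prod_fact_def)

text \<open>Growing x - 1 to x multiplies \<open>prod_rising\<close> by x - 1 - \<alpha> and
  \<open>prod_fact\<close> by x. After this is pulled out, the summand is a constant times a
  quadratic polynomial in x, so the sum over the parts involves only their first two power
  sums.\<close>

lemma ag_comp_term:
  assumes "\<mu> \<in> parts_of (Suc n)" "x \<in># \<mu>" "x \<noteq> 1" "2 \<le> n" "\<alpha> < 1"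
  shows "(real x - 1 - \<alpha>) * (multinom (dec_part x \<mu>) * ag_ppf \<alpha> \<gamma> (dec_part x \<mu>)) =
    fact n * block_coeff \<alpha> \<gamma> (size \<mu>) * prod_rising \<alpha> \<mu> / (rising \<alpha> n * prod_fact \<mu>) *
      (real x * (\<gamma> + (1 - \<alpha> - \<gamma>) * (cross_sum \<mu> - 2 * (real n + 1 - real x)) / (real n * (real n - 1))))"
proof -
  define \<nu> where "\<nu> = dec_part x \<mu>"
  have x: "2 \<le> x" using assms by (cases x) (auto simp: parts_of_def)
  have x1: "x - 1 \<in># \<nu>" by (simp add: \<nu>_def dec_part_def)
  have \<mu>: "\<mu> = inc_part (x - 1) \<nu>" using inc_dec_part(1)[of x \<mu>] assms x by (simp add: \<nu>_def)
  have n: "\<Sum>\<^sub># \<nu> = n" using inc_part_simps(2)[OF x1] assms(1) \<mu> by (simp add: parts_of_def)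
  have eqs: "size \<mu> = size \<nu>" "prod_rising \<alpha> \<mu> = prod_rising \<alpha> \<nu> * (real x - 1 - \<alpha>)"
    "prod_fact \<mu> = prod_fact \<nu> * real x" "cross_sum \<mu> = cross_sum \<nu> + 2 * (real n + 1 - real x)"
    using inc_part_simps(1)[OF x1] prod_rising_inc[OF x1] prod_fact_inc[OF x1] cross_sum_inc[OF x1] x \<mu> n
    by (simp_all add: of_nat_diff)
  show ?thesis
    unfolding \<nu>_def[symmetric] ag_ppf_eq[OF n] multinom_eq[OF n] eqs using x
    by (simp add: mult_ac)
qed

lemma parts_of_size_2:
  assumes "\<mu> \<in> parts_of (Suc n)" "1 \<in># \<mu>" "size \<mu> = 2"
  shows "\<mu> = {#n, 1#}"
proof -
  obtain \<nu> where \<mu>: "\<mu> = add_mset 1 \<nu>" using assms(2) by (metis multi_member_split)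
  with assms(3) obtain y where "\<nu> = {#y#}" by (metis size_1_singleton_mset size_add_mset nat.inject numeral_2_eq_2 One_nat_def)
  with \<mu> assms(1) show ?thesis by (auto simp: parts_of_def)
qed

text \<open>The weight in front is the last factor of \<open>block_coeff\<close> for the larger
  partition. It is present only if at least two parts remain after deleting the singleton.\<close>

lemma ag_comp_term_1:
  assumes "\<mu> \<in> parts_of (Suc n)" "1 \<in># \<mu>" "size \<mu> \<noteq> 2" "2 \<le> n" "\<alpha> < 1"
  shows "((real (size \<mu>) - 2) * \<alpha> - \<gamma>) * (multinom (\<mu> - {#1#}) * ag_ppf \<alpha> \<gamma> (\<mu> - {#1#})) =
    fact n * block_coeff \<alpha> \<gamma> (size \<mu>) * prod_rising \<alpha> \<mu> / (rising \<alpha> n * prod_fact \<mu>) *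
      (\<gamma> + (1 - \<alpha> - \<gamma>) * (cross_sum \<mu> - 2 * real n) / (real n * (real n - 1)))"
proof -
  define \<nu> where "\<nu> = \<mu> - {#1#}"
  have \<mu>: "\<mu> = add_mset 1 \<nu>" using assms by (simp add: \<nu>_def)
  have n: "\<Sum>\<^sub># \<nu> = n" using assms(1) \<mu> by (simp add: parts_of_def)
  have "size \<mu> = Suc (size \<nu>)" "2 \<le> size \<nu>" using \<mu> assms by (auto simp: parts_of_def)
  then have "block_coeff \<alpha> \<gamma> (size \<mu>) = block_coeff \<alpha> \<gamma> (size \<nu>) * ((real (size \<mu>) - 2) * \<alpha> - \<gamma>)"
    by (simp add: block_coeff_Suc)
  then have bc: "block_coeff \<alpha> \<gamma> (size \<mu>) = block_coeff \<alpha> \<gamma> (size \<nu>) * ((real (size \<mu>) - 2) * \<alpha> - \<gamma>)" .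
  have "prod_rising \<alpha> \<mu> = prod_rising \<alpha> \<nu>" "prod_fact \<mu> = prod_fact \<nu>"
    using \<mu> by (simp_all add: prod_rising_def prod_fact_def)
  moreover have "cross_sum \<mu> = cross_sum \<nu> + 2 * real n"
    using \<mu> n by (simp add: cross_sum_add)
  ultimately show ?thesis
    unfolding \<nu>_def[symmetric] ag_ppf_eq[OF n] multinom_eq[OF n] bc
    by (simp add: mult_ac)
qed

lemma ag_comp_eq:
  assumes "\<alpha> < 1" "0 \<le> \<alpha>" "\<mu> \<in> parts_of n"
  shows "ag_comp \<alpha> \<gamma> n \<mu> = multinom \<mu> * ag_ppf \<alpha> \<gamma> \<mu>"
proof -
  have "2 \<le> n" using assms parts_of_ge_2 by blast
  then show ?thesis using assms(3)
  proof (induction n arbitrary: \<mu> rule: dec_induct)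
    case base
    then have "\<mu> = {#1, 1#}" by (simp add: parts_of_2)
    moreover have "rising \<alpha> 2 = 1 - \<alpha>" by (simp add: rising_def numeral_2_eq_2)
    ultimately show ?case using assms(1) unfolding ag_comp_2
      by (simp add: ag_ppf_def multinom_def cross_sum_def power2_eq_square Let_def numeral_2_eq_2 field_simps)
  next
    case (step n)
    define c where "c = fact n * block_coeff \<alpha> \<gamma> (size \<mu>) * prod_rising \<alpha> \<mu> / (rising \<alpha> n * prod_fact \<mu>)"
    define g where "g x = c * (real x * (\<gamma> + (1 - \<alpha> - \<gamma>) * (cross_sum \<mu> - 2 * (real n + 1 - real x)) / (real n * (real n - 1))))" for x
    define f where "f x = (if x = 1 then ((real (size \<mu>) - 2) * \<alpha> - \<gamma>) * ag_comp \<alpha> \<gamma> n (\<mu> - {#1#})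
                else (real x - 1 - \<alpha>) * ag_comp \<alpha> \<gamma> n (dec_part x \<mu>))" for x
    have n: "\<Sum>\<^sub># \<mu> = Suc n" using step.prems by (simp add: parts_of_def)
    have f1: "f x = g x" if "x \<in># \<mu>" "x \<noteq> 1" for x
    proof -
      have "dec_part x \<mu> \<in> parts_of n"
        using that step.prems by (auto dest!: multi_member_split simp: parts_of_def dec_part_def)
      then show ?thesis using that step ag_comp_term[OF step.prems that step.hyps(1) assms(1)]
        by (simp add: f_def g_def c_def)
    qed
    \<comment> \<open>A two-part split {n, 1} cannot come from adding a singleton to a split of n,
      since {n} alone is none. Exactly there the root edge term \<gamma> appears, and it equals the
      missing summand \<open>g 1\<close>.\<close>
    have sum_eq: "(\<Sum>x\<in>#\<mu>. f x) + (if \<mu> = {#n, 1#} then \<gamma> else 0) = (\<Sum>x\<in>#\<mu>. g x)"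
    proof (cases "size \<mu> = 2 \<and> 1 \<in># \<mu>")
      case True
      then have \<mu>: "\<mu> = {#n, 1#}" using parts_of_size_2 step.prems by auto
      have "ag_comp \<alpha> \<gamma> n {#n#} = 0" by (rule ag_comp_outside) (use step in \<open>auto simp: parts_of_def\<close>)
      then have "f 1 = 0" by (simp add: f_def \<mu>)
      moreover have "f n = g n" using f1[of n] step.hyps \<mu> by simp
      moreover have "g 1 = \<gamma>" 
      proof -
        have "c = 1" using rising_pos[OF assms(1)] \<mu> by (simp add: c_def prod_rising_def prod_fact_def less_imp_neq[symmetric])
        moreover have "cross_sum \<mu> = 2 * real n" by (simp add: \<mu> cross_sum_def power2_eq_square algebra_simps)
        ultimately show ?thesis using step.hyps by (simp add: g_def)
      qed
      ultimately show ?thesis using \<mu> by simp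
    next
      case False
      then have "\<mu> \<noteq> {#n, 1#}" by auto
      moreover have "f x = g x" if "x \<in># \<mu>" for x
      proof (cases "x = 1")
        case True
        have "2 < size \<mu>" using False that True step.prems by (auto simp: parts_of_def)
        then have "\<mu> - {#1#} \<in> parts_of n"
          using that True step.prems by (auto dest!: multi_member_split simp: parts_of_def)
        then show ?thesis using True that step ag_comp_term_1[OF step.prems _ _ step.hyps(1) assms(1), of \<gamma>] \<open>2 < size \<mu>\<close>
          by (simp add: f_def g_def c_def)
      qed (use f1 that in auto)
      ultimately show ?thesis by (simp cong: image_mset_cong)
    qed
    have n0: "real n - \<alpha> \<noteq> 0" "real n \<noteq> 0" "real n - 1 \<noteq> 0" using step.hyps assms by auto
    have "(real n - \<alpha>) * ag_comp \<alpha> \<gamma> (Suc n) \<mu> = (\<Sum>x\<in>#\<mu>. g x)"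
      using ag_comp_Suc[OF step.hyps(1) step.prems, of \<alpha> \<gamma>] sum_eq n0 unfolding f_def by simp
    also have "\<dots> = c * (\<Sum>x\<in>#\<mu>. (\<gamma> + (1 - \<alpha> - \<gamma>) * (cross_sum \<mu> - 2 * (real n + 1)) / (real n * (real n - 1))) * real x
         + (2 * (1 - \<alpha> - \<gamma>) / (real n * (real n - 1))) * (real x)\<^sup>2 + 0)"
      unfolding sum_mset_distrib_left g_def
      by (intro arg_cong[where f=sum_mset] image_mset_cong) (simp add: field_simps power2_eq_square n0 add_divide_distrib diff_divide_distrib)
    \<comment> \<open>The weighted sum reproduces the shape \<gamma> + \<delta> S / (N (N - 1)) with
      N replaced by N + 1. This is what singles out the quadratic statistic S in the
      solution.\<close>
    also have "\<dots> = c * ((\<gamma> + (1 - \<alpha> - \<gamma>) * cross_sum \<mu> / ((real n + 1) * real n)) * (real n + 1))"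
    proof -
      have "(\<gamma> + \<delta> * (S - 2 * (N + 1)) / (N * (N - 1))) * (N + 1) + 2 * \<delta> / (N * (N - 1)) * ((N + 1)\<^sup>2 - S)
         = (\<gamma> + \<delta> * S / ((N + 1) * N)) * (N + 1)" if "N > 1" for N \<delta> S :: real
        using that by (simp add: divide_simps power2_eq_square) algebra
      from this[of "real n" "1 - \<alpha> - \<gamma>" "cross_sum \<mu>"] show ?thesis
        unfolding sum_mset_weighted n using step.hyps by (simp add: add.commute)
    qed
    also have "\<dots> = (real n - \<alpha>) * (multinom \<mu> * ag_ppf \<alpha> \<gamma> \<mu>)"
      unfolding ag_ppf_eq[OF n] multinom_eq[OF n] c_def using n0 step.hyps
      by (simp add: rising_Suc add.commute[of 1] mult_ac)
    finally show ?case using n0 by simp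
  qed
qed

text \<open>The value at (n, 1) serves twice: in sampling consistency, for a leaf that is alone
  beside all others, and as the relative increment of the normalising constants.\<close>

lemma ag_ppf_pair:
  assumes "\<alpha> < 1" "1 \<le> n"
  shows "(real n - \<alpha>) * ag_ppf \<alpha> \<gamma> {#n, 1#} = \<gamma> + 2 * (1 - \<alpha> - \<gamma>) / (real n + 1)"
proof -
  have "cross_sum {#n, 1#} = 2 * real n" by (simp add: cross_sum_def power2_eq_square algebra_simps)
  moreover have "\<delta> * (2 * real n) / (real (Suc n) * (real (Suc n) - 1)) = 2 * \<delta> / (real n + 1)" for \<delta>
    using assms by (simp add: divide_simps)
  moreover have "rising \<alpha> (Suc n) = rising \<alpha> n * (real n - \<alpha>)" using assms by (simp add: rising_Suc)
  moreover have "rising \<alpha> n \<noteq> 0" "real n - \<alpha> \<noteq> 0" using assms rising_pos[OF assms(1), of n] by auto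
  moreover have "\<Sum>\<^sub># {#n, 1#} = Suc n" by simp
  moreover have "prod_rising \<alpha> {#n, 1#} = rising \<alpha> n" by (simp add: prod_rising_def)
  ultimately show ?thesis
    by (simp only: ag_ppf_eq size_add_mset size_empty block_coeff_simps) simp
qed

text \<open>Reading of the left side: the leaf to be removed lies in a larger part, or is a part of
  its own, or is alone beside the n others. In the last case the top branch point disappears and the
  split \<mu> moves up from the level below, hence the product.\<close>

lemma ag_ppf_sampling:
  assumes "\<alpha> < 1" "\<mu> \<in> parts_of n"
  shows "(\<Sum>x\<in>#\<mu>. ag_ppf \<alpha> \<gamma> (inc_part x \<mu>)) + ag_ppf \<alpha> \<gamma> (add_mset 1 \<mu>)
     + ag_ppf \<alpha> \<gamma> {#n, 1#} * ag_ppf \<alpha> \<gamma> \<mu> = ag_ppf \<alpha> \<gamma> \<mu>"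
proof -
  have n2: "2 \<le> n" using assms parts_of_ge_2 by blast
  have n: "\<Sum>\<^sub># \<mu> = n" using assms by (simp add: parts_of_def)
  have k: "2 \<le> size \<mu>" using assms by (simp add: parts_of_def)
  define c where "c = block_coeff \<alpha> \<gamma> (size \<mu>) * prod_rising \<alpha> \<mu> / rising \<alpha> n"
  define S where "S = cross_sum \<mu>"
  define \<delta> where "\<delta> = 1 - \<alpha> - \<gamma>"
  define N where "N = real n"
  define K where "K = real (size \<mu>)"
  have N: "2 \<le> N" "N - \<alpha> > 0" using n2 assms by (auto simp: N_def)
  have r: "rising \<alpha> n > 0" using rising_pos assms by blast
  have a0: "ag_ppf \<alpha> \<gamma> \<mu> = (\<gamma> + \<delta> * S / (N * (N - 1))) * c"
    unfolding ag_ppf_eq[OF n] by (simp add: S_def \<delta>_def N_def c_def)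
  have a1: "(N - \<alpha>) * ag_ppf \<alpha> \<gamma> (inc_part x \<mu>) = (real x - \<alpha>) * (\<gamma> + \<delta> * (S + 2 * (N - real x)) / ((N + 1) * N)) * c"
    if x: "x \<in># \<mu>" for x
  proof -
    have "x \<noteq> 0" using x assms(2) by (auto simp: parts_of_def intro: ccontr)
    then show ?thesis using N r n2
      unfolding ag_ppf_eq[OF inc_part_simps(2)[OF x]] n c_def inc_part_simps(1)[OF x] cross_sum_inc[OF x]
      by (simp add: prod_rising_inc[OF x] rising_Suc S_def \<delta>_def N_def n field_simps)
  qed
  have a2: "(N - \<alpha>) * ag_ppf \<alpha> \<gamma> (add_mset 1 \<mu>) = ((K - 1) * \<alpha> - \<gamma>) * (\<gamma> + \<delta> * (S + 2 * N) / ((N + 1) * N)) * c"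
  proof -
    have *: "\<Sum>\<^sub># (add_mset 1 \<mu>) = Suc n" using n by simp
    show ?thesis using N r n2 k
      unfolding ag_ppf_eq[OF *] c_def cross_sum_add
      by (simp add: prod_rising_def rising_Suc S_def \<delta>_def N_def n block_coeff_Suc K_def field_simps)
  qed
  have "(N - \<alpha>) * (\<Sum>x\<in>#\<mu>. ag_ppf \<alpha> \<gamma> (inc_part x \<mu>)) = (\<Sum>x\<in>#\<mu>. (N - \<alpha>) * ag_ppf \<alpha> \<gamma> (inc_part x \<mu>))"
    by (simp add: sum_mset_distrib_left)
  also have "\<dots> = (\<Sum>x\<in>#\<mu>. (real x - \<alpha>) * (\<gamma> + \<delta> * (S + 2 * (N - real x)) / ((N + 1) * N)) * c)"
    by (intro arg_cong[where f=sum_mset] image_mset_cong a1)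
  also have "\<dots> = (\<Sum>x\<in>#\<mu>. (c * (\<gamma> + \<delta> * (S + 2 * N + 2 * \<alpha>) / ((N + 1) * N))) * real x + (- c * 2 * \<delta> / ((N + 1) * N)) * (real x)\<^sup>2
       + (- \<alpha> * c * (\<gamma> + \<delta> * (S + 2 * N) / ((N + 1) * N))))"
    by (intro arg_cong[where f=sum_mset] image_mset_cong)
      (simp add: divide_inverse algebra_simps power2_eq_square)
  also have "\<dots> = c * ((\<gamma> + \<delta> * (S + 2 * N + 2 * \<alpha>) / ((N + 1) * N)) * N - 2 * \<delta> / ((N + 1) * N) * (N\<^sup>2 - S)
      - \<alpha> * (\<gamma> + \<delta> * (S + 2 * N) / ((N + 1) * N)) * K)"
    unfolding sum_mset_weighted n by (simp add: S_def N_def K_def divide_inverse algebra_simps)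
  finally have a3: "(N - \<alpha>) * (\<Sum>x\<in>#\<mu>. ag_ppf \<alpha> \<gamma> (inc_part x \<mu>)) = \<dots>" .
  have "(N - \<alpha>) * (ag_ppf \<alpha> \<gamma> {#n, 1#} * ag_ppf \<alpha> \<gamma> \<mu>) = (\<gamma> + 2 * \<delta> / (N + 1)) * ((\<gamma> + \<delta> * S / (N * (N - 1))) * c)"
    using ag_ppf_pair[OF assms(1), of n \<gamma>] n2 a0 by (simp add: \<delta>_def N_def)
  note a4 = a3 a2 this
  have "(N - \<alpha>) * ((\<Sum>x\<in>#\<mu>. ag_ppf \<alpha> \<gamma> (inc_part x \<mu>)) + ag_ppf \<alpha> \<gamma> (add_mset 1 \<mu>)
     + ag_ppf \<alpha> \<gamma> {#n, 1#} * ag_ppf \<alpha> \<gamma> \<mu>) = (N - \<alpha>) * ag_ppf \<alpha> \<gamma> \<mu>"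
  proof -
    \<comment> \<open>The terms in the number of parts K cancel: every existing part gives up
      \<alpha>, and opening a new part gains \<alpha> for each existing one.\<close>
    have "(\<gamma> + \<delta> * (S + 2 * N + 2 * \<alpha>) / ((N + 1) * N)) * N - 2 * \<delta> / ((N + 1) * N) * (N\<^sup>2 - S)
      - \<alpha> * (\<gamma> + \<delta> * (S + 2 * N) / ((N + 1) * N)) * K +
       ((K - 1) * \<alpha> - \<gamma>) * (\<gamma> + \<delta> * (S + 2 * N) / ((N + 1) * N)) +
       (\<gamma> + 2 * \<delta> / (N + 1)) * (\<gamma> + \<delta> * S / (N * (N - 1))) = (N - \<alpha>) * (\<gamma> + \<delta> * S / (N * (N - 1)))"
      using N unfolding \<delta>_def by (simp add: divide_simps power2_eq_square) algebra
    note key = arg_cong[OF this, of "\<lambda>z. z * c"]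
    show ?thesis
      unfolding distrib_left[of "N - \<alpha>"] a4(1) a4(2) a4(3) unfolding a0
      by (rule trans[OF _ trans[OF key]]) (simp_all only: distrib_right distrib_left mult_ac)
  qed
  then show ?thesis using N by simp
qed

section \<open>Passage to \<alpha> = 1\<close>

lemma multinom_inc:
  "x \<in># \<mu> \<Longrightarrow> \<Sum>\<^sub># \<mu> = n \<Longrightarrow> (real x + 1) * multinom (inc_part x \<mu>) = (real n + 1) * multinom \<mu>"
  using prod_fact_pos[of \<mu>]
  by (simp add: multinom_eq[OF refl] inc_part_simps prod_fact_inc divide_simps)

text \<open>The denominators m + 2 - \<alpha> are at least 1 on \<open>{..1}\<close>, whereas those
  of the closed formula contain the factor 1 - \<alpha>.\<close>

lemma continuous_ag_comp_rec:
  "continuous_on {..1} (\<lambda>\<alpha>. ag_comp_rec \<alpha> \<gamma> m \<mu>)"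
proof (induction m arbitrary: \<mu>)
  case (Suc m)
  have *: "continuous_on {..1} (\<lambda>\<alpha>. \<Sum>x\<in>#\<mu>. f x \<alpha>)" if "\<And>x. continuous_on {..1} (f x)"
    for f :: "nat \<Rightarrow> real \<Rightarrow> real" and \<mu>
    using that by (induction \<mu>) (auto intro!: continuous_intros)
  have **: "continuous_on {..1} (\<lambda>\<alpha>. if b then f \<alpha> else g \<alpha>)" if "continuous_on {..1} f" "continuous_on {..1} g"
    for f g :: "real \<Rightarrow> real" and b using that by (cases b) auto
  show ?case unfolding ag_comp_rec.simps
    by (intro ** * continuous_intros Suc) auto
qed auto

text \<open>\<open>ag_ppf_sampling\<close> multiplied by (n + 1) times the multinomial coefficient.
  The weights x + 1 come from \<open>multinom_inc\<close>; they count the leaves of the enlarged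
  part, each of which may be the one removed.\<close>

lemma ag_comp_sampling:
  assumes "0 \<le> \<alpha>" "\<alpha> \<le> 1" "\<mu> \<in> parts_of n"
  shows "(\<Sum>x\<in>#\<mu>. (real x + 1) * ag_comp \<alpha> \<gamma> (Suc n) (inc_part x \<mu>)) + ag_comp \<alpha> \<gamma> (Suc n) (add_mset 1 \<mu>)
     + ag_comp \<alpha> \<gamma> (Suc n) {#n, 1#} * ag_comp \<alpha> \<gamma> n \<mu> = (real n + 1) * ag_comp \<alpha> \<gamma> n \<mu>" (is "?L \<alpha> = ?R \<alpha>")
proof -
  have n2: "2 \<le> n" using assms parts_of_ge_2 by blast
  have n: "\<Sum>\<^sub># \<mu> = n" using assms by (simp add: parts_of_def)
  have 1: "?L \<alpha> = ?R \<alpha>" if \<alpha>: "0 \<le> \<alpha>" "\<alpha> < 1" for \<alpha>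
  proof -
    have "ag_comp \<alpha> \<gamma> n \<mu> = multinom \<mu> * ag_ppf \<alpha> \<gamma> \<mu>"
      using ag_comp_eq \<alpha> assms by blast
    moreover have "ag_comp \<alpha> \<gamma> (Suc n) {#n, 1#} = (real n + 1) * ag_ppf \<alpha> \<gamma> {#n, 1#}"
    proof -
      have "{#n, 1#} \<in> parts_of (Suc n)" using n2 by (auto simp: parts_of_def)
      moreover have "multinom {#n, 1#} = real n + 1" by (simp add: multinom_def)
      ultimately show ?thesis using ag_comp_eq \<alpha> by metis
    qed
    moreover have "ag_comp \<alpha> \<gamma> (Suc n) (add_mset 1 \<mu>) = (real n + 1) * multinom \<mu> * ag_ppf \<alpha> \<gamma> (add_mset 1 \<mu>)"
    proof -
      have "add_mset 1 \<mu> \<in> parts_of (Suc n)" using assms by (auto simp: parts_of_def)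
      moreover have "multinom (add_mset 1 \<mu>) = (real n + 1) * multinom \<mu>" using n by (simp add: multinom_def)
      ultimately show ?thesis using ag_comp_eq \<alpha> by metis
    qed
    moreover have "(\<Sum>x\<in>#\<mu>. (real x + 1) * ag_comp \<alpha> \<gamma> (Suc n) (inc_part x \<mu>)) =
        (real n + 1) * multinom \<mu> * (\<Sum>x\<in>#\<mu>. ag_ppf \<alpha> \<gamma> (inc_part x \<mu>))"
      unfolding sum_mset_distrib_left
      by (intro arg_cong[where f=sum_mset] image_mset_cong)
        (use ag_comp_eq \<alpha> inc_part_simps(3) multinom_inc n assms(3) in \<open>simp add: mult.assoc[symmetric]\<close>)
    ultimately have "?L \<alpha> = (real n + 1) * multinom \<mu> * ((\<Sum>x\<in>#\<mu>. ag_ppf \<alpha> \<gamma> (inc_part x \<mu>)) + ag_ppf \<alpha> \<gamma> (add_mset 1 \<mu>)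
     + ag_ppf \<alpha> \<gamma> {#n, 1#} * ag_ppf \<alpha> \<gamma> \<mu>)"
      by (simp add: algebra_simps)
    also have "\<dots> = ?R \<alpha>" unfolding ag_ppf_sampling[OF \<alpha>(2) assms(3)]
      using \<open>ag_comp \<alpha> \<gamma> n \<mu> = multinom \<mu> * ag_ppf \<alpha> \<gamma> \<mu>\<close> by simp
    finally show ?thesis .
  qed
  have *: "continuous_on {..1} (\<lambda>\<alpha>. \<Sum>x\<in>#\<mu>. f x \<alpha>)" if "\<And>x. continuous_on {..1} (f x)"
    for f :: "nat \<Rightarrow> real \<Rightarrow> real" and \<mu>
    using that by (induction \<mu>) (auto intro!: continuous_intros)
  \<comment> \<open>The difference of both sides is continuous up to \<alpha> = 1 and vanishes on
    [0, 1), so it vanishes in the left limit.\<close>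
  have "continuous_on {..1} (\<lambda>\<alpha>. ?L \<alpha> - ?R \<alpha>)"
    unfolding ag_comp_def by (intro * continuous_intros continuous_ag_comp_rec)
  then have "((\<lambda>\<alpha>. ?L \<alpha> - ?R \<alpha>) \<longlongrightarrow> ?L 1 - ?R 1) (at 1 within {..1})"
    unfolding continuous_on_def by (rule bspec) auto
  then have t: "((\<lambda>\<alpha>. ?L \<alpha> - ?R \<alpha>) \<longlongrightarrow> ?L 1 - ?R 1) (at_left 1)"
    by (rule tendsto_within_subset) auto
  have ev: "\<forall>\<^sub>F \<alpha> in at_left (1::real). ?L \<alpha> - ?R \<alpha> = 0"
    using eventually_at_left_field[of _ "1::real"] 1 by (intro iffD2[OF eventually_at_left_field] exI[of _ 0]) simp
  have "((\<lambda>\<alpha>. 0) \<longlongrightarrow> ?L 1 - ?R 1) (at_left (1::real))"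
    by (rule Lim_transform_eventually[OF t ev])
  then have "?L 1 - ?R 1 = 0" by (simp add: tendsto_const_iff)
  then show ?thesis using 1 assms by (cases "\<alpha> = 1") auto
qed

section \<open>The first split of alpha-gamma trees\<close>

primrec labels :: "'a rtree \<Rightarrow> 'a multiset" where
  "labels (Leaf a) = {#a#}"
| "labels (Branch ts) = \<Sum>\<^sub># (image_mset labels ts)"

primrec proper :: "'a rtree \<Rightarrow> bool" where
  "proper (Leaf a) = True"
| "proper (Branch ts) = (2 \<le> size ts \<and> (\<forall>b\<in>#image_mset proper ts. b))"

text \<open>\<open>replace_subtree\<close> acts on all occurrences of a subtree. Distinct labels,
  together with the fact that every proper subtree has a label, guarantee that there is only
  one.\<close>

definition good :: "'a rtree \<Rightarrow> bool" where
  "good t \<longleftrightarrow> proper t \<and> (\<forall>a. count (labels t) a \<le> 1)"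

text \<open>Together with \<open>grown_site\<close> this describes both kinds of insertion as one
  replacement, so that edges and branch points can be treated alike.\<close>

definition site_tree :: "'a site \<Rightarrow> 'a rtree" where
  "site_tree c = (case c of Edge u \<Rightarrow> u | Vertex ts \<Rightarrow> Branch ts)"

definition grown_site :: "'a \<Rightarrow> 'a site \<Rightarrow> 'a rtree" where
  "grown_site a c = (case c of Edge u \<Rightarrow> Branch {#u, Leaf a#} | Vertex ts \<Rightarrow> Branch (add_mset (Leaf a) ts))"

definition component_sizes :: "'a rtree \<Rightarrow> nat multiset" where
  "component_sizes t = (case t of Leaf a \<Rightarrow> {#} | Branch ts \<Rightarrow> image_mset num_leaves ts)"

definition multiplicity_fact :: "'a multiset \<Rightarrow> real" where
  "multiplicity_fact \<mu> = (\<Prod>x\<in>set_mset \<mu>. fact (count \<mu> x))"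

section \<open>Leaf insertion in trees with distinct labels\<close>

lemma component_sizes_Branch [simp]: "component_sizes (Branch ts) = image_mset num_leaves ts"
  by (simp add: component_sizes_def)

lemma insert_leaf_eq: "insert_leaf a t c = replace_subtree (site_tree c) (grown_site a c) t"
  by (cases c) (auto simp: site_tree_def grown_site_def)

lemma sites_eq: "c \<in> sites t \<longleftrightarrow> site_tree c \<in> subtrees t"
  by (cases c) (auto simp: sites_def site_tree_def)

lemma self_subtree [simp]: "t \<in> subtrees t"
  by (cases t) auto

lemma labels_subset_sum: "u \<in># ts \<Longrightarrow> labels u \<subseteq># \<Sum>\<^sub># (image_mset labels ts)"
  by (auto dest!: multi_member_split)

lemma subtrees_labels: "v \<in> subtrees t \<Longrightarrow> labels v \<subseteq># labels t"
proof (induction t)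
  case (Branch ts)
  then show ?case using labels_subset_sum by (fastforce intro: subset_mset.order_trans)
qed auto

lemma subtrees_proper: "v \<in> subtrees t \<Longrightarrow> proper t \<Longrightarrow> proper v"
  by (induction t) auto

lemma labels_nonempty: "proper t \<Longrightarrow> labels t \<noteq> {#}"
proof (induction t)
  case (Branch ts)
  then obtain u where "u \<in># ts" by (cases ts) auto
  then show ?case using Branch labels_subset_sum[of u ts] by auto
qed auto

lemma size_labels: "size (labels t) = num_leaves t"
proof (induction t)
  case (Branch ts)
  then have "(\<Sum>u\<in>#ts. size (labels u)) = (\<Sum>u\<in>#ts. num_leaves u)"
    by (intro arg_cong[where f=sum_mset] image_mset_cong) auto
  then show ?case by (simp add: multiset.map_comp comp_def)
qed auto

lemma num_leaves_pos: "proper t \<Longrightarrow> 0 < num_leaves t"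
  using labels_nonempty[of t] size_labels[of t] by (metis gr0I size_eq_0_iff_empty)

lemma good_child:
  assumes "good (Branch ts)" "u \<in># ts"
  shows "good u"
proof -
  have "count (labels u) a \<le> count (labels (Branch ts)) a" for a
    using labels_subset_sum[OF assms(2)] by (simp add: mset_subset_eq_count)
  then show ?thesis using assms unfolding good_def by (auto intro: order_trans)
qed

text \<open>A common subtree of two children would carry a label, and that label would be counted
  twice in the whole tree.\<close>

lemma good_disjoint:
  assumes "good (Branch ts)" "u \<in># ts" "u' \<in># ts - {#u#}" "v \<in> subtrees u"
  shows "v \<notin> subtrees u'"
proof
  assume v: "v \<in> subtrees u'"
  have "proper v" using assms good_child[OF assms(1,2)] subtrees_proper by (auto simp: good_def)
  then obtain a where a: "a \<in># labels v" using labels_nonempty by fastforce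
  obtain ts' where "ts = add_mset u (add_mset u' ts')"
    using assms(2,3) by (metis insert_DiffM)
  then have "count (labels u) a + count (labels u') a \<le> count (labels (Branch ts)) a" by simp
  also have "\<dots> \<le> 1" using assms(1) by (simp add: good_def)
  finally have "count (labels u) a + count (labels u') a \<le> 1" .
  moreover have "a \<in># labels u" "a \<in># labels u'"
    using a v assms(4) subtrees_labels by (meson mset_subset_eqD)+
  then have "count (labels u) a \<ge> 1" "count (labels u') a \<ge> 1"
    by (simp_all add: Suc_leI)
  ultimately show False by linarith
qed

lemma good_count:
  assumes "good (Branch ts)"
  shows "count ts u \<le> 1"
proof (rule ccontr)
  assume *: "\<not> count ts u \<le> 1"
  then have "u \<in># ts" by (metis count_eq_zero_iff zero_le)
  moreover have "u \<in># ts - {#u#}" using * by (simp add: in_diff_count)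
  ultimately show False using good_disjoint[OF assms, of u u u] by simp
qed

text \<open>By counting leaves: a subtree of u has at most as many leaves as u, while the whole tree
  has at least one more, in a sibling of u.\<close>

lemma good_root:
  assumes "good (Branch ts)" "u \<in># ts"
  shows "Branch ts \<notin> subtrees u"
proof
  assume "Branch ts \<in> subtrees u"
  from size_mset_mono[OF subtrees_labels[OF this]] have "num_leaves (Branch ts) \<le> num_leaves u"
    by (simp add: size_labels del: labels.simps num_leaves.simps)
  moreover obtain ts' where ts: "ts = add_mset u ts'" using assms(2) by (metis insert_DiffM)
  moreover from this obtain u' where u': "u' \<in># ts'" using assms(1) by (cases ts') (auto simp: good_def)
  moreover have "0 < num_leaves u'" using num_leaves_pos[of u'] assms u' ts by (auto simp: good_def)
  ultimately show False by (auto dest!: multi_member_split)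
qed

lemma replace_subtree_notin: "v \<notin> subtrees t \<Longrightarrow> replace_subtree v w t = t"
proof (induction t)
  case (Branch ts)
  then have "image_mset (replace_subtree v w) ts = image_mset (\<lambda>t. t) ts"
    by (intro image_mset_cong) auto
  then show ?case using Branch by auto
qed auto

text \<open>The site occurs neither at the root (\<open>good_root\<close>) nor in a sibling of u
  (\<open>good_disjoint\<close>), so the replacement leaves everything but u untouched.\<close>

lemma insert_leaf_child:
  assumes "good (Branch ts)" "u \<in># ts" "c \<in> sites u"
  shows "insert_leaf a (Branch ts) c = Branch (add_mset (insert_leaf a u c) (ts - {#u#}))"
proof -
  have c: "site_tree c \<in> subtrees u" using assms(3) by (simp add: sites_eq)
  then have ne: "Branch ts \<noteq> site_tree c" using good_root[OF assms(1,2)] by auto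
  have "image_mset (replace_subtree (site_tree c) (grown_site a c)) (ts - {#u#}) = image_mset (\<lambda>t. t) (ts - {#u#})"
    using good_disjoint[OF assms(1,2) _ c] by (intro image_mset_cong replace_subtree_notin)
  moreover obtain ts' where "ts = add_mset u ts'" using assms(2) by (metis insert_DiffM)
  ultimately show ?thesis unfolding insert_leaf_eq using ne by simp
qed

lemma insert_leaf_root:
  "insert_leaf a t (Edge t) = Branch {#t, Leaf a#}"
  "insert_leaf a (Branch ts) (Vertex ts) = Branch (add_mset (Leaf a) ts)"
  by (cases t) simp_all

lemma sites_Leaf: "sites (Leaf a) = {Edge (Leaf a)}"
  by (auto simp: sites_def)

lemma sites_Branch:
  "sites (Branch ts) = {Edge (Branch ts), Vertex ts} \<union> (\<Union>u\<in>set_mset ts. sites u)"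
proof (rule set_eqI)
  fix c show "c \<in> sites (Branch ts) \<longleftrightarrow> c \<in> {Edge (Branch ts), Vertex ts} \<union> (\<Union>u\<in>set_mset ts. sites u)"
    unfolding sites_eq Un_iff UN_iff by (cases c) (auto simp: site_tree_def)
qed

lemma finite_sites [simp]: "finite (sites t)"
  by (induction t) (auto simp: sites_Leaf sites_Branch)

lemma sum_mset_distinct:
  assumes "\<And>u. count ts u \<le> 1"
  shows "(\<Sum>u\<in>#ts. f u) = (\<Sum>u\<in>set_mset ts. f u)"
proof -
  have "count (mset_set (set_mset ts)) u = count ts u" for u
  proof (cases "u \<in># ts")
    case True
    then have "count ts u = 1" using assms[of u] count_greater_zero_iff[of ts u] by linarith
    then show ?thesis using True by simp
  qed (simp add: not_in_iff)
  then have "mset_set (set_mset ts) = ts" by (rule multiset_eqI)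
  then show ?thesis by (simp add: sum_unfold_sum_mset)
qed

lemma sum_mset_count:
  "(\<Sum>x\<in>#\<mu>. f x) = (\<Sum>x\<in>set_mset \<mu>. real (count \<mu> x) * f x)"
proof (induction \<mu>)
  case (add y \<mu>)
  have "(\<Sum>x\<in>insert y (set_mset \<mu>). real (count (add_mset y \<mu>) x) * f x) =
      (\<Sum>x\<in>insert y (set_mset \<mu>). real (count \<mu> x) * f x + (if x = y then f y else 0))"
    by (intro sum.cong) (auto simp: algebra_simps)
  also have "\<dots> = (\<Sum>x\<in>insert y (set_mset \<mu>). real (count \<mu> x) * f x) + f y"
    by (simp add: sum.distrib del: sum.insert_if)
  also have "(\<Sum>x\<in>insert y (set_mset \<mu>). real (count \<mu> x) * f x) = (\<Sum>x\<in>set_mset \<mu>. real (count \<mu> x) * f x)"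
    by (intro sum.mono_neutral_right) (auto simp: not_in_iff)
  finally show ?case using add by simp
qed simp

text \<open>Distinct labels enter twice: no child has multiplicity above 1, and different children
  have disjoint sets of sites.\<close>

lemma sum_sites_Branch:
  fixes f :: "'a site \<Rightarrow> real"
  assumes "good (Branch ts)"
  shows "(\<Sum>c\<in>sites (Branch ts). f c) = f (Edge (Branch ts)) + f (Vertex ts) + (\<Sum>u\<in>#ts. \<Sum>c\<in>sites u. f c)"
proof -
  have "(\<Sum>u\<in>#ts. \<Sum>c\<in>sites u. f c) = (\<Sum>u\<in>set_mset ts. \<Sum>c\<in>sites u. f c)"
    using good_count[OF assms] by (rule sum_mset_distinct)
  also have "\<dots> = (\<Sum>c\<in>(\<Union>u\<in>set_mset ts. sites u). f c)"
  proof (rule sum.UNION_disjoint[symmetric])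
    show "\<forall>u\<in>set_mset ts. \<forall>u'\<in>set_mset ts. u \<noteq> u' \<longrightarrow> sites u \<inter> sites u' = {}"
    proof (intro ballI impI)
      fix u u' assume *: "u \<in># ts" "u' \<in># ts" "u \<noteq> u'"
      then have "u' \<in># ts - {#u#}" by (simp add: in_diff_count)
      then show "sites u \<inter> sites u' = {}"
        using good_disjoint[OF assms *(1), of u'] by (auto simp: sites_eq)
    qed
  qed auto
  finally have *: "(\<Sum>u\<in>#ts. \<Sum>c\<in>sites u. f c) = (\<Sum>c\<in>(\<Union>u\<in>set_mset ts. sites u). f c)" .
  have "Edge (Branch ts) \<notin> (\<Union>u\<in>set_mset ts. sites u)" "Vertex ts \<notin> (\<Union>u\<in>set_mset ts. sites u)"
    using good_root[OF assms] by (auto simp: sites_eq site_tree_def)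
  then show ?thesis unfolding sites_Branch * by (subst sum.union_disjoint) auto
qed

text \<open>At a branch point with k children, \<gamma> of the edge above cancels - \<gamma> of the
  vertex, and (k - 1) \<alpha> offsets all but one of the k terms - \<alpha> contributed by the
  children.\<close>

lemma sum_site_weight: "good t \<Longrightarrow> (\<Sum>c\<in>sites t. site_weight \<alpha> \<gamma> c) = real (num_leaves t) - \<alpha>"
proof (induction t)
  case (Branch ts)
  have "(\<Sum>u\<in>#ts. \<Sum>c\<in>sites u. site_weight \<alpha> \<gamma> c) = (\<Sum>u\<in>#ts. real (num_leaves u) - \<alpha>)"
    using Branch.IH good_child[OF Branch.prems] by (intro arg_cong[where f=sum_mset] image_mset_cong) auto
  also have "\<dots> = real (\<Sum>u\<in>#ts. num_leaves u) - \<alpha> * size ts"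
    by (induction ts) (auto simp: algebra_simps)
  finally show ?case unfolding sum_sites_Branch[OF Branch.prems]
    by (simp add: algebra_simps)
qed (simp add: sites_Leaf)

text \<open>At least two children give a branch point the weight \<alpha> - \<gamma> or
  more.\<close>

lemma site_weight_nonneg:
  assumes "0 \<le> \<alpha>" "\<alpha> \<le> 1" "0 \<le> \<gamma>" "\<gamma> \<le> \<alpha>" "proper t" "c \<in> sites t"
  shows "0 \<le> site_weight \<alpha> \<gamma> c"
proof (cases c)
  case (Edge u)
  then show ?thesis using assms by (cases u) auto
next
  case (Vertex ts)
  then have "Branch ts \<in> subtrees t" using assms(6) by (simp add: sites_eq site_tree_def)
  then have "proper (Branch ts)" using subtrees_proper assms(5) by blast
  then have "2 \<le> real (size ts)" by simp
  then have "1 * \<alpha> \<le> (real (size ts) - 1) * \<alpha>" using assms by (intro mult_right_mono) auto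
  then show ?thesis using assms Vertex by simp
qed

lemma insert_leaf_labels_proper:
  "good t \<Longrightarrow> c \<in> sites t \<Longrightarrow> labels (insert_leaf a t c) = add_mset a (labels t) \<and> proper (insert_leaf a t c)"
proof (induction t)
  case (Leaf b)
  then show ?case by (simp add: sites_Leaf insert_leaf_root)
next
  case (Branch ts)
  consider "c = Edge (Branch ts)" | "c = Vertex ts" | u where "u \<in># ts" "c \<in> sites u"
    using Branch.prems(2) by (auto simp: sites_Branch)
  then show ?case
  proof cases
    case 1
    then show ?thesis using Branch.prems by (simp only: insert_leaf_root) (simp add: good_def)
  next
    case 2
    then show ?thesis using Branch.prems by (simp only: insert_leaf_root) (simp add: good_def)
  next
    case 3
    then obtain ts' where ts: "ts = add_mset u ts'" by (metis insert_DiffM)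
    have "labels (insert_leaf a u c) = add_mset a (labels u) \<and> proper (insert_leaf a u c)"
      using Branch.IH[OF 3(1) good_child[OF Branch.prems(1) 3(1)] 3(2)] .
    then show ?thesis unfolding insert_leaf_child[OF Branch.prems(1) 3] using Branch.prems(1)
      by (simp add: ts good_def)
  qed
qed

lemma num_leaves_insert_leaf:
  "good t \<Longrightarrow> c \<in> sites t \<Longrightarrow> num_leaves (insert_leaf a t c) = Suc (num_leaves t)"
  using insert_leaf_labels_proper[of t c a] by (metis size_labels size_add_mset)

lemma pmf_weighted_pmf:
  assumes "finite A" "\<And>x. x \<in> A \<Longrightarrow> 0 \<le> w x" "0 < (\<Sum>y\<in>A. w y)"
  shows "pmf (weighted_pmf A w) x = (if x \<in> A then w x / (\<Sum>y\<in>A. w y) else 0)"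
  unfolding weighted_pmf_def
proof (rule pmf_embed_pmf)
  show "0 \<le> (if x \<in> A then w x / sum w A else 0)" for x using assms by auto
  have "(\<integral>\<^sup>+ x. ennreal (if x \<in> A then w x / sum w A else 0) \<partial>count_space UNIV)
      = (\<Sum>x\<in>A. ennreal (if x \<in> A then w x / sum w A else 0))"
    using assms(1) by (intro nn_integral_count_space') auto
  also have "\<dots> = ennreal (\<Sum>x\<in>A. w x / sum w A)"
    using assms by (subst sum_ennreal[symmetric]) (auto intro!: sum.cong)
  also have "(\<Sum>x\<in>A. w x / sum w A) = 1" using assms by (simp add: sum_divide_distrib[symmetric])
  finally show "(\<integral>\<^sup>+ x. ennreal (if x \<in> A then w x / sum w A else 0) \<partial>count_space UNIV) = 1" by simp
qed

lemma expectation_of_bool: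
  "measure_pmf.expectation p (\<lambda>x. of_bool (f x = y)) = pmf (map_pmf f p) y"
proof -
  have "(\<lambda>x. of_bool (f x = y) :: real) = indicator (f -` {y})" by (auto simp: indicator_def)
  then show ?thesis by (simp add: pmf_map)
qed

section \<open>The Markov chain of first splits\<close>

locale alpha_gamma =
  fixes \<alpha> \<gamma> :: real
  assumes ag: "0 \<le> \<alpha>" "\<alpha> \<le> 1" "0 \<le> \<gamma>" "\<gamma> \<le> \<alpha>"
begin

lemma pmf_sites:
  assumes "good t" "2 \<le> num_leaves t"
  shows "pmf (weighted_pmf (sites t) (site_weight \<alpha> \<gamma>)) c =
    (if c \<in> sites t then site_weight \<alpha> \<gamma> c / (real (num_leaves t) - \<alpha>) else 0)"
  using assms ag site_weight_nonneg[OF ag]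
  by (subst pmf_weighted_pmf) (auto simp: good_def sum_site_weight[OF assms(1)])

lemma set_pmf_sites:
  assumes "good t" "2 \<le> num_leaves t"
  shows "set_pmf (weighted_pmf (sites t) (site_weight \<alpha> \<gamma>)) \<subseteq> sites t"
  using pmf_sites[OF assms] by (auto simp: set_pmf_eq split: if_splits)


lemma ag_tree_Suc:
  assumes "2 \<le> n"
  shows "ag_tree \<alpha> \<gamma> (Suc n) = bind_pmf (ag_tree \<alpha> \<gamma> n) (\<lambda>t.
       map_pmf (insert_leaf (Suc n) t) (weighted_pmf (sites t) (site_weight \<alpha> \<gamma>)))"
proof -
  obtain m where "n = Suc (Suc m)" using assms by (metis Suc_le_D numeral_2_eq_2 Suc_le_mono)
  then show ?thesis by (simp add: numeral_3_eq_3)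
qed

lemma ag_tree_2: "ag_tree \<alpha> \<gamma> 2 = return_pmf (Branch {#Leaf 1, Leaf 2#})"
  by (simp add: numeral_2_eq_2)

lemma ag_tree_support:
  assumes "2 \<le> n" "t \<in> set_pmf (ag_tree \<alpha> \<gamma> n)"
  shows "good t" "labels t = mset_set {1..n}" "num_leaves t = n" "\<exists>ts. t = Branch ts"
proof -
  have "good t \<and> labels t = mset_set {1..n}"
    using assms
  proof (induction n arbitrary: t rule: dec_induct)
    case base
    then show ?case by (auto simp: ag_tree_2 good_def numeral_2_eq_2 atLeastAtMostSuc_conv)
  next
    case (step n)
    then obtain s c where s: "s \<in> set_pmf (ag_tree \<alpha> \<gamma> n)"
      "c \<in> set_pmf (weighted_pmf (sites s) (site_weight \<alpha> \<gamma>))" "t = insert_leaf (Suc n) s c"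
      by (auto simp: ag_tree_Suc)
    have g: "good s" "labels s = mset_set {1..n}" using step.IH[OF s(1)] by auto
    have "num_leaves s = n" using g size_labels[of s] by simp
    then have "c \<in> sites s" using set_pmf_sites[OF g(1)] s(2) step.hyps by auto
    then have "labels t = add_mset (Suc n) (labels s)" "proper t"
      using insert_leaf_labels_proper[OF g(1)] s(3) by auto
    moreover have "mset_set {1..Suc n} = add_mset (Suc n) (mset_set {1..n})"
      by (simp add: atLeastAtMostSuc_conv)
    moreover have "count (mset_set {1..Suc n}) a \<le> 1" for a by (simp add: count_mset_set')
    ultimately show ?case using g by (simp add: good_def)
  qed
  then show *: "good t" "labels t = mset_set {1..n}" by auto
  show n: "num_leaves t = n" using * size_labels[of t] by simp
  show "\<exists>ts. t = Branch ts" using n assms(1) by (cases t) auto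
qed

lemma finite_ag_tree: "2 \<le> n \<Longrightarrow> finite (set_pmf (ag_tree \<alpha> \<gamma> n))"
proof (induction n rule: dec_induct)
  case (step n)
  have "finite (set_pmf (weighted_pmf (sites t) (site_weight \<alpha> \<gamma>)))" if "t \<in> set_pmf (ag_tree \<alpha> \<gamma> n)" for t
    using set_pmf_sites[of t] ag_tree_support[OF step.hyps(1) that] step.hyps finite_subset finite_sites by metis
  then show ?case using step by (auto simp: ag_tree_Suc)
qed (simp add: ag_tree_2)

text \<open>Transition weights, still to be divided by n - \<alpha>. The three terms belong to the
  root edge, to the top branch point, and to the sites inside the components.\<close>

definition split_kernel :: "nat multiset \<Rightarrow> nat multiset \<Rightarrow> real" where
  "split_kernel \<mu> \<mu>' = \<gamma> * of_bool ({#\<Sum>\<^sub># \<mu>, 1#} = \<mu>') + ((real (size \<mu>) - 1) * \<alpha> - \<gamma>) * of_bool (add_mset 1 \<mu> = \<mu>')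
    + (\<Sum>m\<in>#\<mu>. (real m - \<alpha>) * of_bool (inc_part m \<mu> = \<mu>'))"

text \<open>All sites inside one component lead to the same new split, so only their total weight
  matters, and \<open>sum_site_weight\<close> gives it. Hence the first split is a Markov chain by
  itself.\<close>

lemma sum_split_transition:
  assumes "good t" "t = Branch ts"
  shows "(\<Sum>c\<in>sites t. site_weight \<alpha> \<gamma> c * of_bool (component_sizes (insert_leaf a t c) = \<mu>'))
    = split_kernel (component_sizes t) \<mu>'"
proof -
  have "(\<Sum>c\<in>sites u. site_weight \<alpha> \<gamma> c * of_bool (component_sizes (insert_leaf a t c) = \<mu>')) =
      (real (num_leaves u) - \<alpha>) * of_bool (inc_part (num_leaves u) (component_sizes t) = \<mu>')" if u: "u \<in># ts" for u
  proof -
    have "component_sizes (insert_leaf a t c) = inc_part (num_leaves u) (component_sizes t)" if "c \<in> sites u" for c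
      using that u insert_leaf_child[OF assms(1)[unfolded assms(2)] u that]
        num_leaves_insert_leaf[OF good_child[OF assms(1)[unfolded assms(2)] u] that]
      by (auto simp: assms(2) inc_part_def dest!: multi_member_split)
    then show ?thesis using good_child[OF assms(1)[unfolded assms(2)] u]
      by (simp add: sum_distrib_right[symmetric] sum_site_weight cong: sum.cong)
  qed
  then have "(\<Sum>u\<in>#ts. \<Sum>c\<in>sites u. site_weight \<alpha> \<gamma> c * of_bool (component_sizes (insert_leaf a t c) = \<mu>')) = 
     (\<Sum>u\<in>#ts. (real (num_leaves u) - \<alpha>) * of_bool (inc_part (num_leaves u) (component_sizes t) = \<mu>'))"
    by (intro arg_cong[where f=sum_mset] image_mset_cong)
  then show ?thesis using assms(1) unfolding assms(2) split_kernel_def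
    by (subst sum_sites_Branch)
      (simp_all add: insert_leaf_root multiset.map_comp comp_def del: insert_leaf.simps)
qed

lemma pmf_split_transition:
  assumes "2 \<le> n" "t \<in> set_pmf (ag_tree \<alpha> \<gamma> n)"
  shows "(real n - \<alpha>) * pmf (map_pmf component_sizes (map_pmf (insert_leaf a t) (weighted_pmf (sites t) (site_weight \<alpha> \<gamma>)))) \<mu>'
    = split_kernel (component_sizes t) \<mu>'"
proof -
  note t = ag_tree_support[OF assms]
  obtain ts where ts: "t = Branch ts" using t by blast
  let ?p = "weighted_pmf (sites t) (site_weight \<alpha> \<gamma>)"
  have n2: "2 \<le> num_leaves t" using t assms by simp
  have "pmf (map_pmf component_sizes (map_pmf (insert_leaf a t) ?p)) \<mu>' = 
     measure_pmf.expectation ?p (\<lambda>c. of_bool (component_sizes (insert_leaf a t c) = \<mu>'))"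
    unfolding pmf.map_comp expectation_of_bool by (simp add: comp_def)
  also have "\<dots> = (\<Sum>c\<in>sites t. of_bool (component_sizes (insert_leaf a t c) = \<mu>') * pmf ?p c)"
    using set_pmf_sites[OF t(1) n2] by (intro integral_measure_pmf_real) auto
  also have "\<dots> = (\<Sum>c\<in>sites t. site_weight \<alpha> \<gamma> c * of_bool (component_sizes (insert_leaf a t c) = \<mu>') / (real n - \<alpha>))"
    using pmf_sites[OF t(1) n2] t(3) by (intro sum.cong) auto
  also have "\<dots> = split_kernel (component_sizes t) \<mu>' / (real n - \<alpha>)"
    unfolding sum_divide_distrib[symmetric] sum_split_transition[OF t(1) ts] ..
  finally show ?thesis using ag assms by simp
qed

lemma component_sizes_support:
  assumes "2 \<le> n" "t \<in> set_pmf (ag_tree \<alpha> \<gamma> n)"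
  shows "component_sizes t \<in> parts_of n"
proof -
  note t = ag_tree_support[OF assms]
  obtain ts where ts: "t = Branch ts" using t by blast
  have "num_leaves u \<noteq> 0" if "u \<in># ts" for u
    using num_leaves_pos[of u] good_child[of ts u] t ts that by (auto simp: good_def)
  then have "0 \<notin># component_sizes t" using ts by fastforce
  then show ?thesis using t ts by (simp add: parts_of_def good_def)
qed

text \<open>The kernel read backwards, organised by the part of the target that the step produced.
  Several components of size x - 1 may have been the one that grew, which explains the factor
  \<open>count\<close>.\<close>

lemma split_kernel_eq:
  assumes "\<mu> \<in> parts_of n" "\<mu>' \<in> parts_of (Suc n)"
  shows "split_kernel \<mu> \<mu>' = \<gamma> * of_bool (\<mu>' = {#n, 1#}) +
    (\<Sum>x\<in>set_mset \<mu>'. if x = 1 then ((real (size \<mu>') - 2) * \<alpha> - \<gamma>) * of_bool (\<mu> = \<mu>' - {#1#})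
        else (real x - 1 - \<alpha>) * (real (count (dec_part x \<mu>') (x - 1)) * of_bool (\<mu> = dec_part x \<mu>')))"
proof -
  have sum1: "(\<Sum>m\<in>#\<mu>. (real m - \<alpha>) * of_bool (inc_part m \<mu> = \<mu>')) =
     (\<Sum>x\<in>set_mset \<mu>' - {1}. (real x - 1 - \<alpha>) * (real (count (dec_part x \<mu>') (x - 1)) * of_bool (\<mu> = dec_part x \<mu>')))"
  proof -
    have "(\<Sum>m\<in>#\<mu>. (real m - \<alpha>) * of_bool (inc_part m \<mu> = \<mu>')) =
      (\<Sum>m\<in>set_mset \<mu>. real (count \<mu> m) * ((real m - \<alpha>) * of_bool (inc_part m \<mu> = \<mu>')))"
      by (rule sum_mset_count)
    also have "\<dots> = (\<Sum>m\<in>{m\<in>set_mset \<mu>. inc_part m \<mu> = \<mu>'}. real (count \<mu> m) * (real m - \<alpha>))"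
      by (intro sum.mono_neutral_cong_right) auto
    also have "\<dots> = (\<Sum>x\<in>{x\<in>set_mset \<mu>' - {1}. \<mu> = dec_part x \<mu>'}. (real x - 1 - \<alpha>) * real (count (dec_part x \<mu>') (x - 1)))"
    proof (rule sum.reindex_bij_witness[of _ "\<lambda>x. x - 1" Suc])
      fix m assume m: "m \<in> {m \<in> set_mset \<mu>. inc_part m \<mu> = \<mu>'}"
      then show "Suc m - 1 = m" by simp
      have "m \<noteq> 0" using m assms by (auto simp: parts_of_def intro: ccontr)
      then show "Suc m \<in> {x \<in> set_mset \<mu>' - {1}. \<mu> = dec_part x \<mu>'}"
        using m inc_dec_part(2)[of m \<mu>] inc_part_def[of m \<mu>] by (metis (mono_tags, lifting) DiffI Suc_inject One_nat_def mem_Collect_eq singletonD union_single_eq_member)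
      show "(real (Suc m) - 1 - \<alpha>) * real (count (dec_part (Suc m) \<mu>') (Suc m - 1)) = real (count \<mu> m) * (real m - \<alpha>)"
        using m inc_dec_part(2)[of m \<mu>] by auto
    next
      fix x assume x: "x \<in> {x \<in> set_mset \<mu>' - {1}. \<mu> = dec_part x \<mu>'}"
      have x0: "x \<noteq> 0" using x assms by (auto simp: parts_of_def intro: ccontr)
      then show "Suc (x - 1) = x" by simp
      show "x - 1 \<in> {m \<in> set_mset \<mu>. inc_part m \<mu> = \<mu>'}"
        using x inc_dec_part(1)[of x \<mu>'] x0 by (auto simp: dec_part_def)
    qed
    also have "\<dots> = (\<Sum>x\<in>set_mset \<mu>' - {1}. (real x - 1 - \<alpha>) * (real (count (dec_part x \<mu>') (x - 1)) * of_bool (\<mu> = dec_part x \<mu>')))"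
      by (intro sum.mono_neutral_cong_left) auto
    finally show ?thesis .
  qed
  have sum2: "((real (size \<mu>) - 1) * \<alpha> - \<gamma>) * of_bool (add_mset 1 \<mu> = \<mu>') =
     (\<Sum>x\<in>set_mset \<mu>' \<inter> {1}. ((real (size \<mu>') - 2) * \<alpha> - \<gamma>) * of_bool (\<mu> = \<mu>' - {#1#}))"
  proof (cases "1 \<in># \<mu>'")
    case True
    then obtain \<nu> where "\<mu>' = add_mset 1 \<nu>" by (metis insert_DiffM)
    moreover have "set_mset \<mu>' \<inter> {1} = {1}" using True by auto
    ultimately show ?thesis by auto
  qed (auto simp: Int_insert_right)
  have "\<Sum>\<^sub># \<mu> = n" using assms by (simp add: parts_of_def)
  then show ?thesis unfolding split_kernel_def sum1 sum2
    by (subst sum.If_cases) (auto simp: Int_commute Diff_eq Collect_neg_eq intro!: arg_cong2[where f="(+)"] sum.cong)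
qed

lemma multiplicity_fact_add:
  "multiplicity_fact (add_mset y \<nu>) = multiplicity_fact \<nu> * (real (count \<nu> y) + 1)"
proof -
  have "multiplicity_fact (add_mset y \<nu>) = (\<Prod>x\<in>insert y (set_mset \<nu>). fact (count (add_mset y \<nu>) x))"
    by (simp add: multiplicity_fact_def)
  also have "\<dots> = fact (Suc (count \<nu> y)) * (\<Prod>x\<in>set_mset \<nu> - {y}. fact (count \<nu> x))"
    by (subst prod.insert_remove) (auto intro!: prod.cong split: if_splits)
  also have "\<dots> = (real (count \<nu> y) + 1) * (\<Prod>x\<in>insert y (set_mset \<nu>). fact (count \<nu> x))"
    by (subst prod.insert_remove) (auto simp: algebra_simps)
  also have "(\<Prod>x\<in>insert y (set_mset \<nu>). fact (count \<nu> x)) = multiplicity_fact \<nu>"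
    unfolding multiplicity_fact_def
    by (intro prod.mono_neutral_right) (auto simp: not_in_iff)
  finally show ?thesis by (simp add: mult.commute)
qed

lemma multiplicity_fact_pos: "0 < multiplicity_fact \<mu>"
  by (auto simp: multiplicity_fact_def intro!: prod_pos)

text \<open>The choice among equal copies of y absorbs one factor of the factorial. This makes it
  possible to reindex sums over (multiset, chosen part) by the multiset without that part.\<close>

lemma count_div_multiplicity_fact:
  "y \<in># \<mu> \<Longrightarrow> real (count \<mu> y) / multiplicity_fact \<mu> = 1 / multiplicity_fact (\<mu> - {#y#})"
  using multiplicity_fact_pos
  by (auto dest!: multi_member_split simp: multiplicity_fact_add add.commute add_nonneg_eq_0_iff)

text \<open>Forward equation of the chain: the law at n + 1 is the kernel integrated against the law
  at n, and after division by \<open>multiplicity_fact\<close> this is the recursion of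
  \<open>ag_comp_rec\<close>.\<close>

lemma pmf_component_sizes:
  assumes "2 \<le> n"
  shows "pmf (map_pmf component_sizes (ag_tree \<alpha> \<gamma> n)) \<mu> = ag_comp \<alpha> \<gamma> n \<mu> / multiplicity_fact \<mu>"
  using assms
proof (induction n arbitrary: \<mu> rule: dec_induct)
  case base
  have "multiplicity_fact {#1::nat, 1#} = 2" by (simp add: multiplicity_fact_def numeral_2_eq_2[symmetric])
  then show ?case by (auto simp: ag_tree_2 ag_comp_2 indicator_def)
next
  case (step n \<mu>')
  let ?T = "ag_tree \<alpha> \<gamma> n"
  let ?P = "\<lambda>\<mu>. pmf (map_pmf component_sizes ?T) \<mu>"
  show ?case
  proof (cases "\<mu>' \<in> parts_of (Suc n)")
    case False
    then have "\<mu>' \<notin> component_sizes ` set_pmf (ag_tree \<alpha> \<gamma> (Suc n))"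
      using component_sizes_support[of "Suc n"] step.hyps by auto
    then have "pmf (map_pmf component_sizes (ag_tree \<alpha> \<gamma> (Suc n))) \<mu>' = 0" by (rule pmf_map_outside)
    then show ?thesis using ag_comp_outside[of "Suc n" \<mu>' \<alpha> \<gamma>] False step.hyps by simp
  next
    case True
    have na: "real n - \<alpha> > 0" using ag step.hyps by simp
    have ind: "measure_pmf.expectation ?T (\<lambda>t. of_bool (component_sizes t = \<nu>)) = ?P \<nu>" for \<nu>
      by (rule expectation_of_bool)
    have int: "integrable (measure_pmf ?T) f" for f :: "nat rtree \<Rightarrow> real"
      by (rule integrable_measure_pmf_finite) (rule finite_ag_tree[OF step.hyps(1)])
    have "(real n - \<alpha>) * pmf (map_pmf component_sizes (ag_tree \<alpha> \<gamma> (Suc n))) \<mu>' =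
       measure_pmf.expectation ?T (\<lambda>t. (real n - \<alpha>) * pmf (map_pmf component_sizes (map_pmf (insert_leaf (Suc n) t) (weighted_pmf (sites t) (site_weight \<alpha> \<gamma>)))) \<mu>')"
      unfolding ag_tree_Suc[OF step.hyps(1)] map_bind_pmf pmf_bind by simp
    also have "\<dots> = measure_pmf.expectation ?T (\<lambda>t. \<gamma> * of_bool (\<mu>' = {#n, 1#}) +
      (\<Sum>x\<in>set_mset \<mu>'. if x = 1 then ((real (size \<mu>') - 2) * \<alpha> - \<gamma>) * of_bool (component_sizes t = \<mu>' - {#1#})
        else (real x - 1 - \<alpha>) * (real (count (dec_part x \<mu>') (x - 1)) * of_bool (component_sizes t = dec_part x \<mu>'))))"
      by (intro integral_cong_AE AE_pmfI) (auto simp: pmf_split_transition[OF step.hyps(1)]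
            split_kernel_eq[OF component_sizes_support[OF step.hyps(1)] True])
    also have "\<dots> = \<gamma> * of_bool (\<mu>' = {#n, 1#}) +
      (\<Sum>x\<in>set_mset \<mu>'. if x = 1 then ((real (size \<mu>') - 2) * \<alpha> - \<gamma>) * ?P (\<mu>' - {#1#})
        else (real x - 1 - \<alpha>) * (real (count (dec_part x \<mu>') (x - 1)) * ?P (dec_part x \<mu>')))"
      by (subst Bochner_Integration.integral_add[OF int int], subst Bochner_Integration.integral_sum[OF int])
        (auto intro!: sum.cong simp: ind)
    also have "(\<Sum>x\<in>set_mset \<mu>'. if x = 1 then ((real (size \<mu>') - 2) * \<alpha> - \<gamma>) * ?P (\<mu>' - {#1#})
        else (real x - 1 - \<alpha>) * (real (count (dec_part x \<mu>') (x - 1)) * ?P (dec_part x \<mu>'))) =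
        (\<Sum>x\<in>set_mset \<mu>'. real (count \<mu>' x) * (if x = 1 then ((real (size \<mu>') - 2) * \<alpha> - \<gamma>) * ag_comp \<alpha> \<gamma> n (\<mu>' - {#1#})
        else (real x - 1 - \<alpha>) * ag_comp \<alpha> \<gamma> n (dec_part x \<mu>')) / multiplicity_fact \<mu>')"
    proof (intro sum.cong refl)
      fix x assume x: "x \<in># \<mu>'"
      have 1: "1 / multiplicity_fact (\<mu>' - {#x#}) = real (count \<mu>' x) / multiplicity_fact \<mu>'"
        using count_div_multiplicity_fact[OF x] by simp
      \<comment> \<open>Removing x from the target and removing x - 1 from its predecessor leave the
        same multiset, so both ratios of a count to factorials agree.\<close>
      have "real (count (dec_part x \<mu>') (x - 1)) / multiplicity_fact (dec_part x \<mu>') = 1 / multiplicity_fact (\<mu>' - {#x#})"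
        by (subst count_div_multiplicity_fact) (auto simp: dec_part_def)
      note 2 = this[unfolded 1]
      show "(if x = 1 then ((real (size \<mu>') - 2) * \<alpha> - \<gamma>) * ?P (\<mu>' - {#1#})
        else (real x - 1 - \<alpha>) * (real (count (dec_part x \<mu>') (x - 1)) * ?P (dec_part x \<mu>'))) =
        real (count \<mu>' x) * (if x = 1 then ((real (size \<mu>') - 2) * \<alpha> - \<gamma>) * ag_comp \<alpha> \<gamma> n (\<mu>' - {#1#})
        else (real x - 1 - \<alpha>) * ag_comp \<alpha> \<gamma> n (dec_part x \<mu>')) / multiplicity_fact \<mu>'"
      proof (cases "x = 1")
        case True
        then show ?thesis using arg_cong[OF 1, of "\<lambda>z. ((real (size \<mu>') - 2) * \<alpha> - \<gamma>) * ag_comp \<alpha> \<gamma> n (\<mu>' - {#1#}) * z"]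
          by (simp add: step.IH mult_ac)
      next
        case False
        then show ?thesis using arg_cong[OF 2, of "\<lambda>z. (real x - 1 - \<alpha>) * ag_comp \<alpha> \<gamma> n (dec_part x \<mu>') * z"]
          by (simp add: step.IH mult_ac)
      qed
    qed
    also have "\<dots> = (\<Sum>x\<in>#\<mu>'. (if x = 1 then ((real (size \<mu>') - 2) * \<alpha> - \<gamma>) * ag_comp \<alpha> \<gamma> n (\<mu>' - {#1#})
        else (real x - 1 - \<alpha>) * ag_comp \<alpha> \<gamma> n (dec_part x \<mu>'))) / multiplicity_fact \<mu>'"
      unfolding sum_mset_count sum_divide_distrib ..
    also have "\<gamma> * of_bool (\<mu>' = {#n, 1#}) = (if \<mu>' = {#n, 1#} then \<gamma> else 0) / multiplicity_fact \<mu>'"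
      using step.hyps by (auto simp: multiplicity_fact_def)
    also have "(if \<mu>' = {#n, 1#} then \<gamma> else 0) / multiplicity_fact \<mu>' + 
       (\<Sum>x\<in>#\<mu>'. (if x = 1 then ((real (size \<mu>') - 2) * \<alpha> - \<gamma>) * ag_comp \<alpha> \<gamma> n (\<mu>' - {#1#})
        else (real x - 1 - \<alpha>) * ag_comp \<alpha> \<gamma> n (dec_part x \<mu>'))) / multiplicity_fact \<mu>' = 
        (real n - \<alpha>) * ag_comp \<alpha> \<gamma> (Suc n) \<mu>' / multiplicity_fact \<mu>'"
      unfolding ag_comp_Suc[OF step.hyps(1) True] using na by (simp add: add_divide_distrib)
    finally have "(real n - \<alpha>) * pmf (map_pmf component_sizes (ag_tree \<alpha> \<gamma> (Suc n))) \<mu>' =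
        (real n - \<alpha>) * (ag_comp \<alpha> \<gamma> (Suc n) \<mu>' / multiplicity_fact \<mu>')" by simp
    then show ?thesis using na by (metis less_irrefl mult_left_cancel)
  qed
qed

end

section \<open>From component sizes to the splitting rule\<close>

lemma component_sizes_shape: "component_sizes (shape t) = component_sizes t"
proof -
  have "num_leaves (shape t) = num_leaves t" for t :: "'a rtree"
  proof (induction t)
    case (Branch ts)
    then have "image_mset (num_leaves \<circ> shape) ts = image_mset num_leaves ts"
      by (intro image_mset_cong) auto
    then show ?case by (simp add: shape_def multiset.map_comp comp_def)
  qed (simp add: shape_def)
  then show ?thesis by (cases t) (auto simp: shape_def component_sizes_def multiset.map_comp comp_def)
qed

lemma first_split_eq: "first_split t = rev (sorted_list_of_multiset (component_sizes t))"
  by (cases t) (auto simp: component_sizes_def)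

lemma rev_sort_eq:
  assumes "sorted_wrt (\<ge>) (ns :: nat list)"
  shows "rev (sort ns) = ns"
proof -
  have "sorted (rev ns)" using assms by (simp add: sorted_wrt_rev)
  then have "sort ns = rev ns" by (intro properties_for_sort) auto
  then show ?thesis by simp
qed

lemma (in alpha_gamma) q_seq_eq:
  assumes "sorted_wrt (\<ge>) ns" "2 \<le> sum_list ns"
  shows "q_seq \<alpha> \<gamma> ns = ag_comp \<alpha> \<gamma> (sum_list ns) (mset ns) / multiplicity_fact (mset ns)"
proof -
  have "map_pmf first_split (ag_tree_unlabelled \<alpha> \<gamma> (sum_list ns)) =
      map_pmf (\<lambda>\<mu>. rev (sorted_list_of_multiset \<mu>)) (map_pmf component_sizes (ag_tree \<alpha> \<gamma> (sum_list ns)))"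
    unfolding ag_tree_unlabelled_def pmf.map_comp
    by (intro map_pmf_cong) (auto simp: first_split_eq component_sizes_shape)
  moreover have "inj (\<lambda>\<mu> :: nat multiset. rev (sorted_list_of_multiset \<mu>))"
    by (rule injI) (metis mset_sorted_list_of_multiset rev_rev_ident)
  ultimately have "q_seq \<alpha> \<gamma> ns = pmf (map_pmf component_sizes (ag_tree \<alpha> \<gamma> (sum_list ns))) (mset ns)"
    unfolding q_seq_def using pmf_map_inj'[of "\<lambda>\<mu>. rev (sorted_list_of_multiset \<mu>)" _ "mset ns"]
    by (simp add: rev_sort_eq[OF assms(1)])
  then show ?thesis using pmf_component_sizes[OF assms(2)] by simp
qed

lemma bij_betw_splits: "bij_betw mset (splits n) (parts_of n)"
proof (rule bij_betw_byWitness[where f' = "\<lambda>\<mu>. rev (sorted_list_of_multiset \<mu>)"])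
  show "\<forall>ns\<in>splits n. rev (sorted_list_of_multiset (mset ns)) = ns"
    by (auto simp: splits_def rev_sort_eq)
  show "mset ` splits n \<subseteq> parts_of n"
    by (auto simp: splits_def parts_of_def sum_mset_sum_list)
  show "(\<lambda>\<mu>. rev (sorted_list_of_multiset \<mu>)) ` parts_of n \<subseteq> splits n"
  proof safe
    fix \<mu> assume "\<mu> \<in> parts_of n"
    moreover have "sum_list (sorted_list_of_multiset \<mu>) = \<Sum>\<^sub># \<mu>" "length (sorted_list_of_multiset \<mu>) = size \<mu>"
      by (metis mset_sorted_list_of_multiset sum_mset_sum_list, metis mset_sorted_list_of_multiset size_mset)
    moreover have "sorted_wrt (\<lambda>x y. y \<ge> x) (sorted_list_of_multiset \<mu>)"
      using sorted_sorted_list_of_multiset by simp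
    ultimately show "rev (sorted_list_of_multiset \<mu>) \<in> splits n"
      by (auto simp: splits_def parts_of_def sorted_wrt_rev sum_list_rev Suc_le_eq intro: gr0I)
  qed
qed auto

lemma finite_parts_of: "finite (parts_of n)"
proof (rule finite_subset)
  show "parts_of n \<subseteq> mset ` {ns. set ns \<subseteq> {..n} \<and> length ns \<le> n}"
  proof
    fix \<mu> assume *: "\<mu> \<in> parts_of n"
    then have "set_mset \<mu> \<subseteq> {..n}" by (auto simp: parts_of_def dest!: multi_member_split)
    moreover have "size \<mu> \<le> n" using * sum_mset_pos_size[of \<mu>] by (auto simp: parts_of_def)
    ultimately show "\<mu> \<in> mset ` {ns. set ns \<subseteq> {..n} \<and> length ns \<le> n}"
      by (intro image_eqI[of _ _ "sorted_list_of_multiset \<mu>"]) (auto simp flip: size_mset)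
  qed
qed (auto intro: finite_lists_length_le)

lemma finite_splits: "finite (splits n)"
  using bij_betw_splits finite_parts_of bij_betw_finite by metis

text \<open>The values are the point masses of the law of \<open>component_sizes\<close>, whose
  support lies in \<open>parts_of n\<close>.\<close>

lemma (in alpha_gamma) splitting_rule_q_seq: "splitting_rule (q_seq \<alpha> \<gamma>)"
  unfolding splitting_rule_def
proof (intro allI impI conjI ballI)
  fix n :: nat assume n: "2 \<le> n"
  show "0 \<le> q_seq \<alpha> \<gamma> ns" for ns by (simp add: q_seq_def)
  have "(\<Sum>ns\<in>splits n. q_seq \<alpha> \<gamma> ns) = (\<Sum>ns\<in>splits n. pmf (map_pmf component_sizes (ag_tree \<alpha> \<gamma> n)) (mset ns))"
    using n by (intro sum.cong refl) (auto simp: q_seq_eq pmf_component_sizes splits_def)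
  also have "\<dots> = (\<Sum>\<mu>\<in>parts_of n. pmf (map_pmf component_sizes (ag_tree \<alpha> \<gamma> n)) \<mu>)"
    by (rule sum.reindex_bij_betw[OF bij_betw_splits])
  also have "\<dots> = 1"
    using component_sizes_support[OF n] by (intro sum_pmf_eq_1) (auto simp: finite_parts_of)
  finally show "(\<Sum>ns\<in>splits n. q_seq \<alpha> \<gamma> ns) = 1" .
qed

section \<open>Sampling consistency\<close>

definition indep_mset :: "'a pmf multiset \<Rightarrow> 'a multiset pmf" where
  "indep_mset = fold_mset (\<lambda>p P. bind_pmf p (\<lambda>x. map_pmf (add_mset x) P)) (return_pmf {#})"

lemma indep_mset_empty [simp]: "indep_mset {#} = return_pmf {#}"
  by (simp add: indep_mset_def)

text \<open>The fold does not depend on the order of the laws because independent draws may be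
  exchanged (\<open>bind_commute_pmf\<close>).\<close>

lemma indep_mset_add [simp]:
  "indep_mset (add_mset p ps) = bind_pmf p (\<lambda>x. map_pmf (add_mset x) (indep_mset ps))"
proof -
  interpret comp_fun_commute "\<lambda>(p :: 'a pmf) P. bind_pmf p (\<lambda>x. map_pmf (add_mset x) P)"
  proof
    fix p q :: "'a pmf"
    show "(\<lambda>P. bind_pmf p (\<lambda>x. map_pmf (add_mset x) P)) \<circ> (\<lambda>P. bind_pmf q (\<lambda>x. map_pmf (add_mset x) P)) =
      (\<lambda>P. bind_pmf q (\<lambda>x. map_pmf (add_mset x) P)) \<circ> (\<lambda>P. bind_pmf p (\<lambda>x. map_pmf (add_mset x) P))"
      unfolding comp_def map_bind_pmf pmf.map_comp
      by (subst bind_commute_pmf) (simp add: comp_def add_mset_commute)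
  qed
  show ?thesis unfolding indep_mset_def by (rule fold_mset_add_mset)
qed

lemma map_mset_indep_list: "map_pmf mset (indep_list_pmf ps) = indep_mset (mset ps)"
proof (induction ps)
  case (Cons p ps)
  have "map_pmf mset (indep_list_pmf (p # ps)) = bind_pmf p (\<lambda>x. map_pmf (add_mset x) (map_pmf mset (indep_list_pmf ps)))"
    by (simp add: map_bind_pmf pmf.map_comp comp_def)
  then show ?case by (simp add: Cons)
qed simp

lemma set_indep_mset_size: "ts \<in> set_pmf (indep_mset P) \<Longrightarrow> size ts = size P"
  by (induction P arbitrary: ts) auto

lemma nn_integral_sum_mset:
  assumes "\<And>i. f i \<in> borel_measurable M"
  shows "(\<integral>\<^sup>+ x. (\<Sum>i\<in>#P. f i x) \<partial>M) = (\<Sum>i\<in>#P. \<integral>\<^sup>+ x. f i x \<partial>M)"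
proof (induction P)
  case (add i P)
  note assms[measurable]
  have "(\<lambda>x. \<Sum>i\<in>#P. f i x) \<in> borel_measurable M"
    by (induction P) simp_all
  then show ?case using add assms by (simp add: nn_integral_add)
qed simp

lemma nn_integral_pmf_commute:
  "(\<integral>\<^sup>+ x. \<integral>\<^sup>+ y. f x y \<partial>measure_pmf q \<partial>measure_pmf p) = (\<integral>\<^sup>+ y. \<integral>\<^sup>+ x. f x y \<partial>measure_pmf p \<partial>measure_pmf q)"
proof -
  have "(\<integral>\<^sup>+ z. f (fst z) (snd z) \<partial>bind_pmf p (\<lambda>x. bind_pmf q (\<lambda>y. return_pmf (x, y)))) =
     (\<integral>\<^sup>+ z. f (fst z) (snd z) \<partial>bind_pmf q (\<lambda>y. bind_pmf p (\<lambda>x. return_pmf (x, y))))"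
    by (subst bind_commute_pmf) simp
  then show ?thesis by (simp add: nn_integral_return)
qed

text \<open>Linearity of expectation over the element that is singled out: if t was drawn from p,
  then the others form an independent forest for the remaining laws. The rest is written
  \<open>ts - {#t#}\<close>, which is insensitive to which of several equal trees is taken.\<close>

lemma nn_integral_indep_mset_sum:
  fixes G :: "'a \<Rightarrow> 'a multiset \<Rightarrow> ennreal"
  shows "(\<integral>\<^sup>+ ts. (\<Sum>t\<in>#ts. G t (ts - {#t#})) \<partial>indep_mset P) =
    (\<Sum>p\<in>#P. \<integral>\<^sup>+ t. \<integral>\<^sup>+ rest. G t rest \<partial>indep_mset (P - {#p#}) \<partial>measure_pmf p)"
proof (induction P arbitrary: G)
  case empty
  show ?case by (simp add: nn_integral_return)
next
  case (add p P)
  have "(\<Sum>t\<in>#ts. G t (add_mset x ts - {#t#})) = (\<Sum>t\<in>#ts. G t (add_mset x (ts - {#t#})))" for x ts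
    by (intro arg_cong[where f=sum_mset] image_mset_cong) simp
  then have "(\<integral>\<^sup>+ ts. (\<Sum>t\<in>#ts. G t (ts - {#t#})) \<partial>indep_mset (add_mset p P)) =
     (\<integral>\<^sup>+ x. \<integral>\<^sup>+ ts. G x ts + (\<Sum>t\<in>#ts. G t (add_mset x (ts - {#t#}))) \<partial>indep_mset P \<partial>measure_pmf p)"
    by simp
  also have "\<dots> = (\<integral>\<^sup>+ x. (\<integral>\<^sup>+ ts. G x ts \<partial>indep_mset P) +
      (\<Sum>p'\<in>#P. \<integral>\<^sup>+ t. \<integral>\<^sup>+ rest. G t (add_mset x rest) \<partial>indep_mset (P - {#p'#}) \<partial>measure_pmf p') \<partial>measure_pmf p)"
    by (subst nn_integral_add) (simp_all add: add.IH[of "\<lambda>t rest. G t (add_mset _ rest)"])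
  also have "\<dots> = (\<integral>\<^sup>+ x. \<integral>\<^sup>+ ts. G x ts \<partial>indep_mset P \<partial>measure_pmf p) +
      (\<Sum>p'\<in>#P. \<integral>\<^sup>+ x. \<integral>\<^sup>+ t. \<integral>\<^sup>+ rest. G t (add_mset x rest) \<partial>indep_mset (P - {#p'#}) \<partial>measure_pmf p' \<partial>measure_pmf p)"
    by (subst nn_integral_add) (simp_all add: nn_integral_sum_mset)
  also have "(\<Sum>p'\<in>#P. \<integral>\<^sup>+ x. \<integral>\<^sup>+ t. \<integral>\<^sup>+ rest. G t (add_mset x rest) \<partial>indep_mset (P - {#p'#}) \<partial>measure_pmf p' \<partial>measure_pmf p) =
      (\<Sum>p'\<in>#P. \<integral>\<^sup>+ t. \<integral>\<^sup>+ rest. G t rest \<partial>indep_mset (add_mset p P - {#p'#}) \<partial>measure_pmf p')"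
    by (intro arg_cong[where f=sum_mset] image_mset_cong)
      (subst nn_integral_pmf_commute, simp)
  finally show ?case by simp
qed

lemma pmf_map_pmf_of_multiset:
  assumes "M \<noteq> {#}"
  shows "real (size M) * pmf (map_pmf f (pmf_of_multiset M)) y = real (count (image_mset f M) y)"
proof -
  have "pmf (map_pmf f (pmf_of_multiset M)) y = measure_pmf.expectation (pmf_of_multiset M) (\<lambda>x. of_bool (f x = y))"
    by (rule expectation_of_bool[symmetric])
  also have "\<dots> = (\<Sum>x\<in>set_mset M. of_bool (f x = y) * (real (count M x) / real (size M)))"
    using assms by (subst integral_measure_pmf_real[of "set_mset M"]) auto
  also have "\<dots> = (\<Sum>x\<in>f -` {y} \<inter> set_mset M. real (count M x) / real (size M))"
    by (intro sum.mono_neutral_cong_right) auto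
  also have "\<dots> = real (count (image_mset f M) y) / real (size M)"
    by (simp add: count_image_mset sum_divide_distrib)
  finally show ?thesis using assms by simp
qed

section \<open>Removing a uniform leaf from a Markov branching tree\<close>

lemma count_sum_mset: "count (\<Sum>\<^sub># (image_mset f M)) y = (\<Sum>x\<in>#M. count (f x) y)"
  by (induction M) auto

text \<open>The part of \<open>leaf_removals\<close> due to one child t with siblings
  \<open>rest\<close>. Only a child that is itself a leaf changes the degree of the branch
  point.\<close>

definition removals_at :: "'a rtree \<Rightarrow> 'a rtree multiset \<Rightarrow> 'a rtree multiset" where
  "removals_at t rest = (case t of Leaf a \<Rightarrow> {#suppress rest#}
     | Branch us \<Rightarrow> image_mset (\<lambda>t'. Branch (add_mset t' rest)) (leaf_removals t))"

lemma leaf_removals_Branch: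
  "leaf_removals (Branch ts) = (\<Sum>t\<in>#ts. removals_at t (ts - {#t#}))"
  by (simp add: removals_at_def multiset.map_comp comp_def)

declare leaf_removals.simps(2) [simp del]

text \<open>One entry per leaf, so that a uniform entry of the multiset is the effect of removing a
  uniform leaf.\<close>

lemma size_leaf_removals: "size (leaf_removals t) = (case t of Leaf a \<Rightarrow> 0 | Branch ts \<Rightarrow> num_leaves t)"
proof (induction t)
  case (Branch ts)
  have "size (removals_at t rest) = num_leaves t" if "t \<in># ts" for t rest
    using Branch[OF that] by (cases t) (auto simp: removals_at_def)
  then show ?case unfolding leaf_removals_Branch
    by (simp add: multiset.map_comp comp_def cong: image_mset_cong)
qed simp

declare mb_tree.simps [simp del]

definition forest_law :: "(nat list \<Rightarrow> real) \<Rightarrow> nat multiset \<Rightarrow> unit rtree multiset pmf" where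
  "forest_law q \<mu> = indep_mset (image_mset (mb_tree q) \<mu>)"

lemma pmf_split_pmf:
  assumes "splitting_rule q" "2 \<le> n"
  shows "pmf (split_pmf q n) ns = (if ns \<in> splits n then q ns else 0)"
  unfolding split_pmf_def
proof (rule pmf_embed_pmf)
  have *: "ns \<in> splits n \<Longrightarrow> 0 \<le> q ns" "(\<Sum>ns\<in>splits n. q ns) = 1" for ns
    using assms by (auto simp: splitting_rule_def)
  then show "0 \<le> (if ns \<in> splits n then q ns else 0)" for ns by auto
  have "(\<integral>\<^sup>+ ns. ennreal (if ns \<in> splits n then q ns else 0) \<partial>count_space UNIV)
      = (\<Sum>ns\<in>splits n. ennreal (if ns \<in> splits n then q ns else 0))"
    using finite_splits by (intro nn_integral_count_space') auto
  also have "\<dots> = ennreal (\<Sum>ns\<in>splits n. q ns)"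
    using * by (subst sum_ennreal[symmetric]) (auto intro!: sum.cong)
  finally show "(\<integral>\<^sup>+ ns. ennreal (if ns \<in> splits n then q ns else 0) \<partial>count_space UNIV) = 1"
    using * by simp
qed

lemma mb_tree_1: "mb_tree q (Suc 0) = return_pmf (Leaf ())"
  by (simp add: mb_tree.simps)

lemma parts_of_less:
  assumes "\<mu> \<in> parts_of n" "m \<in># \<mu>"
  shows "m < n"
proof -
  obtain \<nu> where \<nu>: "\<mu> = add_mset m \<nu>" using assms(2) by (metis insert_DiffM)
  with assms(1) have "m + \<Sum>\<^sub># \<nu> = n" "0 \<notin># \<nu>" "1 \<le> size \<nu>" by (auto simp: parts_of_def)
  then show ?thesis using sum_mset_pos_size[of \<nu>] by simp
qed

lemma splits_parts_less: "ns \<in> splits n \<Longrightarrow> m \<in> set ns \<Longrightarrow> m < n"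
  using parts_of_less[of "mset ns" n m] bij_betw_splits[of n] by (auto simp: bij_betw_def)

text \<open>All parts of a split of n are smaller than n, so the termination guard always selects
  the recursive law; passing to multisets then forgets the order of the components.\<close>

lemma mb_tree_unfold:
  assumes "splitting_rule q" "2 \<le> n"
  shows "mb_tree q n = bind_pmf (split_pmf q n) (\<lambda>ns. map_pmf Branch (forest_law q (mset ns)))"
proof -
  have "map_pmf (\<lambda>ts. Branch (mset ts))
          (indep_list_pmf (map (\<lambda>m. if m < n then mb_tree q m else return_pmf (Leaf ())) ns)) = 
        map_pmf Branch (forest_law q (mset ns))" if "ns \<in> set_pmf (split_pmf q n)" for ns
  proof -
    have "ns \<in> splits n" using that pmf_split_pmf[OF assms, of ns] by (auto simp: set_pmf_eq split: if_splits)
    then have "map (\<lambda>m. if m < n then mb_tree q m else return_pmf (Leaf ())) ns = map (mb_tree q) ns"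
      using splits_parts_less by auto
    then show ?thesis unfolding forest_law_def
      by (simp only: mset_map[symmetric] map_mset_indep_list[symmetric] pmf.map_comp comp_def)
  qed
  then show ?thesis using assms(2)
    by (subst mb_tree.simps) (auto intro!: bind_pmf_cong)
qed

context alpha_gamma
begin

abbreviation mb where "mb \<equiv> mb_tree (q_seq \<alpha> \<gamma>)"
abbreviation forest where "forest \<equiv> forest_law (q_seq \<alpha> \<gamma>)"

definition split_prob :: "nat \<Rightarrow> nat multiset \<Rightarrow> real" where
  "split_prob n \<mu> = ag_comp \<alpha> \<gamma> n \<mu> / multiplicity_fact \<mu>"

lemma split_prob_nonneg: "2 \<le> n \<Longrightarrow> 0 \<le> split_prob n \<mu>"
  unfolding split_prob_def by (metis pmf_component_sizes pmf_nonneg)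

lemma nn_integral_split_pmf:
  assumes "2 \<le> n"
  shows "(\<integral>\<^sup>+ ns. f (mset ns) \<partial>split_pmf (q_seq \<alpha> \<gamma>) n) = (\<Sum>\<mu>\<in>parts_of n. f \<mu> * ennreal (split_prob n \<mu>))"
proof -
  have "(\<integral>\<^sup>+ ns. f (mset ns) \<partial>split_pmf (q_seq \<alpha> \<gamma>) n) =
      (\<Sum>ns\<in>splits n. f (mset ns) * ennreal (pmf (split_pmf (q_seq \<alpha> \<gamma>) n) ns))"
    using pmf_split_pmf[OF splitting_rule_q_seq assms] finite_splits
    by (intro nn_integral_measure_pmf_support) (auto simp: set_pmf_eq)
  also have "\<dots> = (\<Sum>ns\<in>splits n. f (mset ns) * ennreal (split_prob n (mset ns)))"
    using assms by (intro sum.cong refl) (auto simp: pmf_split_pmf[OF splitting_rule_q_seq] q_seq_eq split_prob_def splits_def)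
  also have "\<dots> = (\<Sum>\<mu>\<in>parts_of n. f \<mu> * ennreal (split_prob n \<mu>))"
    by (rule sum.reindex_bij_betw[OF bij_betw_splits])
  finally show ?thesis .
qed

lemma pmf_mb:
  assumes "2 \<le> n"
  shows "pmf (mb n) \<tau> = (\<Sum>\<mu>\<in>parts_of n. split_prob n \<mu> * pmf (map_pmf Branch (forest \<mu>)) \<tau>)"
proof -
  have "ennreal (pmf (mb n) \<tau>) = (\<Sum>\<mu>\<in>parts_of n. ennreal (pmf (map_pmf Branch (forest \<mu>)) \<tau>) * ennreal (split_prob n \<mu>))"
    unfolding mb_tree_unfold[OF splitting_rule_q_seq assms] ennreal_pmf_bind
    by (rule nn_integral_split_pmf[OF assms])
  also have "\<dots> = ennreal (\<Sum>\<mu>\<in>parts_of n. split_prob n \<mu> * pmf (map_pmf Branch (forest \<mu>)) \<tau>)"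
    using split_prob_nonneg[OF assms]
    by (subst sum_ennreal[symmetric]) (auto simp: ennreal_mult'[symmetric] mult.commute)
  finally show ?thesis using split_prob_nonneg[OF assms]
    by (subst (asm) ennreal_inj) (auto intro!: sum_nonneg)
qed

text \<open>The parameter n is the actual number of leaves, and therefore the number of entries of
  \<open>leaf_removals\<close> when n is at least 2.\<close>

lemma mb_support:
  "1 \<le> n \<Longrightarrow> t \<in> set_pmf (mb n) \<Longrightarrow> num_leaves t = n \<and> (case t of Leaf a \<Rightarrow> n = 1 | Branch ts \<Rightarrow> 2 \<le> n)"
proof (induction n arbitrary: t rule: less_induct)
  case (less n)
  show ?case
  proof (cases "n = 1")
    case True
    then show ?thesis using less.prems by (simp add: mb_tree_1)
  next
    case False
    then have n: "2 \<le> n" using less.prems by simp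
    from less.prems(2) obtain ns ts where ns: "ns \<in> set_pmf (split_pmf (q_seq \<alpha> \<gamma>) n)"
      and ts: "ts \<in> set_pmf (forest (mset ns))" "t = Branch ts"
      by (auto simp: mb_tree_unfold[OF splitting_rule_q_seq n])
    have ns': "ns \<in> splits n" using ns pmf_split_pmf[OF splitting_rule_q_seq n, of ns] by (auto simp: set_pmf_eq split: if_splits)
    have "image_mset num_leaves ts = \<mu>" 
      if "ts \<in> set_pmf (forest \<mu>)" "\<forall>m\<in>#\<mu>. 1 \<le> m \<and> m < n" for ts \<mu>
      using that
    proof (induction \<mu> arbitrary: ts)
      case (add m \<mu>)
      then obtain t' ts' where "t' \<in> set_pmf (mb m)" "ts' \<in> set_pmf (forest \<mu>)" "ts = add_mset t' ts'"
        by (auto simp: forest_law_def)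
      then show ?case using add less.IH[of m t'] by auto
    qed (simp add: forest_law_def)
    then have "image_mset num_leaves ts = mset ns"
      using ts ns' splits_parts_less[OF ns'] by (auto simp: splits_def)
    then show ?thesis using ts ns' n by (auto simp: splits_def sum_mset_sum_list)
  qed
qed

text \<open>Covers at once what is left after deleting a leaf child: with one remaining component
  the branch point is suppressed and the law is \<open>mb n\<close>, otherwise a branch point
  stays.\<close>

definition reduced_law :: "nat multiset \<Rightarrow> unit rtree pmf" where
  "reduced_law \<mu> = map_pmf suppress (forest \<mu>)"

lemma reduced_law_single: "reduced_law {#n#} = mb n"
  by (simp add: reduced_law_def forest_law_def suppress_def map_bind_pmf pmf.map_comp comp_def bind_return_pmf')

lemma reduced_law_Branch: "2 \<le> size \<mu> \<Longrightarrow> reduced_law \<mu> = map_pmf Branch (forest \<mu>)"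
  unfolding reduced_law_def using set_indep_mset_size[of _ "image_mset mb \<mu>"]
  by (intro map_pmf_cong) (auto simp: suppress_def forest_law_def)

definition removal :: "nat \<Rightarrow> unit rtree pmf" where
  "removal n = bind_pmf (mb n) (\<lambda>t. pmf_of_multiset (leaf_removals t))"

text \<open>A component of size x at least 2 loses a uniform leaf and becomes, by the third
  assumption, a tree of size x - 1 independent of its siblings. The factor x is the number of leaves
  among which the removal chooses.\<close>

lemma nn_integral_removals_at:
  assumes "1 \<le> x" "x \<in># \<mu>" "2 \<le> x \<Longrightarrow> removal x = mb (x - 1)"
  shows "(\<integral>\<^sup>+ t. \<integral>\<^sup>+ rest. of_nat (count (removals_at t rest) \<tau>) \<partial>forest (\<mu> - {#x#}) \<partial>mb x) =
    ennreal (if x = 1 then pmf (reduced_law (\<mu> - {#1#})) \<tau> else real x * pmf (map_pmf Branch (forest (dec_part x \<mu>))) \<tau>)"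
proof (cases "x = 1")
  case True
  have "(\<integral>\<^sup>+ rest. of_nat (count {#suppress rest#} \<tau>) \<partial>forest (\<mu> - {#1#})) =
     (\<integral>\<^sup>+ rest. indicator (suppress -` {\<tau>}) rest \<partial>forest (\<mu> - {#1#}))"
    by (intro nn_integral_cong) (auto simp: indicator_def)
  also have "\<dots> = ennreal (pmf (reduced_law (\<mu> - {#1#})) \<tau>)"
    by (simp add: reduced_law_def pmf_map measure_pmf.emeasure_eq_measure)
  finally show ?thesis using True by (simp add: mb_tree_1 nn_integral_return removals_at_def)
next
  case False
  then have x: "2 \<le> x" using assms(1) by simp
  have *: "of_nat (count (removals_at t rest) \<tau>) =
      ennreal (real x) * ennreal (pmf (map_pmf (\<lambda>t'. Branch (add_mset t' rest)) (pmf_of_multiset (leaf_removals t))) \<tau>)"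
    if "t \<in> set_pmf (mb x)" for t rest
  proof -
    have t: "num_leaves t = x" "\<exists>ts. t = Branch ts"
      using mb_support[OF assms(1) that] x by (auto split: rtree.splits)
    then have s: "size (leaf_removals t) = x" by (auto simp: size_leaf_removals split: rtree.splits)
    then have "leaf_removals t \<noteq> {#}" using x by auto
    from pmf_map_pmf_of_multiset[OF this, of "\<lambda>t'. Branch (add_mset t' rest)" \<tau>] t s show ?thesis
      by (auto simp: removals_at_def ennreal_of_nat_eq_real_of_nat ennreal_mult'[symmetric])
  qed
  have "(\<integral>\<^sup>+ t. \<integral>\<^sup>+ rest. of_nat (count (removals_at t rest) \<tau>) \<partial>forest (\<mu> - {#x#}) \<partial>mb x) =
     (\<integral>\<^sup>+ t. \<integral>\<^sup>+ rest. ennreal (real x) * ennreal (pmf (map_pmf (\<lambda>t'. Branch (add_mset t' rest)) (pmf_of_multiset (leaf_removals t))) \<tau>) \<partial>forest (\<mu> - {#x#}) \<partial>mb x)"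
    by (intro nn_integral_cong_AE AE_pmfI) (simp add: *)
  also have "\<dots> = ennreal (real x) * ennreal (pmf (bind_pmf (mb x) (\<lambda>t. bind_pmf (forest (\<mu> - {#x#})) 
       (\<lambda>rest. map_pmf (\<lambda>t'. Branch (add_mset t' rest)) (pmf_of_multiset (leaf_removals t))))) \<tau>)"
    by (simp add: nn_integral_cmult ennreal_pmf_bind)
  also have "bind_pmf (mb x) (\<lambda>t. bind_pmf (forest (\<mu> - {#x#})) 
       (\<lambda>rest. map_pmf (\<lambda>t'. Branch (add_mset t' rest)) (pmf_of_multiset (leaf_removals t)))) =
     bind_pmf (removal x) (\<lambda>t'. map_pmf (\<lambda>rest. Branch (add_mset t' rest)) (forest (\<mu> - {#x#})))"
    unfolding removal_def bind_assoc_pmf map_pmf_def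
    by (intro bind_pmf_cong refl) (rule bind_commute_pmf)
  also have "\<dots> = map_pmf Branch (forest (dec_part x \<mu>))"
    using assms(3)[OF x] by (simp add: forest_law_def dec_part_def map_bind_pmf pmf.map_comp comp_def)
  finally show ?thesis using False by (simp add: ennreal_mult')
qed

text \<open>The factor n + 1 turns the uniform choice of a leaf into a count, which splits over the
  components. Only components smaller than the whole tree occur, so the induction hypothesis applies
  to them.\<close>

lemma pmf_removal:
  assumes n: "1 \<le> n" and IH: "\<And>x. 2 \<le> x \<Longrightarrow> x \<le> n \<Longrightarrow> removal x = mb (x - 1)"
  shows "(real n + 1) * pmf (removal (Suc n)) \<tau> = (\<Sum>\<mu>\<in>parts_of (Suc n). split_prob (Suc n) \<mu> *
     (\<Sum>x\<in>#\<mu>. if x = 1 then pmf (reduced_law (\<mu> - {#1#})) \<tau> else real x * pmf (map_pmf Branch (forest (dec_part x \<mu>))) \<tau>))"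
   (is "_ = (\<Sum>\<mu>\<in>_. _ * (\<Sum>x\<in>#\<mu>. ?R \<mu> x))")
proof -
  have n2: "2 \<le> Suc n" using n by simp
  have R0: "0 \<le> ?R \<mu> x" for \<mu> x by simp
  have R: "0 \<le> (\<Sum>x\<in>#\<mu>. ?R \<mu>' x)" for \<mu> \<mu>' by (induction \<mu>) (auto intro: add_nonneg_nonneg R0 simp del: if_split)
  have Renn: "(\<Sum>x\<in>#\<mu>. ennreal (?R \<mu>' x)) = ennreal (\<Sum>x\<in>#\<mu>. ?R \<mu>' x)" for \<mu> \<mu>'
  proof (induction \<mu>)
    case (add x \<mu>)
    show ?case unfolding image_mset_add_mset sum_mset.add_mset add.IH
      by (rule ennreal_plus[symmetric, OF R0 R])
  qed simp
  have inner: "(\<integral>\<^sup>+ ts. ennreal (real n + 1) * ennreal (pmf (pmf_of_multiset (leaf_removals (Branch ts))) \<tau>) \<partial>forest \<mu>) = ennreal (\<Sum>x\<in>#\<mu>. ?R \<mu> x)"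
    if \<mu>: "\<mu> \<in> parts_of (Suc n)" for \<mu>
  proof -
    have sizes: "image_mset num_leaves ts = \<mu>" if "ts \<in> set_pmf (forest \<mu>)" "0 \<notin># \<mu>" for ts \<mu>
      using that
    proof (induction \<mu> arbitrary: ts)
      case (add m \<mu>)
      then obtain t' ts' where "t' \<in> set_pmf (mb m)" "ts' \<in> set_pmf (forest \<mu>)" "ts = add_mset t' ts'"
        by (auto simp: forest_law_def)
      then show ?case using add mb_support[of m t'] by auto
    qed (simp add: forest_law_def)
    have "ennreal (real n + 1) * ennreal (pmf (pmf_of_multiset (leaf_removals (Branch ts))) \<tau>) =
       (\<Sum>t\<in>#ts. of_nat (count (removals_at t (ts - {#t#})) \<tau>))" if "ts \<in> set_pmf (forest \<mu>)" for ts
    proof -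
      have "image_mset num_leaves ts = \<mu>" using sizes[OF that] \<mu> by (auto simp: parts_of_def)
      then have s: "size (leaf_removals (Branch ts)) = Suc n" using \<mu> by (simp add: size_leaf_removals parts_of_def)
      then have "leaf_removals (Branch ts) \<noteq> {#}" by auto
      then have "(real n + 1) * pmf (pmf_of_multiset (leaf_removals (Branch ts))) \<tau> = real (count (leaf_removals (Branch ts)) \<tau>)"
        using s by (simp add: add.commute)
      then have "ennreal (real n + 1) * ennreal (pmf (pmf_of_multiset (leaf_removals (Branch ts))) \<tau>) = of_nat (count (leaf_removals (Branch ts)) \<tau>)"
        by (metis ennreal_mult' ennreal_of_nat_eq_real_of_nat pmf_nonneg of_nat_0_le_iff add_nonneg_nonneg zero_le_one)
      then show ?thesis by (simp add: leaf_removals_Branch count_sum_mset multiset.map_comp comp_def)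
    qed
    then have "(\<integral>\<^sup>+ ts. ennreal (real n + 1) * ennreal (pmf (pmf_of_multiset (leaf_removals (Branch ts))) \<tau>) \<partial>forest \<mu>) = 
      (\<integral>\<^sup>+ ts. (\<Sum>t\<in>#ts. of_nat (count (removals_at t (ts - {#t#})) \<tau>)) \<partial>forest \<mu>)"
      by (intro nn_integral_cong_AE AE_pmfI)
    also have "\<dots> = (\<Sum>x\<in>#\<mu>. \<integral>\<^sup>+ t. \<integral>\<^sup>+ rest. of_nat (count (removals_at t rest) \<tau>) \<partial>indep_mset (image_mset mb \<mu> - {#mb x#}) \<partial>mb x)"
      unfolding forest_law_def nn_integral_indep_mset_sum[where G = "\<lambda>t rest. of_nat (count (removals_at t rest) \<tau>)"] by (simp add: multiset.map_comp comp_def)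
    also have "\<dots> = (\<Sum>x\<in>#\<mu>. ennreal (?R \<mu> x))"
    proof (intro arg_cong[where f=sum_mset] image_mset_cong)
      fix x assume x: "x \<in># \<mu>"
      then have "x \<noteq> 0" "x < Suc n" using \<mu> parts_of_less[OF \<mu>] by (auto simp: parts_of_def intro: ccontr)
      moreover have "image_mset mb \<mu> - {#mb x#} = image_mset mb (\<mu> - {#x#})"
        using x by (auto dest!: multi_member_split)
      ultimately show "(\<integral>\<^sup>+ t. \<integral>\<^sup>+ rest. of_nat (count (removals_at t rest) \<tau>) \<partial>indep_mset (image_mset mb \<mu> - {#mb x#}) \<partial>mb x) = ennreal (?R \<mu> x)"
        using nn_integral_removals_at[of x \<mu> \<tau>] x IH[of x] by (simp add: forest_law_def)
    qed
    finally show ?thesis unfolding Renn .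
  qed
  have "ennreal ((real n + 1) * pmf (removal (Suc n)) \<tau>) = (\<integral>\<^sup>+ ns. (\<integral>\<^sup>+ ts. ennreal (real n + 1) * 
      ennreal (pmf (pmf_of_multiset (leaf_removals (Branch ts))) \<tau>) \<partial>forest (mset ns)) \<partial>split_pmf (q_seq \<alpha> \<gamma>) (Suc n))"
    unfolding removal_def mb_tree_unfold[OF splitting_rule_q_seq n2]
    by (simp add: ennreal_mult' bind_assoc_pmf bind_map_pmf ennreal_pmf_bind nn_integral_cmult)
  also have "\<dots> = (\<Sum>\<mu>\<in>parts_of (Suc n). ennreal (\<Sum>x\<in>#\<mu>. ?R \<mu> x) * ennreal (split_prob (Suc n) \<mu>))"
    by (subst nn_integral_split_pmf[OF n2]) (intro sum.cong refl, simp only: inner)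
  also have "\<dots> = ennreal (\<Sum>\<mu>\<in>parts_of (Suc n). split_prob (Suc n) \<mu> * (\<Sum>x\<in>#\<mu>. ?R \<mu> x))"
    using split_prob_nonneg[OF n2] R
    by (subst sum_ennreal[symmetric]) (auto simp: ennreal_mult'[symmetric] mult.commute intro!: sum.cong)
  finally show ?thesis using split_prob_nonneg[OF n2] R
    by (subst (asm) ennreal_inj) (auto intro!: sum_nonneg)
qed

text \<open>Regroups the pairs of a split of n + 1 and the part that loses a leaf by the split of n
  that results. The pair {n, 1} with the part 1 leaves {n}, which is not a split; this is the extra
  summand.\<close>

lemma split_prob_reindex:
  assumes n: "2 \<le> n" 
  shows "(\<Sum>\<mu>\<in>parts_of (Suc n). split_prob (Suc n) \<mu> *
     (\<Sum>x\<in>#\<mu>. if x = 1 then h (\<mu> - {#1#}) else real x * h (dec_part x \<mu>))) =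
     (\<Sum>\<mu>\<in>parts_of n. h \<mu> * ((\<Sum>x\<in>#\<mu>. (real x + 1) * ag_comp \<alpha> \<gamma> (Suc n) (inc_part x \<mu>)) + ag_comp \<alpha> \<gamma> (Suc n) (add_mset 1 \<mu>)) / multiplicity_fact \<mu>)
     + ag_comp \<alpha> \<gamma> (Suc n) {#n, 1#} * h {#n#}"
proof -
  let ?A = "ag_comp \<alpha> \<gamma> (Suc n)"
  let ?N = "\<lambda>\<mu> x. real (count \<mu> x) / multiplicity_fact \<mu>"
  \<comment> \<open>\<open>P1\<close> collects the cases in which a part of size at least 2 shrinks,
    \<open>P2\<close> those in which a singleton disappears.\<close>
  define P1 where "P1 = (SIGMA \<mu>:parts_of (Suc n). set_mset \<mu> - {1})"
  define P2 where "P2 = {\<mu>\<in>parts_of (Suc n). 1 \<in># \<mu>}"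
  have "(\<Sum>\<mu>\<in>parts_of (Suc n). split_prob (Suc n) \<mu> *
     (\<Sum>x\<in>#\<mu>. if x = 1 then h (\<mu> - {#1#}) else real x * h (dec_part x \<mu>))) =
     (\<Sum>\<mu>\<in>parts_of (Suc n). (\<Sum>x\<in>set_mset \<mu> - {1}. ?N \<mu> x * ?A \<mu> * (real x * h (dec_part x \<mu>)))
       + (if 1 \<in># \<mu> then ?N \<mu> 1 * ?A \<mu> * h (\<mu> - {#1#}) else 0))"
  proof (intro sum.cong refl)
    fix \<mu>
    let ?f = "\<lambda>x. ?N \<mu> x * ?A \<mu> * (if x = 1 then h (\<mu> - {#1#}) else real x * h (dec_part x \<mu>))"
    have "split_prob (Suc n) \<mu> * (\<Sum>x\<in>#\<mu>. if x = 1 then h (\<mu> - {#1#}) else real x * h (dec_part x \<mu>)) = (\<Sum>x\<in>set_mset \<mu>. ?f x)"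
      unfolding sum_mset_count sum_distrib_left split_prob_def by (intro sum.cong refl) simp
    also have "\<dots> = (\<Sum>x\<in>set_mset \<mu> - {1}. ?f x) + (\<Sum>x\<in>set_mset \<mu> \<inter> {1}. ?f x)"
      by (subst sum.Int_Diff[of _ _ "{1}"]) auto
    also have "(\<Sum>x\<in>set_mset \<mu> - {1}. ?f x) = (\<Sum>x\<in>set_mset \<mu> - {1}. ?N \<mu> x * ?A \<mu> * (real x * h (dec_part x \<mu>)))"
      by (intro sum.cong) auto
    also have "(\<Sum>x\<in>set_mset \<mu> \<inter> {1}. ?f x) = (if 1 \<in># \<mu> then ?N \<mu> 1 * ?A \<mu> * h (\<mu> - {#1#}) else 0)"
      by simp
    finally show "split_prob (Suc n) \<mu> * (\<Sum>x\<in>#\<mu>. if x = 1 then h (\<mu> - {#1#}) else real x * h (dec_part x \<mu>)) =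
      (\<Sum>x\<in>set_mset \<mu> - {1}. ?N \<mu> x * ?A \<mu> * (real x * h (dec_part x \<mu>)))
       + (if 1 \<in># \<mu> then ?N \<mu> 1 * ?A \<mu> * h (\<mu> - {#1#}) else 0)" .
  qed
  also have "\<dots> = (\<Sum>(\<mu>,x)\<in>P1. ?N \<mu> x * ?A \<mu> * (real x * h (dec_part x \<mu>))) + (\<Sum>\<mu>\<in>P2. ?N \<mu> 1 * ?A \<mu> * h (\<mu> - {#1#}))"
    unfolding sum.distrib P1_def P2_def
    by (subst sum.Sigma) (auto simp: finite_parts_of sum.inter_filter intro!: sum.cong)
  also have "(\<Sum>(\<mu>,x)\<in>P1. ?N \<mu> x * ?A \<mu> * (real x * h (dec_part x \<mu>))) =
    (\<Sum>(\<mu>,x)\<in>(SIGMA \<mu>:parts_of n. set_mset \<mu>). ?N \<mu> x * ?A (inc_part x \<mu>) * ((real x + 1) * h \<mu>))"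
  proof (rule sum.reindex_bij_witness[of _ "\<lambda>(\<mu>,x). (inc_part x \<mu>, Suc x)" "\<lambda>(\<mu>,x). (dec_part x \<mu>, x - 1)"], goal_cases)
    case (1 a)
    obtain \<mu> x where a: "a = (\<mu>, x)" by force
    with 1 have x: "x \<in># \<mu>" "x \<noteq> 0" by (auto simp: P1_def parts_of_def intro: ccontr)
    then show ?case using inc_dec_part(1)[of x \<mu>] by (simp add: a)
  next
    case (2 a)
    obtain \<mu> x where a: "a = (\<mu>, x)" by force
    with 2 have x: "x \<in># \<mu>" "x \<noteq> 0" "x \<noteq> 1" "\<mu> \<in> parts_of (Suc n)" by (auto simp: P1_def parts_of_def intro: ccontr)
    then have "dec_part x \<mu> \<in> parts_of n" by (auto dest!: multi_member_split simp: parts_of_def dec_part_def)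
    then show ?case by (simp add: a) (simp add: dec_part_def)
  next
    case (3 b)
    then show ?case using inc_dec_part(2) by auto
  next
    case (4 b)
    obtain \<mu> x where b: "b = (\<mu>, x)" by force
    with 4 have x: "x \<in># \<mu>" "x \<noteq> 0" "\<mu> \<in> parts_of n" by (auto simp: parts_of_def intro: ccontr)
    then show ?case using inc_part_simps(3)[OF x(1,3)] by (simp add: b P1_def) (simp add: inc_part_def)
  next
    case (5 a)
    obtain \<mu> x where a: "a = (\<mu>, x)" by force
    with 5 have x: "x \<in># \<mu>" "x \<noteq> 0" by (auto simp: P1_def parts_of_def intro: ccontr)
    have "?N (dec_part x \<mu>) (x - 1) = 1 / multiplicity_fact (\<mu> - {#x#})"
      by (subst count_div_multiplicity_fact) (auto simp: dec_part_def)
    also have "\<dots> = ?N \<mu> x" using x by (simp add: count_div_multiplicity_fact)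
    finally have "?N (dec_part x \<mu>) (x - 1) * (?A \<mu> * (real x * h (dec_part x \<mu>))) = ?N \<mu> x * (?A \<mu> * (real x * h (dec_part x \<mu>)))"
      by simp
    then show ?case using inc_dec_part(1)[OF x] x by (simp add: a of_nat_diff mult.assoc)
  qed
  also have "(\<Sum>(\<mu>,x)\<in>(SIGMA \<mu>:parts_of n. set_mset \<mu>). ?N \<mu> x * ?A (inc_part x \<mu>) * ((real x + 1) * h \<mu>)) =
     (\<Sum>\<mu>\<in>parts_of n. h \<mu> * (\<Sum>x\<in>#\<mu>. (real x + 1) * ?A (inc_part x \<mu>)) / multiplicity_fact \<mu>)"
    by (subst sum.Sigma[symmetric])
      (auto simp: finite_parts_of sum_mset_count sum_distrib_left sum_divide_distrib intro!: sum.cong)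
  also have "(\<Sum>\<mu>\<in>P2. ?N \<mu> 1 * ?A \<mu> * h (\<mu> - {#1#})) = (\<Sum>\<mu>\<in>insert {#n#} (parts_of n). ?A (add_mset 1 \<mu>) * h \<mu> / multiplicity_fact \<mu>)"
  proof (rule sum.reindex_bij_witness[of _ "add_mset 1" "\<lambda>\<mu>. \<mu> - {#1#}"], goal_cases)
    case (2 \<mu>)
    then obtain \<nu> where \<nu>: "\<mu> = add_mset 1 \<nu>" by (auto simp: P2_def dest: multi_member_split)
    with 2 have *: "1 \<le> size \<nu>" "0 \<notin># \<nu>" "\<Sum>\<^sub># \<nu> = n" by (auto simp: P2_def parts_of_def)
    show ?case
    proof (cases "size \<nu> = 1")
      case True
      then obtain y where "\<nu> = {#y#}" by (metis size_1_singleton_mset)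
      then show ?thesis using * \<nu> by auto
    next
      case False
      then show ?thesis using * \<nu> by (auto simp: parts_of_def)
    qed
  next
    case (4 \<mu>)
    then show ?case using n by (auto simp: P2_def parts_of_def)
  next
    case (5 \<mu>)
    then show ?case using count_div_multiplicity_fact[of 1 \<mu>] by (auto simp: P2_def)
  qed (auto simp: P2_def)
  also have "\<dots> = (\<Sum>\<mu>\<in>parts_of n. ?A (add_mset 1 \<mu>) * h \<mu> / multiplicity_fact \<mu>) + ?A {#n, 1#} * h {#n#}"
  proof -
    have "{#n#} \<notin> parts_of n" by (simp add: parts_of_def)
    moreover have "multiplicity_fact {#n#} = 1" by (simp add: multiplicity_fact_def)
    ultimately show ?thesis by (simp add: finite_parts_of add_mset_commute)
  qed
  finally show ?thesis
    by (simp add: sum.distrib[symmetric] algebra_simps add_divide_distrib)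
qed

text \<open>Strong induction, because components of any smaller size lose leaves. Two leaves are
  treated apart, since the tree that remains has no split.\<close>

lemma removal_eq: "1 \<le> n \<Longrightarrow> removal (Suc n) = mb n"
proof (induction n rule: less_induct)
  case (less n)
  have IH: "removal x = mb (x - 1)" if "2 \<le> x" "x \<le> n" for x
    using less.IH[of "x - 1"] that by simp
  show ?case
  proof (rule pmf_eqI)
    fix \<tau>
    define h where "h \<mu> = pmf (reduced_law \<mu>) \<tau>" for \<mu>
    have hB: "pmf (map_pmf Branch (forest \<mu>)) \<tau> = h \<mu>" if "2 \<le> size \<mu>" for \<mu>
      using that by (simp add: h_def reduced_law_Branch)
    have "(real n + 1) * pmf (removal (Suc n)) \<tau> = (\<Sum>\<mu>\<in>parts_of (Suc n). split_prob (Suc n) \<mu> *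
     (\<Sum>x\<in>#\<mu>. if x = 1 then h (\<mu> - {#1#}) else real x * pmf (map_pmf Branch (forest (dec_part x \<mu>))) \<tau>))"
      unfolding h_def by (rule pmf_removal[OF less.prems IH])
    also have "\<dots> = (\<Sum>\<mu>\<in>parts_of (Suc n). split_prob (Suc n) \<mu> *
     (\<Sum>x\<in>#\<mu>. if x = 1 then h (\<mu> - {#1#}) else real x * h (dec_part x \<mu>)))"
    proof (intro sum.cong refl arg_cong2[where f="(*)"] arg_cong[where f=sum_mset] image_mset_cong)
      fix \<mu> x assume "\<mu> \<in> parts_of (Suc n)" "x \<in># \<mu>"
      then have "2 \<le> size (dec_part x \<mu>)" by (auto simp: dec_part_def parts_of_def dest!: multi_member_split)
      then show "(if x = 1 then h (\<mu> - {#1#}) else real x * pmf (map_pmf Branch (forest (dec_part x \<mu>))) \<tau>) =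
         (if x = 1 then h (\<mu> - {#1#}) else real x * h (dec_part x \<mu>))" by (simp add: hB)
    qed
    also have "\<dots> = (real n + 1) * pmf (mb n) \<tau>"
    proof (cases "n = 1")
      case True
      have "split_prob 2 {#1, 1#} = 1" by (simp add: split_prob_def ag_comp_2 multiplicity_fact_def numeral_2_eq_2[symmetric])
      moreover have n2: "Suc n = 2" using True by simp
      moreover have "h {#1#} = pmf (mb n) \<tau>" using True by (simp add: h_def reduced_law_single)
      ultimately show ?thesis using True unfolding n2 parts_of_2 by simp
    next
      case False
      then have n: "2 \<le> n" using less.prems by simp
      have mb: "pmf (mb n) \<tau> = (\<Sum>\<mu>\<in>parts_of n. split_prob n \<mu> * h \<mu>)"
        unfolding pmf_mb[OF n] by (intro sum.cong refl) (simp add: hB parts_of_def)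
      have "h {#n#} = pmf (mb n) \<tau>" by (simp add: h_def reduced_law_single)
      \<comment> \<open>The value \<open>h {#n#}\<close> is the probability of \<tau> under
        \<open>mb n\<close>. Expanding it again over the first split makes the extra summand a sum
        over \<open>parts_of n\<close>, and both sides can be compared split by split.\<close>
      then have "(\<Sum>\<mu>\<in>parts_of (Suc n). split_prob (Suc n) \<mu> *
     (\<Sum>x\<in>#\<mu>. if x = 1 then h (\<mu> - {#1#}) else real x * h (dec_part x \<mu>))) =
     (\<Sum>\<mu>\<in>parts_of n. h \<mu> * ((\<Sum>x\<in>#\<mu>. (real x + 1) * ag_comp \<alpha> \<gamma> (Suc n) (inc_part x \<mu>)) + ag_comp \<alpha> \<gamma> (Suc n) (add_mset 1 \<mu>)
         + ag_comp \<alpha> \<gamma> (Suc n) {#n, 1#} * ag_comp \<alpha> \<gamma> n \<mu>) / multiplicity_fact \<mu>)"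
        by (subst split_prob_reindex[OF n, of h])
          (simp add: mb split_prob_def sum_distrib_left sum.distrib[symmetric] distrib_left add_divide_distrib mult_ac)
      also have "\<dots> = (\<Sum>\<mu>\<in>parts_of n. h \<mu> * ((real n + 1) * ag_comp \<alpha> \<gamma> n \<mu>) / multiplicity_fact \<mu>)"
        using ag by (intro sum.cong refl) (simp only: ag_comp_sampling)
      also have "\<dots> = (real n + 1) * pmf (mb n) \<tau>"
        unfolding mb split_prob_def by (simp add: sum_distrib_left mult_ac)
      finally show ?thesis .
    qed
    finally show "pmf (removal (Suc n)) \<tau> = pmf (mb n) \<tau>" by simp
  qed
qed

lemma sampling_consistent_q_seq: "sampling_consistent (q_seq \<alpha> \<gamma>)"
  unfolding sampling_consistent_def
proof (intro allI impI)
  fix n :: nat assume "2 \<le> n"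
  then show "bind_pmf (mb n) (\<lambda>t. pmf_of_multiset (leaf_removals t)) = mb (n - 1)"
    using removal_eq[of "n - 1"] by (simp add: removal_def)
qed

end

section \<open>Infinite sums of nonnegative terms as integrals\<close>

lemma infsum_eq_nn_integral_count_space:
  fixes f :: "'a \<Rightarrow> ennreal"
  assumes "countable A"
  shows "infsum f A = (\<integral>\<^sup>+ x. f x \<partial>count_space A)"
proof (cases "A = {}")
  case False
  have inf: "infsum f A = (SUP F\<in>{F. finite F \<and> F \<subseteq> A}. sum f F)"
    by (rule nonneg_infsum_complete) simp
  \<comment> \<open>Finite sets increasing to A along an enumeration. Repetitions in the enumeration
    are harmless, so finite A is included.\<close>
  define B where "B n = from_nat_into A ` {..<n}" for n
  have B: "finite (B n)" "B n \<subseteq> A" for n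
    using from_nat_into[OF False] by (auto simp: B_def)
  have fin: "(\<integral>\<^sup>+ x. f x * indicator F x \<partial>count_space A) = sum f F" if "finite F" "F \<subseteq> A" for F
    using that by (subst nn_integral_count_space'[of F]) auto
  have "(SUP n. f x * indicator (B n) x) = f x" if x: "x \<in> A" for x
  proof (rule antisym)
    show "(SUP n. f x * indicator (B n) x) \<le> f x"
      by (rule SUP_least) (simp add: indicator_def)
    obtain i where "from_nat_into A i = x" using from_nat_into_surj[OF assms x] by blast
    then have "x \<in> B (Suc i)" by (auto simp: B_def)
    then show "f x \<le> (SUP n. f x * indicator (B n) x)" by (intro SUP_upper2[of "Suc i"]) auto
  qed
  then have "(\<integral>\<^sup>+ x. f x \<partial>count_space A) = (\<integral>\<^sup>+ x. (SUP n. f x * indicator (B n) x) \<partial>count_space A)"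
    by (intro nn_integral_cong) simp
  also have "\<dots> = (SUP n. \<integral>\<^sup>+ x. f x * indicator (B n) x \<partial>count_space A)"
    by (intro nn_integral_monotone_convergence_SUP)
      (auto simp: incseq_def le_fun_def B_def indicator_def)
  also have "\<dots> = (SUP n. sum f (B n))" using fin[OF B] by simp
  finally have eq: "(\<integral>\<^sup>+ x. f x \<partial>count_space A) = (SUP n. sum f (B n))" .
  show ?thesis
  proof (rule antisym)
    have "sum f F \<le> (\<integral>\<^sup>+ x. f x \<partial>count_space A)" if "finite F" "F \<subseteq> A" for F
      unfolding fin[OF that, symmetric] by (intro nn_integral_mono) (simp add: indicator_def)
    then show "infsum f A \<le> (\<integral>\<^sup>+ x. f x \<partial>count_space A)" unfolding inf by (intro SUP_least) auto
    show "(\<integral>\<^sup>+ x. f x \<partial>count_space A) \<le> infsum f A"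
      unfolding inf eq using B by (intro SUP_mono) auto
  qed
qed (simp add: nn_integral_empty)

section \<open>Sums over distinct indices\<close>

text \<open>The integrand of \<open>paintbox_integral\<close>: an augmented monomial symmetric
  function of the sequence f.\<close>

definition dsum :: "(nat \<Rightarrow> real) \<Rightarrow> nat list \<Rightarrow> ennreal" where
  "dsum f ns = (\<Sum>\<^sub>\<infinity>is\<in>{is. length is = length ns \<and> distinct is}.
        \<Prod>j<length ns. ennreal (f (is ! j) ^ (ns ! j)))"

lemma dsum_eq_nn_integral:
  "dsum f ns = (\<integral>\<^sup>+ is. (\<Prod>j<length ns. ennreal (f (is ! j) ^ (ns ! j))) \<partial>count_space {is. length is = length ns \<and> distinct is})"
  unfolding dsum_def by (rule infsum_eq_nn_integral_count_space) simp

lemma dsum_Nil: "dsum f [] = 1"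
proof -
  have *: "{is :: nat list. length is = length [] \<and> distinct is} = {[]}" by auto
  show ?thesis unfolding dsum_def * by simp
qed

text \<open>An index for the new exponent n either avoids the indices chosen for \<open>ns\<close>
  or coincides with exactly one of them, whose exponent then grows by n. Stated with a sum on the
  left to stay clear of subtraction in ennreal.\<close>

lemma dsum_Cons:
  assumes f: "\<And>i. 0 \<le> f i"
  shows "dsum f (n # ns) + (\<Sum>j<length ns. dsum f (ns[j := ns ! j + n])) =
    (\<integral>\<^sup>+ i. ennreal (f i ^ n) \<partial>count_space UNIV) * dsum f ns"
proof -
  define D where "D = {is :: nat list. length is = length ns \<and> distinct is}"
  define w where "w is = (\<Prod>j<length ns. ennreal (f (is ! j) ^ (ns ! j)))" for "is"
  define g where "g = (\<lambda>(i, is). ennreal (f i ^ n) * w is)"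
  define X where "X = {(i, is). is \<in> D \<and> i \<notin> set is}"
  define Y where "Y j = {(i, is). is \<in> D \<and> i = is ! j}" for j
  have split: "g z * indicator (UNIV \<times> D) z = g z * indicator X z + (\<Sum>j<length ns. g z * indicator (Y j) z)" for z
  proof (cases z)
    case (Pair i "is")
    show ?thesis
    proof (cases "is \<in> D \<and> i \<in> set is")
      case True
      then obtain j where j: "j < length ns" "is ! j = i" by (auto simp: D_def in_set_conv_nth)
      have "(\<Sum>j'<length ns. g z * indicator (Y j') z) = (\<Sum>j'<length ns. if j' = j then g z else 0)"
        using True j by (intro sum.cong) (auto simp: Pair Y_def D_def indicator_def nth_eq_iff_index_eq)
      then show ?thesis using True j by (simp add: Pair X_def)
    next
      case False
      have "(\<Sum>j<length ns. g z * indicator (Y j) z) = 0"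
        using False by (intro sum.neutral) (auto simp: Pair Y_def D_def indicator_def)
      then show ?thesis using False by (simp add: Pair X_def indicator_def)
    qed
  qed
  have "(\<integral>\<^sup>+ i. ennreal (f i ^ n) \<partial>count_space UNIV) * dsum f ns =
     (\<integral>\<^sup>+ i. \<integral>\<^sup>+ is. g (i, is) * indicator (UNIV \<times> D) (i, is) \<partial>count_space UNIV \<partial>count_space UNIV)"
    unfolding dsum_eq_nn_integral D_def[symmetric] w_def[symmetric]
    by (simp add: g_def nn_integral_cmult nn_integral_multc mult.assoc nn_integral_count_space_indicator indicator_times)
  also have "\<dots> = (\<integral>\<^sup>+ z. g z * indicator (UNIV \<times> D) z \<partial>count_space UNIV)"
    by (rule nn_integral_fst_count_space)
  also have "\<dots> = (\<integral>\<^sup>+ z. g z * indicator X z \<partial>count_space UNIV) + (\<integral>\<^sup>+ z. (\<Sum>j<length ns. g z * indicator (Y j) z) \<partial>count_space UNIV)"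
    unfolding split by (rule nn_integral_add) simp_all
  also have "(\<integral>\<^sup>+ z. (\<Sum>j<length ns. g z * indicator (Y j) z) \<partial>count_space UNIV) = (\<Sum>j<length ns. \<integral>\<^sup>+ z. g z * indicator (Y j) z \<partial>count_space UNIV)"
    by (rule nn_integral_sum) simp
  also have "(\<integral>\<^sup>+ z. g z * indicator X z \<partial>count_space UNIV) = dsum f (n # ns)"
  proof -
    let ?C = "{is. length is = length (n # ns) \<and> distinct is}"
    have "bij_betw (\<lambda>(i, is). i # is) X ?C"
      by (rule bij_betw_byWitness[where f' = "\<lambda>is. (hd is, tl is)"])
        (auto simp: X_def D_def length_Suc_conv)
    from nn_integral_bij_count_space[OF this, of "\<lambda>is. \<Prod>j<length (n # ns). ennreal (f (is ! j) ^ ((n # ns) ! j))"]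
    have "dsum f (n # ns) = (\<integral>\<^sup>+ z. g z \<partial>count_space X)"
      unfolding dsum_eq_nn_integral
      by (simp add: g_def w_def case_prod_unfold prod.lessThan_Suc_shift del: prod.lessThan_Suc)
    then show ?thesis by (simp add: nn_integral_count_space_indicator)
  qed
  also have "(\<Sum>j<length ns. \<integral>\<^sup>+ z. g z * indicator (Y j) z \<partial>count_space UNIV) = (\<Sum>j<length ns. dsum f (ns[j := ns ! j + n]))"
  proof (intro sum.cong refl)
    fix j assume j: "j \<in> {..<length ns}"
    have "bij_betw (\<lambda>is. (is ! j, is)) D (Y j)"
      by (rule bij_betw_byWitness[where f' = snd]) (auto simp: Y_def)
    from nn_integral_bij_count_space[OF this, of g]
    have "(\<integral>\<^sup>+ z. g z \<partial>count_space (Y j)) = (\<integral>\<^sup>+ is. g (is ! j, is) \<partial>count_space D)" by simp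
    also have "\<dots> = dsum f (ns[j := ns ! j + n])"
      unfolding dsum_eq_nn_integral length_list_update D_def[symmetric]
    proof (intro nn_integral_cong)
      fix "is"
      have "g (is ! j, is) = ennreal (f (is ! j) ^ n) * (ennreal (f (is ! j) ^ (ns ! j)) * (\<Prod>i\<in>{..<length ns} - {j}. ennreal (f (is ! i) ^ (ns ! i))))"
        using j by (simp add: g_def w_def prod.remove)
      also have "\<dots> = ennreal (f (is ! j) ^ (ns ! j + n)) * (\<Prod>i\<in>{..<length ns} - {j}. ennreal (f (is ! i) ^ (ns[j := ns ! j + n] ! i)))"
        unfolding mult.assoc[symmetric] using f
        by (intro arg_cong2[where f="(*)"] prod.cong) (auto simp: power_add ennreal_mult'[symmetric] mult.commute)
      also have "\<dots> = (\<Prod>i<length ns. ennreal (f (is ! i) ^ (ns[j := ns ! j + n] ! i)))"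
        using j by (simp add: prod.remove[of "{..<length ns}" j])
      finally show "g (is ! j, is) = \<dots>" .
    qed
    finally show "(\<integral>\<^sup>+ z. g z * indicator (Y j) z \<partial>count_space UNIV) = dsum f (ns[j := ns ! j + n])"
      by (simp add: nn_integral_count_space_indicator)
  qed
  finally show ?thesis by simp
qed

text \<open>\<open>dsum_Cons\<close> solved for its first term, with p n in the role of the n-th
  power sum. Convergence, measurability and integrals of \<open>dsum\<close> can thus be handled
  through power sums of real numbers.\<close>

fun power_sum_poly :: "(nat \<Rightarrow> real) \<Rightarrow> nat list \<Rightarrow> real" where
  "power_sum_poly p [] = 1"
| "power_sum_poly p (n # ns) =
     p n * power_sum_poly p ns - (\<Sum>j<length ns. power_sum_poly p (ns[j := ns ! j + n]))"

lemma list_update_ge_1: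
  assumes "\<forall>m\<in>set ns. Suc 0 \<le> m"
  shows "\<forall>m\<in>set (ns[j := ns ! j + n]). Suc 0 \<le> m"
proof (cases "j < length ns")
  case True
  then have "Suc 0 \<le> ns ! j + n" using assms nth_mem by (blast intro: trans_le_add1)
  then show ?thesis using assms set_update_subset_insert[of ns j "ns ! j + n"] by blast
qed (use assms in \<open>simp add: list_update_beyond\<close>)

lemma dsum_eq_power_sum_poly:
  assumes f: "\<And>i. 0 \<le> f i" and s: "\<And>n. 1 \<le> n \<Longrightarrow> summable (\<lambda>i. f i ^ n)"
    and p: "\<And>n. 1 \<le> n \<Longrightarrow> p n = (\<Sum>i. f i ^ n)" and ns: "\<forall>m\<in>set ns. Suc 0 \<le> m"
  shows "dsum f ns = ennreal (power_sum_poly p ns) \<and> 0 \<le> power_sum_poly p ns"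
  using ns
proof (induction "length ns" arbitrary: ns)
  case 0 then show ?case by (simp add: dsum_Nil)
next
  case (Suc k)
  then obtain n ns' where ns: "ns = n # ns'" "length ns' = k" by (cases ns) auto
  have n: "1 \<le> n" "\<forall>m\<in>set ns'. Suc 0 \<le> m" using Suc.prems ns by auto
  have ih: "dsum f xs = ennreal (power_sum_poly p xs)" "0 \<le> power_sum_poly p xs"
    if "length xs = k" "\<forall>m\<in>set xs. Suc 0 \<le> m" for xs
    using Suc.hyps(1)[of xs] that by auto
  define S where "S = (\<Sum>j<length ns'. power_sum_poly p (ns'[j := ns' ! j + n]))"
  have S0: "0 \<le> S" unfolding S_def using ns n list_update_ge_1 by (intro sum_nonneg ih) auto
  have "(\<Sum>j<length ns'. dsum f (ns'[j := ns' ! j + n])) = (\<Sum>j<length ns'. ennreal (power_sum_poly p (ns'[j := ns' ! j + n])))"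
    using ns n list_update_ge_1 by (intro sum.cong refl ih) auto
  also have "\<dots> = ennreal S" unfolding S_def
    using ns n list_update_ge_1 by (intro sum_ennreal ih) auto
  finally have sumS: "(\<Sum>j<length ns'. dsum f (ns'[j := ns' ! j + n])) = ennreal S" .
  have pn: "(\<integral>\<^sup>+ i. ennreal (f i ^ n) \<partial>count_space UNIV) = ennreal (p n)" "0 \<le> p n"
    using s[OF n(1)] p[OF n(1)] f
    by (auto simp: nn_integral_count_space_nat intro!: suminf_ennreal2 suminf_nonneg)
  have "dsum f ns + ennreal S = ennreal (p n) * ennreal (power_sum_poly p ns')"
    using dsum_Cons[of f n ns', OF f] unfolding sumS pn(1) ih(1)[OF ns(2) n(2)] ns(1) .
  then have eq: "dsum f ns + ennreal S = ennreal (p n * power_sum_poly p ns')"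
    using pn ih(2)[OF ns(2) n(2)] by (simp add: ennreal_mult')
  then have "ennreal S \<le> ennreal (p n * power_sum_poly p ns')" by (metis add.commute le_iff_add)
  then have le: "S \<le> p n * power_sum_poly p ns'"
    using S0 pn ih(2)[OF ns(2) n(2)] by (subst (asm) ennreal_le_iff) auto
  \<comment> \<open>Subtraction is legitimate here because the sum of coincidence terms is
    finite.\<close>
  have "dsum f ns = ennreal (p n * power_sum_poly p ns') - ennreal S"
    using eq by (metis ennreal_add_diff_cancel_right ennreal_neq_top)
  also have "\<dots> = ennreal (p n * power_sum_poly p ns' - S)" using S0 by (simp add: ennreal_minus)
  finally show ?case using le by (simp add: ns S_def)
qed

text \<open>Drops the coincidence terms of \<open>dsum_Cons\<close>; used as a majorant for
  dominated convergence.\<close>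

lemma dsum_le:
  assumes f: "\<And>i. 0 \<le> f i" and s: "\<And>n. 1 \<le> n \<Longrightarrow> summable (\<lambda>i. f i ^ n)"
    and ns: "\<forall>m\<in>set ns. Suc 0 \<le> m" and B: "\<And>n. 1 \<le> n \<Longrightarrow> (\<Sum>i. f i ^ n) \<le> B ^ n" "0 \<le> B"
  shows "dsum f ns \<le> ennreal (B ^ sum_list ns)"
  using ns
proof (induction ns)
  case (Cons n ns)
  have n: "1 \<le> n" using Cons.prems by simp
  have "dsum f (n # ns) \<le> (\<integral>\<^sup>+ i. ennreal (f i ^ n) \<partial>count_space UNIV) * dsum f ns"
    unfolding dsum_Cons[of f, OF f, symmetric] by (rule le_iff_add[THEN iffD2]) blast
  also have "(\<integral>\<^sup>+ i. ennreal (f i ^ n) \<partial>count_space UNIV) = ennreal (\<Sum>i. f i ^ n)"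
    using s[OF n] f by (auto simp: nn_integral_count_space_nat intro!: suminf_ennreal2)
  also have "\<dots> * dsum f ns \<le> ennreal (B ^ n) * ennreal (B ^ sum_list ns)"
    using Cons B n by (intro mult_mono) (auto intro!: ennreal_leI)
  finally show ?case using B by (simp add: ennreal_mult'[symmetric] power_add)
qed (simp add: dsum_Nil)

lemma tendsto_power_sum_poly:
  assumes "\<And>n. 1 \<le> n \<Longrightarrow> ((\<lambda>m. p m n) \<longlongrightarrow> q n) F" "\<forall>m\<in>set ns. Suc 0 \<le> m"
  shows "((\<lambda>m. power_sum_poly (p m) ns) \<longlongrightarrow> power_sum_poly q ns) F"
  using assms(2)
proof (induction "length ns" arbitrary: ns)
  case (Suc k)
  then obtain n ns' where ns: "ns = n # ns'" "length ns' = k" by (cases ns) auto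
  have n: "1 \<le> n" "\<forall>m\<in>set ns'. Suc 0 \<le> m" using Suc.prems ns by auto
  show ?case unfolding ns power_sum_poly.simps
    using ns n list_update_ge_1 by (intro tendsto_intros assms(1) Suc.hyps(1)) auto
qed simp

lemma measurable_power_sum_poly:
  assumes "\<And>n. (\<lambda>x. p x n) \<in> borel_measurable M"
  shows "(\<lambda>x. power_sum_poly (p x) ns) \<in> borel_measurable M"
proof (induction "length ns" arbitrary: ns)
  case (Suc k)
  then obtain n ns' where ns: "ns = n # ns'" "length ns' = k" by (cases ns) auto
  have [measurable]: "(\<lambda>x. power_sum_poly (p x) xs) \<in> borel_measurable M" if "length xs = k" for xs
    using Suc.hyps(1) that by blast
  note assms[measurable]
  show ?case unfolding ns power_sum_poly.simps using ns(2)
    by (intro borel_measurable_diff borel_measurable_times borel_measurable_sum assms Suc.hyps(1)) auto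
qed simp

section \<open>Decreasing rearrangements\<close>

text \<open>The formula of \<open>ranked_jumps\<close> for an arbitrary index set, so that jumps and
  dyadic increments are sorted by the same operation.\<close>

definition ranked :: "'k set \<Rightarrow> ('k \<Rightarrow> real) \<Rightarrow> nat \<Rightarrow> real" where
  "ranked K f i = Sup ({0} \<union> {y. 0 < y \<and> i < card {k\<in>K. y \<le> f k}})"

lemma ranked_jumps_eq: "ranked_jumps x = ranked {0<..1} (jump x)"
  by (rule ext) (simp add: ranked_jumps_def ranked_def)

text \<open>Bounded finite sums force the level sets at positive heights to be finite. This matters
  because \<open>card\<close> is 0 on infinite sets, which would falsify the ranking.\<close>

locale rankable =
  fixes K :: "'k set" and f :: "'k \<Rightarrow> real" and B :: real
  assumes finite_sum_le: "\<And>F. finite F \<Longrightarrow> F \<subseteq> K \<Longrightarrow> sum f F \<le> B"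
begin

lemma B_nonneg: "0 \<le> B"
  using finite_sum_le[of "{}"] by simp

lemma level_card:
  assumes "0 < y" "finite F" "F \<subseteq> {k\<in>K. y \<le> f k}"
  shows "y * card F \<le> B"
proof -
  have "y * card F = (\<Sum>k\<in>F. y)" by simp
  also have "\<dots> \<le> sum f F" using assms by (intro sum_mono) auto
  also have "\<dots> \<le> B" using assms by (intro finite_sum_le) auto
  finally show ?thesis .
qed

lemma finite_level:
  assumes "0 < y"
  shows "finite {k\<in>K. y \<le> f k}"
proof (rule ccontr)
  assume "infinite {k\<in>K. y \<le> f k}"
  then obtain F where F: "finite F" "F \<subseteq> {k\<in>K. y \<le> f k}" "card F = Suc (nat \<lceil>B / y\<rceil>)"
    by (meson infinite_arbitrarily_large)
  have "y * card F \<le> B" using level_card assms F by blast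
  then have "real (card F) \<le> B / y" using assms by (simp add: field_simps)
  also have "\<dots> \<le> real (nat \<lceil>B / y\<rceil>)" by linarith
  finally show False using F by simp
qed

text \<open>Finer than boundedness: i + 1 values of size at least y sum to at most B. The resulting
  decay of ranks like 1 / (i + 1) is the source of all majorants below.\<close>

lemma level_bound: "0 < y \<Longrightarrow> i < card {k\<in>K. y \<le> f k} \<Longrightarrow> y \<le> B / (real i + 1)"
proof -
  assume y: "0 < y" and i: "i < card {k\<in>K. y \<le> f k}"
  have "y * (real i + 1) \<le> y * card {k\<in>K. y \<le> f k}" using y i by (intro mult_left_mono) auto
  also have "\<dots> \<le> B" using level_card[OF y finite_level[OF y]] by simp
  finally show ?thesis by (simp add: field_simps)
qed

lemma bdd_above_levels: "bdd_above ({0} \<union> {y. 0 < y \<and> i < card {k\<in>K. y \<le> f k}})"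
  using level_bound B_nonneg by (intro bdd_aboveI[of _ "B / (real i + 1)"]) auto

lemma ranked_nonneg: "0 \<le> ranked K f i"
  unfolding ranked_def by (intro cSup_upper bdd_above_levels) auto

lemma ranked_le: "ranked K f i \<le> B / (real i + 1)"
  unfolding ranked_def using level_bound B_nonneg by (intro cSup_least) auto

lemma le_ranked: "0 < y \<Longrightarrow> i < card {k\<in>K. y \<le> f k} \<Longrightarrow> y \<le> ranked K f i"
  unfolding ranked_def by (intro cSup_upper bdd_above_levels) auto

lemma less_ranked:
  assumes "y < ranked K f i" "0 \<le> y"
  obtains z where "y < z" "i < card {k\<in>K. z \<le> f k}"
proof -
  have "\<exists>z\<in>{0} \<union> {y. 0 < y \<and> i < card {k\<in>K. y \<le> f k}}. y < z"
    using assms(1) unfolding ranked_def by (subst less_cSup_iff[symmetric]) (use bdd_above_levels[of i] in auto)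
  then show ?thesis using assms that by auto
qed

lemma decseq_ranked: "decseq (ranked K f)"
  unfolding decseq_def ranked_def
  by (intro allI impI cSup_subset_mono bdd_above_levels) (auto intro: le_less_trans)

end

lemma finite_rankable: "finite K \<Longrightarrow> (\<And>k. k \<in> K \<Longrightarrow> 0 \<le> f k) \<Longrightarrow> rankable K f (sum f K)"
  by unfold_locales (auto intro: sum_mono2)

lemma ranked_finite:
  assumes "finite K" "\<And>k. k \<in> K \<Longrightarrow> 0 \<le> f k"
  obtains xs where "mset xs = image_mset f (mset_set K)"
    "\<And>i. ranked K f i = (if i < length xs then xs ! i else 0)"
proof
  define ys where "ys = sorted_list_of_multiset (image_mset f (mset_set K))"
  define xs where "xs = rev ys"
  show m: "mset xs = image_mset f (mset_set K)" by (simp add: xs_def ys_def)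
  have sorted: "sorted ys" by (simp add: ys_def)
  have desc: "xs ! j \<le> xs ! i" if "i \<le> j" "j < length xs" for i j
    using that sorted unfolding xs_def by (simp add: rev_nth sorted_nth_mono)
  have nn: "0 \<le> xs ! i" if "i < length xs" for i
  proof -
    have "xs ! i \<in># image_mset f (mset_set K)" using that m by (metis nth_mem_mset)
    then show ?thesis using assms by auto
  qed
  \<comment> \<open>In a decreasing list, more than i entries reach y exactly if the entry at
    position i does. This identifies the supremum in \<open>ranked\<close> with a list
    entry.\<close>
  have card: "i < card {k\<in>K. y \<le> f k} \<longleftrightarrow> i < length xs \<and> y \<le> xs ! i" for i y
  proof -
    have "card {k\<in>K. y \<le> f k} = size (filter_mset (\<lambda>k. y \<le> f k) (mset_set K))"
      using assms(1) by simp
    also have "\<dots> = size (filter_mset (\<lambda>z. y \<le> z) (image_mset f (mset_set K)))"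
      by (simp add: filter_mset_image_mset comp_def)
    also have "\<dots> = length (filter (\<lambda>z. y \<le> z) xs)"
      unfolding m[symmetric] by (metis mset_filter size_mset)
    also have "\<dots> = card {j. j < length xs \<and> y \<le> xs ! j}" by (rule length_filter_conv_card)
    finally have c: "card {k\<in>K. y \<le> f k} = card {j. j < length xs \<and> y \<le> xs ! j}" .
    show ?thesis
    proof
      assume i: "i < card {k\<in>K. y \<le> f k}"
      show "i < length xs \<and> y \<le> xs ! i"
      proof (rule ccontr)
        assume neg: "\<not> (i < length xs \<and> y \<le> xs ! i)"
        have "{j. j < length xs \<and> y \<le> xs ! j} \<subseteq> {..<i}"
        proof
          fix j assume j: "j \<in> {j. j < length xs \<and> y \<le> xs ! j}"
          show "j \<in> {..<i}"
          proof (rule ccontr)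
            assume "j \<notin> {..<i}"
            then have "i \<le> j" by simp
            then show False using j neg desc[of i j] by auto
          qed
        qed
        then have "card {j. j < length xs \<and> y \<le> xs ! j} \<le> i"
          using card_mono[of "{..<i}"] by fastforce
        then show False using i c by simp
      qed
    next
      assume "i < length xs \<and> y \<le> xs ! i"
      then have "{..i} \<subseteq> {j. j < length xs \<and> y \<le> xs ! j}" using desc by fastforce
      then have "card {..i} \<le> card {j. j < length xs \<and> y \<le> xs ! j}" by (intro card_mono) auto
      then show "i < card {k\<in>K. y \<le> f k}" using c by simp
    qed
  qed
  show "ranked K f i = (if i < length xs then xs ! i else 0)" for i
  proof (cases "i < length xs")
    case True
    have "Sup ({0} \<union> {y. 0 < y \<and> y \<le> xs ! i}) = xs ! i"
      using nn[OF True] by (intro cSup_eq_maximum) (auto simp: order_le_less)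
    then show ?thesis using True by (simp add: ranked_def card)
  next
    case False
    then show ?thesis by (simp add: ranked_def card)
  qed
qed

lemma sums_ranked_finite:
  fixes g :: "real \<Rightarrow> real"
  assumes "finite K" "\<And>k. k \<in> K \<Longrightarrow> 0 \<le> f k" "g 0 = 0"
  shows "(\<lambda>i. g (ranked K f i)) sums (\<Sum>k\<in>K. g (f k))"
proof -
  obtain xs where xs: "mset xs = image_mset f (mset_set K)"
    "\<And>i. ranked K f i = (if i < length xs then xs ! i else 0)"
    using ranked_finite[of K f] assms(1,2) by blast
  have "(\<Sum>k\<in>K. g (f k)) = (\<Sum>z\<in>#image_mset f (mset_set K). g z)"
    by (simp add: sum_unfold_sum_mset multiset.map_comp comp_def)
  also have "\<dots> = sum_list (map g xs)" unfolding xs(1)[symmetric] by (metis mset_map sum_mset_sum_list)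
  also have "\<dots> = (\<Sum>i<length xs. g (xs ! i))" by (simp add: sum_list_sum_nth atLeast0LessThan)
  also have "\<dots> = (\<Sum>i<length xs. g (ranked K f i))" by (intro sum.cong) (auto simp: xs(2))
  finally show ?thesis using assms(3) sums_finite[of "{..<length xs}" "\<lambda>i. g (ranked K f i)"]
    by (simp add: xs(2))
qed

section \<open>Dyadic increments of a path\<close>

definition dyadic_inc :: "(real \<Rightarrow> real) \<Rightarrow> nat \<Rightarrow> nat \<Rightarrow> real" where
  "dyadic_inc x m k = x (real (Suc k) / 2 ^ m) - x (real k / 2 ^ m)"

locale jump_path =
  fixes x :: "real \<Rightarrow> real"
  assumes mono: "mono_on {0..} x" and right_cont: "\<And>t. 0 \<le> t \<Longrightarrow> continuous (at_right t) x"
    and zero: "x 0 = 0"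
begin

lemma x_mono: "0 \<le> s \<Longrightarrow> s \<le> t \<Longrightarrow> x s \<le> x t"
  using mono by (auto simp: mono_on_def)

text \<open>The definition of \<open>jump\<close> uses \<open>Lim\<close>, which says something only
  when a limit exists. Monotonicity supplies it as the supremum over earlier times.\<close>

lemma left_limit:
  assumes "0 < t"
  shows "(x \<longlongrightarrow> x t - jump x t) (at_left t)"
proof -
  define L where "L = Sup (x ` {0..<t})"
  have bdd: "bdd_above (x ` {0..<t})" using x_mono by (intro bdd_aboveI[of _ "x t"]) auto
  have ne: "x ` {0..<t} \<noteq> {}" using assms by auto
  have "(x \<longlongrightarrow> L) (at_left t)"
  proof (rule order_tendstoI)
    fix l assume "l < L"
    then obtain s where s: "0 \<le> s" "s < t" "l < x s"
      unfolding L_def less_cSup_iff[OF ne bdd] by auto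
    then have "l < x r" if "s < r" "r < t" for r using x_mono[of s r] that by linarith
    then show "\<forall>\<^sub>F r in at_left t. l < x r" using s(2) by (auto simp: eventually_at_left_field)
  next
    fix u assume "L < u"
    have "x r < u" if "0 < r" "r < t" for r
    proof -
      have "x r \<le> L" unfolding L_def using that by (intro cSup_upper bdd) auto
      then show ?thesis using \<open>L < u\<close> by simp
    qed
    then show "\<forall>\<^sub>F r in at_left t. x r < u" using assms by (auto simp: eventually_at_left_field)
  qed
  moreover from this have "Lim (at_left t) x = L" by (intro tendsto_Lim) auto
  ultimately show ?thesis by (simp add: jump_def)
qed

lemma jump_le: "0 \<le> s \<Longrightarrow> s < t \<Longrightarrow> jump x t \<le> x t - x s"
proof -
  assume s: "0 \<le> s" "s < t"
  then have "\<forall>\<^sub>F r in at_left t. x s \<le> x r"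
    unfolding eventually_at_left_field using x_mono[of s] by (intro exI[of _ s]) auto
  with left_limit[of t] s have "x s \<le> x t - jump x t"
    by (intro tendsto_lowerbound) auto
  then show ?thesis by simp
qed

lemma jump_nonneg: "0 < t \<Longrightarrow> 0 \<le> jump x t"
proof -
  assume t: "0 < t"
  have "\<forall>\<^sub>F r in at_left t. x r \<le> x t"
    unfolding eventually_at_left_field using x_mono t by (intro exI[of _ 0]) auto
  then have "x t - jump x t \<le> x t" using left_limit[OF t] by (intro tendsto_upperbound) auto
  then show ?thesis by simp
qed

lemma inc_nonneg: "0 \<le> dyadic_inc x m k"
  unfolding dyadic_inc_def using x_mono[of "real k / 2 ^ m" "real (Suc k) / 2 ^ m"]
  by (simp add: divide_right_mono)

lemma sum_inc: "(\<Sum>k<2 ^ m. dyadic_inc x m k) = x 1"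
  unfolding dyadic_inc_def by (subst sum_lessThan_telescope) (simp add: zero)

lemma eventually_mesh: "0 < e \<Longrightarrow> \<forall>\<^sub>F m in sequentially. 1 / 2 ^ m < (e :: real)"
proof -
  assume e: "0 < e"
  have "(\<lambda>m. (1 / 2 :: real) ^ m) \<longlonglongrightarrow> 0" by (rule LIMSEQ_power_zero) simp
  then have "\<forall>\<^sub>F m in sequentially. (1 / 2 :: real) ^ m < e" using e by (rule order_tendstoD(2))
  then show ?thesis by (simp add: power_divide)
qed

text \<open>A fine mesh separates finitely many times, and the increment over a cell that is open on
  the left and closed on the right includes the whole jump at any of its times.\<close>

lemma jumps_in_cells:
  assumes "finite F" "F \<subseteq> {0<..1}"
  shows "\<forall>\<^sub>F m in sequentially. \<exists>c. inj_on c F \<and> c ` F \<subseteq> {..<2 ^ m} \<and> (\<forall>t\<in>F. jump x t \<le> dyadic_inc x m (c t))"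
proof -
  have "\<forall>\<^sub>F m in sequentially. \<forall>t\<in>F. \<forall>t'\<in>F - {t}. 1 / 2 ^ m < \<bar>t - t'\<bar>"
    using assms by (intro eventually_ball_finite ballI eventually_mesh) auto
  then show ?thesis
  proof eventually_elim
    case (elim m)
    \<comment> \<open>The index k of the cell with k / 2^m < t and t at most (k + 1) / 2^m; a time
      on the grid belongs to the cell on its left.\<close>
    define c where "c t = nat (\<lceil>t * 2 ^ m\<rceil> - 1)" for t :: real
    have c: "real (c t) < t * 2 ^ m" "t * 2 ^ m \<le> real (c t) + 1" "c t < 2 ^ m" if "t \<in> F" for t
    proof -
      have t: "0 < t * 2 ^ m" "t * 2 ^ m \<le> 2 ^ m" using that assms by auto
      then have "1 \<le> \<lceil>t * 2 ^ m\<rceil>" by (simp add: one_le_ceiling)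
      then have eq: "real (c t) = of_int \<lceil>t * 2 ^ m\<rceil> - 1" by (simp add: c_def)
      show c1: "real (c t) < t * 2 ^ m" "t * 2 ^ m \<le> real (c t) + 1" unfolding eq by linarith+
      then have "real (c t) < 2 ^ m" using t by linarith
      then show "c t < 2 ^ m" by (metis of_nat_less_iff of_nat_numeral of_nat_power)
    qed
    have "inj_on c F"
    proof (rule inj_onI, rule ccontr)
      fix t t' assume t: "t \<in> F" "t' \<in> F" "c t = c t'" "t \<noteq> t'"
      have "\<bar>t * 2 ^ m - t' * 2 ^ m\<bar> < 1" using c[OF t(1)] c[OF t(2)] t(3) by linarith
      then have "\<bar>t - t'\<bar> * 2 ^ m < 1" by (simp add: abs_mult flip: left_diff_distrib)
      then have "\<bar>t - t'\<bar> < 1 / 2 ^ m" by (simp add: field_simps)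
      moreover have "1 / 2 ^ m < \<bar>t - t'\<bar>" using elim t by auto
      ultimately show False by linarith
    qed
    moreover have "jump x t \<le> dyadic_inc x m (c t)" if "t \<in> F" for t
    proof -
      have "jump x t \<le> x t - x (real (c t) / 2 ^ m)"
        using c[OF that] by (intro jump_le) (auto simp: field_simps)
      also have "\<dots> \<le> x (real (Suc (c t)) / 2 ^ m) - x (real (c t) / 2 ^ m)"
        using c[OF that] assms that by (intro diff_right_mono x_mono) (auto simp: field_simps)
      finally show ?thesis by (simp add: dyadic_inc_def)
    qed
    ultimately show ?case using c by (intro exI[of _ c]) auto
  qed
qed

sublocale jumps: rankable "{0<..1}" "jump x" "x 1"
proof
  fix F :: "real set" assume F: "finite F" "F \<subseteq> {0<..1}"
  obtain m c where c: "inj_on c F" "c ` F \<subseteq> {..<2 ^ m}" "\<forall>t\<in>F. jump x t \<le> dyadic_inc x m (c t)"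
    using eventually_happens'[OF _ jumps_in_cells[OF F]] by auto
  have "sum (jump x) F \<le> (\<Sum>t\<in>F. dyadic_inc x m (c t))" using c by (intro sum_mono) auto
  also have "\<dots> = (\<Sum>k\<in>c ` F. dyadic_inc x m k)" using c by (simp add: sum.reindex)
  also have "\<dots> \<le> (\<Sum>k<2 ^ m. dyadic_inc x m k)" using c inc_nonneg by (intro sum_mono2) auto
  finally show "sum (jump x) F \<le> x 1" by (simp add: sum_inc)
qed

sublocale incs: rankable "{..<2 ^ m}" "dyadic_inc x m" "x 1" for m
  using finite_rankable[of "{..<2 ^ m}" "dyadic_inc x m"] inc_nonneg by (simp add: sum_inc)

text \<open>On each side of t the path is nearly constant close to t. A short interval near t with
  increment y must therefore cross t, and nearly all of its increment is the jump at t.\<close>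

lemma large_increment_local:
  assumes "0 \<le> t" "0 < y"
  shows "\<exists>\<delta>>0. \<forall>a b. 0 \<le> a \<and> t - \<delta> < a \<and> a < b \<and> b < t + \<delta> \<and> y \<le> x b - x a \<longrightarrow> a < t \<and> t \<le> b \<and> y \<le> jump x t"
proof -
  \<comment> \<open>Two errors of size \<eta>, one on each side of t, must not lift a jump below y
    up to y; hence half of the gap. Any \<eta> up to y / 2 excludes intervals that stay on one
    side.\<close>
  define \<eta> where "\<eta> = (if 0 < t \<and> jump x t < y then (y - jump x t) / 2 else y / 2)"
  have \<eta>: "0 < \<eta>" "\<eta> \<le> y / 2" using assms jump_nonneg[of t] by (auto simp: \<eta>_def)
  have "(x \<longlongrightarrow> x t) (at_right t)" using right_cont[OF assms(1)] by (simp add: continuous_within)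
  then have "\<forall>\<^sub>F s in at_right t. x s < x t + \<eta>" using \<eta> by (intro order_tendstoD) auto
  then obtain b0 where b0: "t < b0" "\<And>s. t < s \<Longrightarrow> s < b0 \<Longrightarrow> x s < x t + \<eta>"
    by (auto simp: eventually_at_right_field)
  obtain a0 where a0: "a0 < t" "\<And>s. 0 < t \<Longrightarrow> a0 < s \<Longrightarrow> s < t \<Longrightarrow> x t - jump x t - \<eta> < x s"
  proof (cases "0 < t")
    case True
    have "\<forall>\<^sub>F s in at_left t. x t - jump x t - \<eta> < x s"
      using left_limit[OF True] \<eta> by (intro order_tendstoD) auto
    then show ?thesis using that by (auto simp: eventually_at_left_field)
  next
    \<comment> \<open>At t = 0 there is no left side. Intervals with 0 \<le> a then start to the
      right of t, and right continuity alone rules them out.\<close>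
    case False then show ?thesis using that[of "t - 1"] by auto
  qed
  have main: "a < t \<and> t \<le> b \<and> y \<le> jump x t"
    if "0 \<le> a" "a0 < a" "a < b" "b < b0" "y \<le> x b - x a" for a b
  proof -
    have xb: "x b < x t + \<eta>" if "t \<le> b" using b0(2)[of b] \<open>b < b0\<close> that \<eta> by (cases "b = t") auto
    have a: "a < t"
    proof (rule ccontr)
      assume "\<not> a < t"
      then have "x t \<le> x a" "x b < x t + \<eta>" using x_mono[of t a] assms xb that by auto
      then show False using that \<eta> assms by linarith
    qed
    then have xa: "x t - jump x t - \<eta> < x a" using a0(2)[of a] that by simp
    have b: "t \<le> b"
    proof (rule ccontr)
      assume "\<not> t \<le> b"
      then have "jump x t \<le> x t - x b" using that by (intro jump_le) auto
      then show False using xa that \<eta> assms by linarith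
    qed
    moreover have "y \<le> jump x t"
    proof (rule ccontr)
      assume "\<not> y \<le> jump x t"
      then have "\<eta> = (y - jump x t) / 2" using a that by (simp add: \<eta>_def)
      moreover have "x b - x a < jump x t + 2 * \<eta>" using xb[OF b] xa by linarith
      ultimately show False using that by simp
    qed
    ultimately show ?thesis using a by simp
  qed
  show ?thesis
  proof (intro exI[of _ "min (t - a0) (b0 - t)"] conjI)
    show "\<forall>a b. 0 \<le> a \<and> t - min (t - a0) (b0 - t) < a \<and> a < b \<and> b < t + min (t - a0) (b0 - t) \<and> y \<le> x b - x a \<longrightarrow> a < t \<and> t \<le> b \<and> y \<le> jump x t"
      by (intro allI impI main) auto
  qed (use a0(1) b0(1) in auto)
qed

text \<open>Counterpart of \<open>large_jumps\<close>. Compactness makes the local statement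
  uniform: once the mesh is small, every cell with increment at least y contains a jump of at least
  y.\<close>

lemma large_increments:
  assumes y: "0 < y"
  shows "\<forall>\<^sub>F m in sequentially. card {k\<in>{..<2 ^ m}. y \<le> dyadic_inc x m k} \<le> card {t\<in>{0<..1}. y \<le> jump x t}"
proof -
  define P where "P t \<delta> \<longleftrightarrow> 0 < \<delta> \<and> (\<forall>a b. 0 \<le> a \<and> t - \<delta> < a \<and> a < b \<and> b < t + \<delta> \<and> y \<le> x b - x a \<longrightarrow> a < t \<and> t \<le> b \<and> y \<le> jump x t)" for t \<delta>
  have "\<forall>t\<in>{0..1}. \<exists>\<delta>. P t \<delta>"
  proof
    fix t :: real assume "t \<in> {0..1}"
    then have "0 \<le> t" by simp
    from large_increment_local[OF this y] show "\<exists>\<delta>. P t \<delta>" unfolding P_def .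
  qed
  from bchoice[OF this] obtain \<delta> where P: "\<forall>t\<in>{0..1}. P t (\<delta> t)" ..
  have \<delta>: "0 < \<delta> t" if "t \<in> {0..1}" for t
    using bspec[OF P that] unfolding P_def by (rule conjunct1)
  have large: "a < t \<and> t \<le> b \<and> y \<le> jump x t"
    if "t \<in> {0..1}" "0 \<le> a" "t - \<delta> t < a" "a < b" "b < t + \<delta> t" "y \<le> x b - x a" for t a b
    using bspec[OF P that(1)] that(2-) unfolding P_def by blast
  have "{0..1} \<subseteq> \<Union>((\<lambda>t. ball t (\<delta> t)) ` {0..1})"
    using \<delta> by (intro subsetI UN_I) auto
  \<comment> \<open>A Lebesgue number of the cover: every cell shorter than e lies in one of the
    balls.\<close>
  then obtain e where e: "0 < e" "\<And>s. s \<in> {0..1} \<Longrightarrow> \<exists>G\<in>(\<lambda>t. ball t (\<delta> t)) ` {0..1}. ball s e \<subseteq> G"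
    by (rule Heine_Borel_lemma[OF compact_Icc]) auto
  show ?thesis using eventually_mesh[OF e(1)]
  proof eventually_elim
    case (elim m)
    define A where "A = {k\<in>{..<2 ^ m}. y \<le> dyadic_inc x m k}"
    have "\<exists>t\<in>{t\<in>{0<..1}. y \<le> jump x t}. real k / 2 ^ m < t \<and> t \<le> real (Suc k) / 2 ^ m" if "k \<in> A" for k
    proof -
      let ?a = "real k / 2 ^ m" and ?b = "real (Suc k) / 2 ^ m"
      have k: "k < 2 ^ m" "y \<le> x ?b - x ?a" using that by (auto simp: A_def dyadic_inc_def)
      have "real k \<le> 2 ^ m" using k by (metis less_imp_le of_nat_le_iff of_nat_numeral of_nat_power)
      then have "?a \<in> {0..1}" by simp
      then obtain t where t: "t \<in> {0..1}" "ball ?a e \<subseteq> ball t (\<delta> t)" using e(2)[OF \<open>?a \<in> {0..1}\<close>] by (elim bexE imageE) simp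
      have b: "?b = ?a + 1 / 2 ^ m" by (simp add: add_divide_distrib)
      have "?a \<in> ball ?a e" "?b \<in> ball ?a e" using elim e(1) unfolding b by (simp_all add: dist_real_def)
      then have "?a \<in> ball t (\<delta> t)" "?b \<in> ball t (\<delta> t)" using t by blast+
      then have "t - \<delta> t < ?a" "?b < t + \<delta> t" by (auto simp: dist_real_def)
      then have "?a < t \<and> t \<le> ?b \<and> y \<le> jump x t"
        using large[OF t(1), of ?a ?b] k by (simp add: divide_strict_right_mono)
      moreover have "0 \<le> ?a" by simp
      ultimately have "0 < t" "?a < t \<and> t \<le> ?b \<and> y \<le> jump x t" by linarith+
      then show ?thesis using t(1) by (intro bexI[of _ t]) auto
    qed
    then have "\<forall>k\<in>A. \<exists>t. t \<in> {t\<in>{0<..1}. y \<le> jump x t} \<and> real k / 2 ^ m < t \<and> t \<le> real (Suc k) / 2 ^ m"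
      by blast
    from bchoice[OF this] obtain h where "\<forall>k\<in>A. h k \<in> {t\<in>{0<..1}. y \<le> jump x t} \<and> real k / 2 ^ m < h k \<and> h k \<le> real (Suc k) / 2 ^ m" ..
    then have h: "h k \<in> {t\<in>{0<..1}. y \<le> jump x t}" "real k / 2 ^ m < h k \<and> h k \<le> real (Suc k) / 2 ^ m" if "k \<in> A" for k
      using that by blast+
    \<comment> \<open>The cells are half-open, hence disjoint, so different cells pick different
      jump times.\<close>
    have "inj_on h A"
    proof (rule inj_onI)
      fix k k' assume "k \<in> A" "k' \<in> A" "h k = h k'"
      then have "real k / 2 ^ m < real (Suc k') / 2 ^ m" "real k' / 2 ^ m < real (Suc k) / 2 ^ m"
        using h(2)[OF \<open>k \<in> A\<close>] h(2)[OF \<open>k' \<in> A\<close>] by linarith+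
      then have "real k < real (Suc k')" "real k' < real (Suc k)" by (simp_all add: divide_less_cancel)
      then show "k = k'" by linarith
    qed
    then have "card A \<le> card {t\<in>{0<..1}. y \<le> jump x t}"
      using h jumps.finite_level[OF y] by (intro card_inj_on_le[of h]) auto
    then show ?case by (simp add: A_def)
  qed
qed

lemma large_jumps:
  assumes "0 < y"
  shows "\<forall>\<^sub>F m in sequentially. card {t\<in>{0<..1}. y \<le> jump x t} \<le> card {k\<in>{..<2 ^ m}. y \<le> dyadic_inc x m k}"
proof -
  let ?F = "{t\<in>{0<..1}. y \<le> jump x t}"
  have "finite ?F" "?F \<subseteq> {0<..1}" using jumps.finite_level[OF assms] by auto
  from jumps_in_cells[OF this] show ?thesis
  proof eventually_elim
    case (elim m)
    then obtain c where c: "inj_on c ?F" "c ` ?F \<subseteq> {..<2 ^ m}" "\<forall>t\<in>?F. jump x t \<le> dyadic_inc x m (c t)" by blast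
    then show ?case by (intro card_inj_on_le[of c]) force+
  qed
qed

text \<open>For each fixed y > 0 the numbers of increments and of jumps of size at least y
  eventually agree, by \<open>large_jumps\<close> and \<open>large_increments\<close>, and ranks are
  determined by such counts.\<close>

lemma ranked_incs_tendsto:
  "(\<lambda>m. ranked {..<2 ^ m} (dyadic_inc x m) i) \<longlonglongrightarrow> ranked_jumps x i"
  unfolding ranked_jumps_eq
proof (rule order_tendstoI)
  fix l assume l: "l < ranked {0<..1} (jump x) i"
  show "\<forall>\<^sub>F m in sequentially. l < ranked {..<2 ^ m} (dyadic_inc x m) i"
  proof (cases "l < 0")
    case True
    then show ?thesis using incs.ranked_nonneg by (auto intro!: always_eventually elim: less_le_trans)
  next
    case False
    then obtain z where z: "l < z" "i < card {t\<in>{0<..1}. z \<le> jump x t}"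
      using jumps.less_ranked[OF l] by auto
    then have "0 < z" using False by simp
    from large_jumps[OF this] show ?thesis
    proof eventually_elim
      case (elim m)
      then show ?case using incs.le_ranked[OF \<open>0 < z\<close>, of i m] z by simp
    qed
  qed
next
  fix u assume u: "ranked {0<..1} (jump x) i < u"
  define z where "z = (ranked {0<..1} (jump x) i + u) / 2"
  have z: "0 < z" "ranked {0<..1} (jump x) i < z" "z < u"
    using u jumps.ranked_nonneg[of i] by (auto simp: z_def)
  then have i: "card {t\<in>{0<..1}. z \<le> jump x t} \<le> i" using jumps.le_ranked[of z i] by fastforce
  from large_increments[OF z(1)] show "\<forall>\<^sub>F m in sequentially. ranked {..<2 ^ m} (dyadic_inc x m) i < u"
  proof eventually_elim
    case (elim m)
    have "\<not> z < ranked {..<2 ^ m} (dyadic_inc x m) i"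
    proof
      assume "z < ranked {..<2 ^ m} (dyadic_inc x m) i"
      then obtain z' where z': "z < z'" "i < card {k\<in>{..<2 ^ m}. z' \<le> dyadic_inc x m k}"
        using incs.less_ranked z by (metis less_imp_le)
      moreover have "card {k\<in>{..<2 ^ m}. z' \<le> dyadic_inc x m k} \<le> card {k\<in>{..<2 ^ m}. z \<le> dyadic_inc x m k}"
        using z' by (intro card_mono) auto
      ultimately show False using elim i by simp
    qed
    then show ?case using z by linarith
  qed
qed

lemma sum_ranked_incs: "g 0 = 0 \<Longrightarrow> (\<lambda>i. g (ranked {..<2 ^ m} (dyadic_inc x m) i)) sums (\<Sum>k<2 ^ m. g (dyadic_inc x m k))"
  for g :: "real \<Rightarrow> real"
  using inc_nonneg by (intro sums_ranked_finite) auto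

lemma ranked_jumps_nonneg: "0 \<le> ranked_jumps x i"
  unfolding ranked_jumps_eq by (rule jumps.ranked_nonneg)

lemma decseq_ranked_jumps: "decseq (ranked_jumps x)"
  unfolding ranked_jumps_eq by (rule jumps.decseq_ranked)

lemma ranked_jumps_partial_sum: "(\<Sum>i<n. ranked_jumps x i) \<le> x 1"
proof (rule LIMSEQ_le_const2)
  show "(\<lambda>m. \<Sum>i<n. ranked {..<2 ^ m} (dyadic_inc x m) i) \<longlonglongrightarrow> (\<Sum>i<n. ranked_jumps x i)"
    by (intro tendsto_sum ranked_incs_tendsto)
  have "(\<Sum>i<n. ranked {..<2 ^ m} (dyadic_inc x m) i) \<le> x 1" for m
    using sum_ranked_incs[of "\<lambda>z. z" m] incs.ranked_nonneg
    by (intro sum_le_suminf[THEN order_trans, OF _ _ _ eq_refl]) (auto simp: sum_inc sums_iff)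
  then show "\<exists>N. \<forall>m\<ge>N. (\<Sum>i<n. ranked {..<2 ^ m} (dyadic_inc x m) i) \<le> x 1" by blast
qed

lemma summable_ranked_jumps: "summable (ranked_jumps x)"
  using ranked_jumps_nonneg ranked_jumps_partial_sum
  by (intro bounded_imp_summable[of _ "x 1"]) (auto simp: lessThan_Suc_atMost[symmetric] simp del: sum.lessThan_Suc)

text \<open>Only an inequality, since a path may also grow continuously. Equality for stable
  subordinators is the almost sure statement \<open>pure_jump\<close>.\<close>

lemma suminf_ranked_jumps: "(\<Sum>i. ranked_jumps x i) \<le> x 1"
  using ranked_jumps_partial_sum summable_ranked_jumps by (intro suminf_le_const)

text \<open>The ranks are at most x 1 / (i + 1) for every mesh, so a quadratic bound on g gives a
  summable majorant and Tannery's theorem applies. A linear bound would give only the harmonic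
  series.\<close>

lemma sum_incs_tendsto:
  fixes g :: "real \<Rightarrow> real"
  assumes g: "continuous_on {0..} g" "\<And>z. 0 \<le> z \<Longrightarrow> \<bar>g z\<bar> \<le> C z * z\<^sup>2" "\<And>y z. 0 \<le> y \<Longrightarrow> y \<le> z \<Longrightarrow> C y \<le> C z"
  shows "(\<lambda>m. \<Sum>k<2 ^ m. g (dyadic_inc x m k)) \<longlonglongrightarrow> (\<Sum>i. g (ranked_jumps x i))"
proof -
  have g0: "g 0 = 0" using g(2)[of 0] by simp
  have "\<bar>g z\<bar> \<le> C (x 1) * (x 1)\<^sup>2 * inverse ((real (Suc i))\<^sup>2)" if z: "0 \<le> z" "z \<le> x 1 / (real i + 1)" for z i
  proof -
    have zx: "z \<le> x 1" using z jumps.B_nonneg by (smt (verit) divide_le_eq_1 frac_le of_nat_0_le_iff div_by_1)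
    have C0: "0 \<le> C z" if "z \<noteq> 0"
    proof -
      have "0 \<le> C z * z\<^sup>2" using g(2)[OF z(1)] by linarith
      then show ?thesis using that by (simp add: zero_le_mult_iff)
    qed
    show ?thesis
    proof (cases "z = 0")
      case True
      have "0 \<le> C (x 1) * (x 1)\<^sup>2" using g(2)[OF jumps.B_nonneg] by linarith
      then show ?thesis using True g0 by simp
    next
      case False
      have "\<bar>g z\<bar> \<le> C z * z\<^sup>2" using g(2) z by blast
      also have "\<dots> \<le> C (x 1) * (x 1 / (real i + 1))\<^sup>2"
        using z zx C0[OF False] g(3)[of z "x 1"] by (intro mult_mono power_mono) auto
      also have "\<dots> = C (x 1) * (x 1)\<^sup>2 * inverse ((real (Suc i))\<^sup>2)"
        by (simp add: power_divide divide_inverse add.commute power_mult_distrib power_inverse)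
      finally show ?thesis .
    qed
  qed
  note bound = this
  have "(\<lambda>m. \<Sum>i. g (ranked {..<2 ^ m} (dyadic_inc x m) i)) \<longlonglongrightarrow> (\<Sum>i. g (ranked_jumps x i))"
  proof (rule tannerys_theorem[where M = "\<lambda>i. C (x 1) * (x 1)\<^sup>2 * inverse ((real (Suc i))\<^sup>2)", THEN conjunct2, THEN conjunct2])
    show "(\<lambda>m. g (ranked {..<2 ^ m} (dyadic_inc x m) i)) \<longlonglongrightarrow> g (ranked_jumps x i)" for i
      using g(1) ranked_incs_tendsto
      by (rule continuous_on_tendsto_compose) (auto simp: incs.ranked_nonneg ranked_jumps_nonneg)
    show "\<forall>\<^sub>F (i, m) in at_top \<times>\<^sub>F sequentially.
       norm (g (ranked {..<2 ^ m} (dyadic_inc x m) i)) \<le> C (x 1) * (x 1)\<^sup>2 * inverse ((real (Suc i))\<^sup>2)"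
      using bound incs.ranked_nonneg incs.ranked_le by (intro always_eventually) auto
    have "summable (\<lambda>i. inverse (real (Suc i) ^ 2))" by (intro inverse_power_summable[THEN summable_Suc_iff[THEN iffD2]]) auto
    then show "summable (\<lambda>i. C (x 1) * (x 1)\<^sup>2 * inverse ((real (Suc i))\<^sup>2))" by (rule summable_mult)
  qed auto
  moreover have "(\<Sum>i. g (ranked {..<2 ^ m} (dyadic_inc x m) i)) = (\<Sum>k<2 ^ m. g (dyadic_inc x m k))" for m
    using sum_ranked_incs[of g m] g0 by (simp add: sums_iff)
  ultimately show ?thesis by simp
qed

end

section \<open>Damped moments\<close>

lemma power_le_fact_exp: "0 \<le> z \<Longrightarrow> z ^ n \<le> fact n * exp (z :: real)"
proof -
  assume z: "0 \<le> z"
  have "z ^ n / fact n \<le> exp z"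
  proof -
    have "(\<Sum>k\<in>{n}. z ^ k /\<^sub>R fact k) \<le> (\<Sum>k. z ^ k /\<^sub>R fact k)"
      using z by (intro sum_le_suminf summable_exp_generic) auto
    then show ?thesis by (simp add: exp_def divide_inverse mult.commute)
  qed
  then show ?thesis by (simp add: field_simps)
qed

lemma power_exp_bound:
  fixes z c :: real
  assumes "0 \<le> z" "0 < c"
  shows "z ^ n * exp (- (c * z)) \<le> fact n / c ^ n"
proof -
  have "(c * z) ^ n \<le> fact n * exp (c * z)" using assms by (intro power_le_fact_exp) simp
  then show ?thesis using assms by (simp add: power_mult_distrib exp_minus field_simps)
qed

lemma (in finite_measure) integrable_laplace_moment:
  fixes Z :: "'a \<Rightarrow> real"
  assumes [measurable]: "Z \<in> borel_measurable M" and Z: "\<And>\<omega>. \<omega> \<in> space M \<Longrightarrow> 0 \<le> Z \<omega>" and c: "0 < c"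
  shows "integrable M (\<lambda>\<omega>. Z \<omega> ^ n * exp (- (c * Z \<omega>)))"
  using power_exp_bound[OF _ c] Z
  by (intro integrable_const_bound[of _ "fact n / c ^ n"] AE_I2) (auto simp: Z)

lemma (in finite_measure) deriv_laplace_moment:
  fixes Z :: "'a \<Rightarrow> real"
  assumes [measurable]: "Z \<in> borel_measurable M" and Z: "\<And>\<omega>. \<omega> \<in> space M \<Longrightarrow> 0 \<le> Z \<omega>" and u: "0 < u"
  shows "((\<lambda>u. \<integral>\<omega>. Z \<omega> ^ n * exp (- (u * Z \<omega>)) \<partial>M) has_real_derivative
    - (\<integral>\<omega>. Z \<omega> ^ Suc n * exp (- (u * Z \<omega>)) \<partial>M)) (at u)"
proof -
  \<comment> \<open>Keeping v above u / 2 leaves a factor exp (- c z) in the difference quotients,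
    which bounds them uniformly in z.\<close>
  define c where "c = u / 2"
  have c: "0 < c" "c < u" using u by (auto simp: c_def)
  let ?F = "\<lambda>u. \<integral>\<omega>. Z \<omega> ^ n * exp (- (u * Z \<omega>)) \<partial>M"
  define q where "q v z = z ^ n * ((exp (- (v * z)) - exp (- (u * z))) / (v - u))" for v z :: real
  have q_meas[measurable]: "(\<lambda>\<omega>. q v (Z \<omega>)) \<in> borel_measurable M" for v unfolding q_def by measurable
  have q_bound: "\<bar>q v z\<bar> \<le> fact (Suc n) / c ^ Suc n" if "c < v" "v \<noteq> u" "0 \<le> z" for v z
  proof -
    have "\<bar>exp (- (v * z)) - exp (- (u * z))\<bar> \<le> \<bar>v - u\<bar> * (z * exp (- (c * z)))" if "c < v" "c < u" for u v
      using that
    proof (induction u v rule: linorder_wlog)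
      case (le u v)
      have "exp (- (u * z)) * (1 - exp (- ((v - u) * z))) \<le> exp (- (c * z)) * ((v - u) * z)"
      proof (intro mult_mono)
        show "exp (- (u * z)) \<le> exp (- (c * z))" using le \<open>0 \<le> z\<close> by (simp add: mult_right_mono)
        show "1 - exp (- ((v - u) * z)) \<le> (v - u) * z" using exp_ge_add_one_self[of "- ((v - u) * z)"] by simp
      qed (use le \<open>0 \<le> z\<close> in auto)
      moreover have "exp (- (u * z)) * exp (- ((v - u) * z)) = exp (- (v * z))"
        by (simp add: exp_add[symmetric] algebra_simps)
      moreover have "exp (- (v * z)) \<le> exp (- (u * z))" using le \<open>0 \<le> z\<close> by (simp add: mult_right_mono)
      ultimately show ?case using le by (simp add: algebra_simps)
    qed (simp add: abs_minus_commute)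
    from this[OF \<open>c < v\<close> c(2)] have "\<bar>exp (- (v * z)) - exp (- (u * z))\<bar> / \<bar>v - u\<bar> \<le> z * exp (- (c * z))"
      using that by (simp add: field_simps)
    then have "\<bar>q v z\<bar> \<le> z ^ n * (z * exp (- (c * z)))"
      unfolding q_def abs_mult abs_divide using \<open>0 \<le> z\<close> by (intro mult_mono) auto
    also have "\<dots> = z ^ Suc n * exp (- (c * z))" by simp
    also have "\<dots> \<le> fact (Suc n) / c ^ Suc n" using \<open>0 \<le> z\<close> c(1) by (rule power_exp_bound)
    finally show ?thesis .
  qed
  have "((\<lambda>v. (?F v - ?F u) / (v - u)) \<longlongrightarrow> - (\<integral>\<omega>. Z \<omega> ^ Suc n * exp (- (u * Z \<omega>)) \<partial>M)) (at u within {c<..})"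
    unfolding tendsto_at_iff_sequentially
  proof (intro allI impI)
    fix V assume V: "\<forall>i. V i \<in> {c<..} - {u}" "V \<longlonglongrightarrow> u"
    have eq: "(?F (V i) - ?F u) / (V i - u) = (\<integral>\<omega>. q (V i) (Z \<omega>) \<partial>M)" for i
    proof -
      have "c < V i" using V by auto
      then have "0 < V i" using c by linarith
      then have "?F (V i) - ?F u = (\<integral>\<omega>. Z \<omega> ^ n * exp (- (V i * Z \<omega>)) - Z \<omega> ^ n * exp (- (u * Z \<omega>)) \<partial>M)"
        using u by (intro Bochner_Integration.integral_diff[symmetric] integrable_laplace_moment Z) auto
      then have "(?F (V i) - ?F u) / (V i - u) = (\<integral>\<omega>. (Z \<omega> ^ n * exp (- (V i * Z \<omega>)) - Z \<omega> ^ n * exp (- (u * Z \<omega>))) / (V i - u) \<partial>M)"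
        by simp
      also have "\<dots> = (\<integral>\<omega>. q (V i) (Z \<omega>) \<partial>M)"
        by (intro Bochner_Integration.integral_cong refl) (simp add: q_def right_diff_distrib)
      finally show ?thesis .
    qed
    have "(\<lambda>i. \<integral>\<omega>. q (V i) (Z \<omega>) \<partial>M) \<longlonglongrightarrow> (\<integral>\<omega>. - (Z \<omega> ^ Suc n * exp (- (u * Z \<omega>))) \<partial>M)"
    proof (rule integral_dominated_convergence[where w = "\<lambda>_. fact (Suc n) / c ^ Suc n"])
      show "AE \<omega> in M. norm (q (V i) (Z \<omega>)) \<le> fact (Suc n) / c ^ Suc n" for i
        unfolding real_norm_def using q_bound V Z by (intro AE_I2) auto
      show "AE \<omega> in M. (\<lambda>i. q (V i) (Z \<omega>)) \<longlonglongrightarrow> - (Z \<omega> ^ Suc n * exp (- (u * Z \<omega>)))"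
      proof (rule AE_I2)
        fix \<omega>
        have "((\<lambda>v. exp (- (v * Z \<omega>))) has_real_derivative - Z \<omega> * exp (- (u * Z \<omega>))) (at u)"
          by (auto intro!: derivative_eq_intros)
        then have "((\<lambda>v. (exp (- (v * Z \<omega>)) - exp (- (u * Z \<omega>))) / (v - u)) \<longlongrightarrow> - Z \<omega> * exp (- (u * Z \<omega>))) (at u)"
          by (simp add: has_field_derivative_iff)
        then have "(\<lambda>i. (exp (- (V i * Z \<omega>)) - exp (- (u * Z \<omega>))) / (V i - u)) \<longlonglongrightarrow> - Z \<omega> * exp (- (u * Z \<omega>))"
          using V unfolding tendsto_at_iff_sequentially by (auto simp: comp_def)
        then have "(\<lambda>i. q (V i) (Z \<omega>)) \<longlonglongrightarrow> Z \<omega> ^ n * (- Z \<omega> * exp (- (u * Z \<omega>)))"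
          unfolding q_def by (intro tendsto_intros)
        then show "(\<lambda>i. q (V i) (Z \<omega>)) \<longlonglongrightarrow> - (Z \<omega> ^ Suc n * exp (- (u * Z \<omega>)))"
          by (simp add: mult_ac)
      qed
    qed auto
    then show "((\<lambda>v. (?F v - ?F u) / (v - u)) \<circ> V) \<longlonglongrightarrow> - (\<integral>\<omega>. Z \<omega> ^ Suc n * exp (- (u * Z \<omega>)) \<partial>M)"
      by (simp add: comp_def eq)
  qed
  then show ?thesis using c by (simp add: has_field_derivative_iff at_within_open[of u "{c<..}"])
qed

text \<open>The coefficients of the polynomial in \<open>h\<close> that turns up in the \<open>n\<close>-th derivative of
  \<open>exp (- h * u powr \<alpha>)\<close>.\<close>

fun stable_coeff :: "real \<Rightarrow> nat \<Rightarrow> nat \<Rightarrow> real" where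
  "stable_coeff \<alpha> 0 j = (if j = 0 then 1 else 0)"
| "stable_coeff \<alpha> (Suc n) j = (real n - real j * \<alpha>) * stable_coeff \<alpha> n j
     + (if j = 0 then 0 else \<alpha> * stable_coeff \<alpha> n (j - 1))"

lemma stable_coeff_gt: "n < j \<Longrightarrow> stable_coeff \<alpha> n j = 0"
  by (induction n arbitrary: j) auto

lemma stable_coeff_0: "stable_coeff \<alpha> (Suc n) 0 = 0"
  by (induction n) auto

text \<open>As h tends to 0 only the linear term in h survives division by h, so this is the
  coefficient that determines the limit.\<close>

lemma stable_coeff_1: "stable_coeff \<alpha> (Suc n) 1 = \<alpha> * rising \<alpha> (Suc n)"
proof (induction n)
  case (Suc n)
  then show ?case unfolding stable_coeff.simps(2)[of \<alpha> "Suc n"] using stable_coeff_0[of \<alpha> n] by (simp add: rising_Suc)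
qed simp

text \<open>The n-th derivative of exp (- h u^\<alpha>) in u with the sign (-1)^n absorbed, that is,
  the moment of order n damped by exp (- u Z) for a variable Z with this Laplace transform.\<close>

definition stable_moment :: "real \<Rightarrow> real \<Rightarrow> nat \<Rightarrow> real \<Rightarrow> real" where
  "stable_moment \<alpha> h n u = exp (- h * u powr \<alpha>) * (\<Sum>j\<le>n. stable_coeff \<alpha> n j * h ^ j * u powr (real j * \<alpha> - real n))"

lemma deriv_stable_moment:
  assumes u: "0 < u"
  shows "(stable_moment \<alpha> h n has_real_derivative - stable_moment \<alpha> h (Suc n) u) (at u)"
proof -
  let ?c = "stable_coeff \<alpha>"
  let ?E = "exp (- h * u powr \<alpha>)"
  let ?s = "\<Sum>j\<le>n. ?c n j * h ^ j * u powr (real j * \<alpha> - real n)"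
  let ?d = "\<Sum>j\<le>n. ?c n j * h ^ j * ((real j * \<alpha> - real n) * u powr (real j * \<alpha> - real n - 1))"
  have "(stable_moment \<alpha> h n has_real_derivative (?E * (- h * (\<alpha> * u powr (\<alpha> - 1)))) * ?s + ?E * ?d) (at u)"
  proof -
    note p = has_real_derivative_powr[OF u]
    have 1: "((\<lambda>u. exp (- h * u powr \<alpha>)) has_real_derivative ?E * (- h * (\<alpha> * u powr (\<alpha> - 1)))) (at u)"
      by (intro DERIV_chain2[OF DERIV_exp] DERIV_cmult p)
    have 2: "((\<lambda>u. \<Sum>j\<le>n. ?c n j * h ^ j * u powr (real j * \<alpha> - real n)) has_real_derivative ?d) (at u)"
      by (intro DERIV_sum DERIV_cmult p)
    show ?thesis using DERIV_mult[OF 1 2] unfolding stable_moment_def[abs_def] by (simp only: mult.commute)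
  qed
  moreover have "(?E * (- h * (\<alpha> * u powr (\<alpha> - 1)))) * ?s + ?E * ?d = - stable_moment \<alpha> h (Suc n) u"
  proof -
    have 1: "(\<alpha> * u powr (\<alpha> - 1)) * ?s * h = (\<Sum>j\<le>n. \<alpha> * ?c n j * h ^ Suc j * u powr (real (Suc j) * \<alpha> - real (Suc n)))"
      unfolding sum_distrib_left sum_distrib_right
    proof (intro sum.cong refl)
      fix j
      have "u powr (\<alpha> - 1) * u powr (real j * \<alpha> - real n) = u powr (real (Suc j) * \<alpha> - real (Suc n))"
        by (simp add: powr_add[symmetric] algebra_simps)
      then show "\<alpha> * u powr (\<alpha> - 1) * (?c n j * h ^ j * u powr (real j * \<alpha> - real n)) * h =
        \<alpha> * ?c n j * h ^ Suc j * u powr (real (Suc j) * \<alpha> - real (Suc n))"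
        by (simp add: mult_ac)
    qed
    have 2: "- ?d = (\<Sum>j\<le>n. (real n - real j * \<alpha>) * ?c n j * h ^ j * u powr (real j * \<alpha> - real (Suc n)))"
      unfolding sum_negf[symmetric] by (intro sum.cong) (auto simp: algebra_simps)
    have "(\<Sum>j\<le>Suc n. ?c (Suc n) j * h ^ j * u powr (real j * \<alpha> - real (Suc n))) =
       (\<Sum>j\<le>Suc n. (real n - real j * \<alpha>) * ?c n j * h ^ j * u powr (real j * \<alpha> - real (Suc n)))
       + (\<Sum>j\<le>Suc n. (if j = 0 then 0 else \<alpha> * ?c n (j - 1)) * h ^ j * u powr (real j * \<alpha> - real (Suc n)))"
      by (simp only: stable_coeff.simps distrib_right sum.distrib)
    also have "(\<Sum>j\<le>Suc n. (real n - real j * \<alpha>) * ?c n j * h ^ j * u powr (real j * \<alpha> - real (Suc n))) = - ?d"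
      unfolding 2 by (simp add: stable_coeff_gt)
    also have "(\<Sum>j\<le>Suc n. (if j = 0 then 0 else \<alpha> * ?c n (j - 1)) * h ^ j * u powr (real j * \<alpha> - real (Suc n))) =
       (\<alpha> * u powr (\<alpha> - 1)) * ?s * h"
      unfolding 1 by (subst sum.atMost_Suc_shift) simp
    finally have "stable_moment \<alpha> h (Suc n) u = ?E * (- ?d + (\<alpha> * u powr (\<alpha> - 1)) * ?s * h)"
      by (simp add: stable_moment_def)
    then show ?thesis by (simp add: algebra_simps)
  qed
  ultimately show ?thesis by simp
qed

text \<open>For 0 < \<alpha> < 1 and u > 0 the limit is the n-th moment, damped by exp (- u x), of
  the Levy measure \<alpha> x^(- \<alpha> - 1) dx / Gamma (1 - \<alpha>).\<close>

lemma stable_moment_tendsto: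
  assumes "1 \<le> n" and h: "h \<longlonglongrightarrow> 0" "\<And>m. h m \<noteq> 0"
  shows "(\<lambda>m. stable_moment \<alpha> (h m) n u / h m) \<longlonglongrightarrow> \<alpha> * rising \<alpha> n * u powr (\<alpha> - real n)"
proof -
  obtain n' where n: "n = Suc n'" using assms(1) by (cases n) auto
  let ?c = "stable_coeff \<alpha>"
  have eq: "stable_moment \<alpha> (h m) n u / h m = exp (- h m * u powr \<alpha>) *
      (\<Sum>j\<le>n'. ?c n (Suc j) * h m ^ j * u powr (real (Suc j) * \<alpha> - real n))" for m
  proof -
    have "(\<Sum>j\<le>n. ?c n j * h m ^ j * u powr (real j * \<alpha> - real n)) =
       (\<Sum>j\<le>n'. ?c n (Suc j) * h m ^ Suc j * u powr (real (Suc j) * \<alpha> - real n))"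
      using stable_coeff_0[of \<alpha> n'] unfolding n by (subst sum.atMost_Suc_shift) simp
    also have "\<dots> = h m * (\<Sum>j\<le>n'. ?c n (Suc j) * h m ^ j * u powr (real (Suc j) * \<alpha> - real n))"
      unfolding sum_distrib_left by (intro sum.cong) (auto simp: mult_ac)
    finally show ?thesis using h(2)[of m] by (simp add: stable_moment_def)
  qed
  have "(\<lambda>m. exp (- h m * u powr \<alpha>) * (\<Sum>j\<le>n'. ?c n (Suc j) * h m ^ j * u powr (real (Suc j) * \<alpha> - real n))) \<longlonglongrightarrow>
     exp (- 0 * u powr \<alpha>) * (\<Sum>j\<le>n'. ?c n (Suc j) * 0 ^ j * u powr (real (Suc j) * \<alpha> - real n))"
    by (intro tendsto_intros h)
  also have "(\<Sum>j\<le>n'. ?c n (Suc j) * 0 ^ j * u powr (real (Suc j) * \<alpha> - real n)) = (\<Sum>j\<le>n'. if j = 0 then ?c n 1 * u powr (\<alpha> - real n) else 0)"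
    by (intro sum.cong) (auto simp: power_0_left)
  also have "\<dots> = \<alpha> * rising \<alpha> n * u powr (\<alpha> - real n)"
    using stable_coeff_1[of \<alpha> n'] by (simp add: n del: stable_coeff.simps)
  finally show ?thesis unfolding eq by simp
qed

lemma stable_moment_0: "stable_moment \<alpha> h 0 u = exp (- h * u powr \<alpha>)" if "0 < u"
  using that by (simp add: stable_moment_def)

section \<open>Stable subordinators\<close>

locale stable_process =
  fixes \<alpha> :: real and M :: "'a measure" and \<sigma> :: "real \<Rightarrow> 'a \<Rightarrow> real"
  assumes stable: "stable_subordinator \<alpha> M \<sigma>" and alpha: "0 < \<alpha>" "\<alpha> < 1"

sublocale stable_process \<subseteq> prob_space M
  using stable by (simp add: stable_subordinator_def)

context stable_process
begin

lemma path: "\<omega> \<in> space M \<Longrightarrow> jump_path (\<lambda>t. \<sigma> t \<omega>)"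
  using stable unfolding stable_subordinator_def jump_path_def by auto

lemma measurable_sigma [measurable]: "0 \<le> t \<Longrightarrow> \<sigma> t \<in> borel_measurable M"
  using stable unfolding stable_subordinator_def by auto

lemma sigma_nonneg: "\<omega> \<in> space M \<Longrightarrow> 0 \<le> t \<Longrightarrow> 0 \<le> \<sigma> t \<omega>"
  using jump_path.x_mono[OF path, of \<omega> 0 t] jump_path.zero[OF path, of \<omega>] by simp

abbreviation mesh :: "nat \<Rightarrow> real" where "mesh m \<equiv> 1 / 2 ^ m"

definition incr :: "nat \<Rightarrow> nat \<Rightarrow> 'a \<Rightarrow> real" where
  "incr m k \<omega> = dyadic_inc (\<lambda>t. \<sigma> t \<omega>) m k"

lemma incr_eq: "incr m k = (\<lambda>\<omega>. \<sigma> (real (Suc k) / 2 ^ m) \<omega> - \<sigma> (real k / 2 ^ m) \<omega>)"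
  by (rule ext) (simp add: incr_def dyadic_inc_def)

lemma measurable_incr [measurable]: "incr m k \<in> borel_measurable M"
  unfolding incr_eq by measurable

lemma incr_nonneg: "\<omega> \<in> space M \<Longrightarrow> 0 \<le> incr m k \<omega>"
  unfolding incr_def by (rule jump_path.inc_nonneg[OF path])

lemma sum_incr: "\<omega> \<in> space M \<Longrightarrow> (\<Sum>k<2 ^ m. incr m k \<omega>) = \<sigma> 1 \<omega>"
  unfolding incr_def by (rule jump_path.sum_inc[OF path])

lemma distr_incr: "distr M borel (incr m k) = distr M borel (\<sigma> (mesh m))"
proof -
  have "distr M borel (\<lambda>\<omega>. \<sigma> t \<omega> - \<sigma> s \<omega>) = distr M borel (\<sigma> (t - s))" if "0 \<le> s" "s \<le> t" for s t
    using stable that unfolding stable_subordinator_def by blast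
  from this[of "real k / 2 ^ m" "real (Suc k) / 2 ^ m"] show ?thesis
    unfolding incr_eq by (simp add: divide_right_mono diff_divide_distrib[symmetric])
qed

lemma indep_incr: "indep_vars (\<lambda>_. borel) (incr m) {..<2 ^ m}"
proof -
  have "prob_space.indep_vars M (\<lambda>_. borel) (\<lambda>i \<omega>. \<sigma> (t (Suc i)) \<omega> - \<sigma> (t i) \<omega>) {..<n}"
    if "0 \<le> t 0" "incseq t" for t :: "nat \<Rightarrow> real" and n
    using stable that unfolding stable_subordinator_def by blast
  from this[of "\<lambda>i. real i / 2 ^ m" "2 ^ m"] show ?thesis
    unfolding incr_eq[abs_def] by (simp add: incseq_def divide_right_mono)
qed

lemma nn_integral_incr:
  assumes "h \<in> borel_measurable borel"
  shows "(\<integral>\<^sup>+\<omega>. h (incr m k \<omega>) \<partial>M) = (\<integral>\<^sup>+\<omega>. h (\<sigma> (mesh m) \<omega>) \<partial>M)"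
proof -
  note assms[measurable]
  have "(\<integral>\<^sup>+\<omega>. h (incr m k \<omega>) \<partial>M) = (\<integral>\<^sup>+z. h z \<partial>distr M borel (incr m k))"
    by (subst nn_integral_distr) auto
  also have "\<dots> = (\<integral>\<^sup>+\<omega>. h (\<sigma> (mesh m) \<omega>) \<partial>M)"
    unfolding distr_incr by (subst nn_integral_distr) auto
  finally show ?thesis .
qed

lemma nn_integral_prod_incr:
  fixes h :: "nat \<Rightarrow> real \<Rightarrow> ennreal"
  assumes "\<And>k. h k \<in> borel_measurable borel"
  shows "(\<integral>\<^sup>+\<omega>. (\<Prod>k<2 ^ m. h k (incr m k \<omega>)) \<partial>M) = (\<Prod>k<2 ^ m. \<integral>\<^sup>+\<omega>. h k (\<sigma> (mesh m) \<omega>) \<partial>M)"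
proof -
  have "(\<integral>\<^sup>+\<omega>. (\<Prod>k<2 ^ m. h k (incr m k \<omega>)) \<partial>M) = (\<Prod>k<2 ^ m. \<integral>\<^sup>+\<omega>. h k (incr m k \<omega>) \<partial>M)"
    by (intro indep_vars_nn_integral indep_vars_compose2[OF indep_incr] assms) auto
  then show ?thesis using nn_integral_incr[OF assms] by simp
qed

definition moment :: "nat \<Rightarrow> nat \<Rightarrow> real \<Rightarrow> real" where
  "moment m n u = (\<integral>\<omega>. \<sigma> (mesh m) \<omega> ^ n * exp (- (u * \<sigma> (mesh m) \<omega>)) \<partial>M)"

lemma nn_moment:
  assumes "0 < u"
  shows "(\<integral>\<^sup>+\<omega>. ennreal (\<sigma> (mesh m) \<omega> ^ n * exp (- (u * \<sigma> (mesh m) \<omega>))) \<partial>M) = ennreal (moment m n u)"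
  unfolding moment_def using sigma_nonneg assms
  by (intro nn_integral_eq_integral integrable_laplace_moment) (auto intro!: AE_I2)

lemma exp_sigma_eq:
  "\<omega> \<in> space M \<Longrightarrow> exp (- (u * \<sigma> 1 \<omega>)) = (\<Prod>k<2 ^ m. exp (- (u * incr m k \<omega>)))"
  by (simp add: sum_incr[of \<omega> m, symmetric] exp_sum[symmetric] sum_distrib_left sum_negf)

lemma moment_nonneg: "0 \<le> moment m n u"
  unfolding moment_def using sigma_nonneg by (intro integral_nonneg_AE AE_I2) auto

text \<open>The Laplace transform is prescribed at time 1 only. Since \<open>\<sigma> 1\<close> is a
  sum of 2^m independent increments with equal laws, the transform at time 2^(-m) is the nonnegative
  root of order 2^m.\<close>

lemma moment_0:
  assumes u: "0 < u"
  shows "moment m 0 u = exp (- mesh m * u powr \<alpha>)"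
proof -
  have "ennreal (exp (- (u powr \<alpha>))) = (\<integral>\<^sup>+\<omega>. ennreal (exp (- (u * \<sigma> 1 \<omega>))) \<partial>M)"
  proof -
    have "(\<integral>\<omega>. exp (- u * \<sigma> 1 \<omega>) \<partial>M) = exp (- (u powr \<alpha>))"
    proof -
      have "\<forall>u\<ge>0. (\<integral>\<omega>. exp (- u * \<sigma> 1 \<omega>) \<partial>M) = exp (- (u powr \<alpha>))"
        using stable unfolding stable_subordinator_def by (elim conjE)
      then show ?thesis using u by simp
    qed
    moreover have "integrable M (\<lambda>\<omega>. \<sigma> 1 \<omega> ^ 0 * exp (- (u * \<sigma> 1 \<omega>)))"
      using sigma_nonneg u by (intro integrable_laplace_moment) auto
    ultimately show ?thesis by (subst nn_integral_eq_integral) auto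
  qed
  also have "\<dots> = (\<integral>\<^sup>+\<omega>. (\<Prod>k<2 ^ m. ennreal (exp (- (u * incr m k \<omega>)))) \<partial>M)"
    by (intro nn_integral_cong) (simp add: exp_sigma_eq[of _ u m] prod_ennreal)
  also have "\<dots> = (\<Prod>k<(2::nat) ^ m. \<integral>\<^sup>+\<omega>. ennreal (exp (- (u * \<sigma> (mesh m) \<omega>))) \<partial>M)"
    by (rule nn_integral_prod_incr[of "\<lambda>k z. ennreal (exp (- (u * z)))"]) simp
  also have "\<dots> = ennreal (moment m 0 u ^ (2 ^ m))"
    using nn_moment[OF u, of m 0] moment_nonneg[of m 0 u] by (simp add: ennreal_power)
  finally have "moment m 0 u ^ (2 ^ m) = exp (- (u powr \<alpha>))"
    using ennreal_inj[of "exp (- (u powr \<alpha>))" "moment m 0 u ^ (2 ^ m)"] moment_nonneg[of m 0 u] by simp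
  also have "\<dots> = exp (real (2 ^ m) * (- mesh m * u powr \<alpha>))" by simp
  also have "\<dots> = exp (- mesh m * u powr \<alpha>) ^ (2 ^ m)" by (rule exp_of_nat_mult)
  finally have eq: "moment m 0 u ^ (2 ^ m) = exp (- mesh m * u powr \<alpha>) ^ (2 ^ m)" .
  show ?thesis by (rule power_eq_imp_eq_base[OF eq]) (simp_all add: moment_nonneg)
qed

text \<open>In both families the member n + 1 is minus the derivative of member n, and they agree at
  n = 0 on all positive u, so uniqueness of derivatives suffices.\<close>

lemma moment_eq: "0 < u \<Longrightarrow> moment m n u = stable_moment \<alpha> (mesh m) n u"
proof (induction n arbitrary: u)
  case 0
  then show ?case by (simp add: moment_0 stable_moment_0)
next
  case (Suc n)
  have "(moment m n has_real_derivative - moment m (Suc n) u) (at u)"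
    unfolding moment_def[abs_def] using sigma_nonneg Suc.prems by (intro deriv_laplace_moment) auto
  moreover have "(moment m n has_real_derivative - stable_moment \<alpha> (mesh m) (Suc n) u) (at u)"
    using deriv_stable_moment[OF Suc.prems]
  proof (rule DERIV_cong_ev[THEN iffD1, OF refl _ refl, rotated])
    have "\<forall>\<^sub>F v in nhds u. v \<in> {0<..}" using Suc.prems by (intro eventually_nhds_in_open) auto
    then show "\<forall>\<^sub>F v in nhds u. stable_moment \<alpha> (mesh m) n v = moment m n v"
      by eventually_elim (simp add: Suc.IH)
  qed
  ultimately have "- moment m (Suc n) u = - stable_moment \<alpha> (mesh m) (Suc n) u" by (rule DERIV_unique)
  then show ?case by simp
qed

lemma moment_tendsto:
  "0 < u \<Longrightarrow> 1 \<le> n \<Longrightarrow> (\<lambda>m. 2 ^ m * moment m n u) \<longlonglongrightarrow> \<alpha> * rising \<alpha> n * u powr (\<alpha> - real n)"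
  using stable_moment_tendsto[of n "\<lambda>m. mesh m" \<alpha> u] LIMSEQ_inverse_realpow_zero[of 2]
  by (simp add: moment_eq inverse_eq_divide mult.commute)

end

text \<open>Exceeding a is a condition on the level counts, and rational levels above a suffice
  because the counts are monotone in the level.\<close>

lemma borel_measurable_ranked:
  assumes "finite K" and [measurable]: "\<And>k. k \<in> K \<Longrightarrow> f k \<in> borel_measurable M"
    and nn: "\<And>\<omega> k. \<omega> \<in> space M \<Longrightarrow> k \<in> K \<Longrightarrow> 0 \<le> f k \<omega>"
  shows "(\<lambda>\<omega>. ranked K (\<lambda>k. f k \<omega>) i) \<in> borel_measurable M"
  unfolding borel_measurable_iff_greater
proof
  fix a :: real
  have rk: "rankable K (\<lambda>k. f k \<omega>) (\<Sum>k\<in>K. f k \<omega>)" if "\<omega> \<in> space M" for \<omega>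
    by (rule finite_rankable[OF assms(1)]) (rule nn[OF that])
  show "{\<omega> \<in> space M. a < ranked K (\<lambda>k. f k \<omega>) i} \<in> sets M"
  proof (cases "a < 0")
    case True
    have "a < ranked K (\<lambda>k. f k \<omega>) i" if "\<omega> \<in> space M" for \<omega>
      using rankable.ranked_nonneg[OF rk[OF that], of i] True by linarith
    then have "{\<omega> \<in> space M. a < ranked K (\<lambda>k. f k \<omega>) i} = space M" by blast
    then show ?thesis by simp
  next
    case False
    have levels: "a < ranked K (\<lambda>k. f k \<omega>) i \<longleftrightarrow> (\<exists>z::rat. a < of_rat z \<and> i < card {k\<in>K. of_rat z \<le> f k \<omega>})"
      if \<omega>: "\<omega> \<in> space M" for \<omega>
    proof
      assume *: "a < ranked K (\<lambda>k. f k \<omega>) i"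
      have "0 \<le> a" using False by simp
      obtain z where z: "a < z" "i < card {k\<in>K. z \<le> f k \<omega>}"
        by (rule rankable.less_ranked[OF rk[OF \<omega>] * \<open>0 \<le> a\<close>])
      obtain r where r: "a < of_rat r" "of_rat r < z" using of_rat_dense[OF z(1)] by blast
      have "card {k\<in>K. z \<le> f k \<omega>} \<le> card {k\<in>K. of_rat r \<le> f k \<omega>}"
        using assms(1) r by (intro card_mono) auto
      then show "\<exists>z::rat. a < of_rat z \<and> i < card {k\<in>K. of_rat z \<le> f k \<omega>}" using z r by (intro exI[of _ r]) auto
    next
      assume "\<exists>z::rat. a < of_rat z \<and> i < card {k\<in>K. of_rat z \<le> f k \<omega>}"
      then obtain z :: rat where "a < of_rat z" "i < card {k\<in>K. of_rat z \<le> f k \<omega>}" by blast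
      then show "a < ranked K (\<lambda>k. f k \<omega>) i"
        using rankable.le_ranked[OF rk[OF \<omega>], of "of_rat z" i] False by linarith
    qed
    have card: "real (card {k\<in>K. z \<le> f k \<omega>}) = (\<Sum>k\<in>K. if z \<le> f k \<omega> then 1 else 0)" for z \<omega>
      using assms(1) by (simp add: sum.If_cases Int_def)
    have count: "i < card {k\<in>K. z \<le> f k \<omega>} \<longleftrightarrow> real i < (\<Sum>k\<in>K. if z \<le> f k \<omega> then 1 else 0)" for z \<omega>
      by (simp only: card[symmetric] of_nat_less_iff)
    have "{\<omega> \<in> space M. a < ranked K (\<lambda>k. f k \<omega>) i} =
      {\<omega> \<in> space M. \<exists>z::rat. a < of_rat z \<and> real i < (\<Sum>k\<in>K. if of_rat z \<le> f k \<omega> then 1 else 0)}"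
      by (intro Collect_cong conj_cong refl) (simp only: levels count)
    also have "\<dots> \<in> sets M" by measurable
    finally show ?thesis .
  qed
qed

text \<open>Every jump falls into one of the two halves of the unit interval. If both halves have
  positive increments, the largest jump is therefore strictly below the total.\<close>

lemma (in jump_path) ranked_jumps_0_le: "ranked_jumps x 0 \<le> max (dyadic_inc x 1 0) (dyadic_inc x 1 1)"
proof -
  have "y \<le> max (x (1 / 2)) (x 1 - x (1 / 2))" if y: "0 < card {t\<in>{0<..1}. y \<le> jump x t}" for y
  proof -
    have "{t\<in>{0<..1}. y \<le> jump x t} \<noteq> {}" using y by (metis card.empty less_irrefl)
    then obtain t where t: "0 < t" "t \<le> 1" "y \<le> jump x t" by auto
    show ?thesis
    proof (cases "t \<le> 1 / 2")
      case True
      then show ?thesis using t jump_le[of 0 t] x_mono[of t "1 / 2"] by (simp add: zero)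
    next
      case False
      then show ?thesis using t jump_le[of "1 / 2" t] x_mono[of t 1] by simp
    qed
  qed
  moreover have "0 \<le> max (x (1 / 2)) (x 1 - x (1 / 2))" using x_mono[of "1 / 2" 1] by simp
  ultimately show ?thesis
    unfolding ranked_jumps_def by (intro cSup_least) (auto simp: dyadic_inc_def zero)
qed

section \<open>Moments of the increments and their limits\<close>

context stable_process
begin

definition rj :: "'a \<Rightarrow> nat \<Rightarrow> real" where
  "rj \<omega> = ranked_jumps (\<lambda>t. \<sigma> t \<omega>)"

text \<open>Increments padded with zeros to a sequence, so that \<open>dsum\<close> over all natural
  numbers applies.\<close>

definition ext :: "nat \<Rightarrow> 'a \<Rightarrow> nat \<Rightarrow> real" where
  "ext m \<omega> k = (if k < 2 ^ m then incr m k \<omega> else 0)"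

lemma measurable_rj [measurable]: "(\<lambda>\<omega>. rj \<omega> i) \<in> borel_measurable M"
proof (rule borel_measurable_LIMSEQ_real)
  show "(\<lambda>m. ranked {..<2 ^ m} (\<lambda>k. incr m k \<omega>) i) \<longlonglongrightarrow> rj \<omega> i" if "\<omega> \<in> space M" for \<omega>
    using jump_path.ranked_incs_tendsto[OF path[OF that], of i] by (simp add: incr_def[abs_def] rj_def)
  show "(\<lambda>\<omega>. ranked {..<2 ^ m} (\<lambda>k. incr m k \<omega>) i) \<in> borel_measurable M" for m
    by (rule borel_measurable_ranked) (auto simp: incr_nonneg)
qed

lemma rj_facts:
  assumes "\<omega> \<in> space M"
  shows "0 \<le> rj \<omega> i" "decseq (rj \<omega>)" "summable (rj \<omega>)" "(\<Sum>i. rj \<omega> i) \<le> \<sigma> 1 \<omega>"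
    "rj \<omega> 0 \<le> max (incr 1 0 \<omega>) (incr 1 1 \<omega>)"
  using jump_path.ranked_jumps_nonneg[OF path[OF assms]] jump_path.decseq_ranked_jumps[OF path[OF assms]]
    jump_path.summable_ranked_jumps[OF path[OF assms]] jump_path.suminf_ranked_jumps[OF path[OF assms]]
    jump_path.ranked_jumps_0_le[OF path[OF assms]]
  by (simp_all add: rj_def incr_def)

lemma ext_nonneg: "\<omega> \<in> space M \<Longrightarrow> 0 \<le> ext m \<omega> k"
  by (simp add: ext_def incr_nonneg)

lemma ext_power_sums: "1 \<le> n \<Longrightarrow> (\<lambda>k. ext m \<omega> k ^ n) sums (\<Sum>k<2 ^ m. incr m k \<omega> ^ n)"
proof -
  assume "1 \<le> n"
  then have "(\<lambda>k. ext m \<omega> k ^ n) sums (\<Sum>k\<in>{..<2 ^ m}. ext m \<omega> k ^ n)"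
    by (intro sums_finite) (auto simp: ext_def)
  then show ?thesis by (simp add: ext_def)
qed

lemma dsum_ext:
  assumes "\<omega> \<in> space M" "\<forall>m\<in>set ns. Suc 0 \<le> m"
  shows "dsum (ext m \<omega>) ns = ennreal (power_sum_poly (\<lambda>n. \<Sum>k<2 ^ m. incr m k \<omega> ^ n) ns)"
    "0 \<le> power_sum_poly (\<lambda>n. \<Sum>k<2 ^ m. incr m k \<omega> ^ n) ns"
  using dsum_eq_power_sum_poly[of "ext m \<omega>" "\<lambda>n. \<Sum>k<2 ^ m. incr m k \<omega> ^ n" ns]
    ext_nonneg[OF assms(1)] ext_power_sums assms(2) by (auto simp: sums_iff)

text \<open>All exponents are positive, so a tuple that uses a padded index contributes 0.\<close>

lemma dsum_ext_finite:
  assumes "\<forall>m\<in>set ns. Suc 0 \<le> m"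
  shows "dsum (ext m \<omega>) ns = (\<Sum>is\<in>{is. length is = length ns \<and> distinct is \<and> set is \<subseteq> {..<2 ^ m}}.
    \<Prod>j<length ns. ennreal (incr m (is ! j) \<omega> ^ (ns ! j)))" (is "_ = sum _ ?A")
proof -
  have "finite ?A"
    by (rule finite_subset[OF _ finite_lists_length_eq[of "{..<2 ^ m}" "length ns"]]) auto
  then have "dsum (ext m \<omega>) ns = (\<Sum>is\<in>?A. \<Prod>j<length ns. ennreal (ext m \<omega> (is ! j) ^ (ns ! j)))"
    unfolding dsum_eq_nn_integral
  proof (intro nn_integral_count_space')
    fix "is" assume *: "is \<in> {is. length is = length ns \<and> distinct is}" "is \<notin> ?A"
    then obtain j where j: "j < length ns" "\<not> is ! j < 2 ^ m"
      by (force simp: in_set_conv_nth)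
    have "ns ! j \<noteq> 0" using assms nth_mem[OF j(1)] by auto
    then have "ennreal (ext m \<omega> (is ! j) ^ (ns ! j)) = 0" using j by (simp add: ext_def)
    then show "(\<Prod>j<length ns. ennreal (ext m \<omega> (is ! j) ^ (ns ! j))) = 0"
      using j by (intro prod_zero) auto
  qed auto
  also have "\<dots> = (\<Sum>is\<in>?A. \<Prod>j<length ns. ennreal (incr m (is ! j) \<omega> ^ (ns ! j)))"
  proof (intro sum.cong prod.cong refl)
    fix "is" j assume "is \<in> ?A" "j \<in> {..<length ns}"
    then have "is ! j \<in> set is" "set is \<subseteq> {..<2 ^ m}" by auto
    then have "is ! j \<in> {..<2 ^ m}" by blast
    then show "ennreal (ext m \<omega> (is ! j) ^ (ns ! j)) = ennreal (incr m (is ! j) \<omega> ^ (ns ! j))"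
      by (simp add: ext_def)
  qed
  finally show ?thesis .
qed

lemma nn_integral_tuple:
  assumes u: "0 < u" and "is": "length is = length ns" "distinct is" "set is \<subseteq> {..<2 ^ m}"
  shows "(\<integral>\<^sup>+\<omega>. (\<Prod>j<length ns. ennreal (incr m (is ! j) \<omega> ^ (ns ! j))) * ennreal (exp (- (u * \<sigma> 1 \<omega>))) \<partial>M) =
    ennreal ((\<Prod>j<length ns. moment m (ns ! j) u) * moment m 0 u ^ (2 ^ m - length ns))"
proof -
  let ?N = "2 ^ m :: nat"
  \<comment> \<open>The exponent assigned to cell k: that of its position in the tuple, or 0 for
    cells outside. The integrand becomes a product over all cells, to which independence
    applies.\<close>
  define a where "a k = (\<Sum>j<length ns. if is ! j = k then ns ! j else 0)" for k
  have a_nth: "a (is ! i) = ns ! i" if i: "i < length ns" for i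
  proof -
    have "a (is ! i) = (\<Sum>j<length ns. if j = i then ns ! j else 0)"
      unfolding a_def using i "is" by (intro sum.cong) (auto simp: nth_eq_iff_index_eq)
    then show ?thesis using i by simp
  qed
  have a_out: "a k = 0" if "k \<notin> set is" for k
    unfolding a_def using that "is" by (intro sum.neutral) auto
  have pre: "(\<Prod>k<?N. f k (a k)) = (\<Prod>j<length ns. f (is ! j) (ns ! j)) * (\<Prod>k\<in>{..<?N} - set is. f k 0)"
    for f :: "nat \<Rightarrow> nat \<Rightarrow> 'b :: comm_semiring_1"
  proof -
    have "(\<Prod>k<?N. f k (a k)) = (\<Prod>k\<in>{..<?N} - set is. f k (a k)) * (\<Prod>k\<in>set is. f k (a k))"
      using "is" by (intro prod.subset_diff) auto
    also have "(\<Prod>k\<in>{..<?N} - set is. f k (a k)) = (\<Prod>k\<in>{..<?N} - set is. f k 0)"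
      by (intro prod.cong) (auto simp: a_out)
    also have "(\<Prod>k\<in>set is. f k (a k)) = (\<Prod>j<length ns. f (is ! j) (a (is ! j)))"
      using bij_betw_nth[OF "is"(2), of "{..<length ns}" "set is"] "is"(1) by (intro prod.reindex_bij_betw[symmetric]) auto
    also have "\<dots> = (\<Prod>j<length ns. f (is ! j) (ns ! j))" by (intro prod.cong) (auto simp: a_nth)
    finally show ?thesis by (simp add: mult.commute)
  qed
  have "(\<Prod>j<length ns. ennreal (incr m (is ! j) \<omega> ^ (ns ! j))) * ennreal (exp (- (u * \<sigma> 1 \<omega>))) =
     (\<Prod>k<?N. ennreal (incr m k \<omega> ^ a k * exp (- (u * incr m k \<omega>))))" if \<omega>: "\<omega> \<in> space M" for \<omega>
  proof -
    have "(\<Prod>k<?N. ennreal (incr m k \<omega> ^ a k * exp (- (u * incr m k \<omega>)))) =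
       (\<Prod>k<?N. ennreal (incr m k \<omega> ^ a k)) * (\<Prod>k<?N. ennreal (exp (- (u * incr m k \<omega>))))"
      unfolding prod.distrib[symmetric] using incr_nonneg[OF \<omega>] by (intro prod.cong refl) (simp add: ennreal_mult)
    also have "(\<Prod>k<?N. ennreal (exp (- (u * incr m k \<omega>)))) = ennreal (exp (- (u * \<sigma> 1 \<omega>)))"
      by (simp add: exp_sigma_eq[OF \<omega>, of u m] prod_ennreal)
    also have "(\<Prod>k<?N. ennreal (incr m k \<omega> ^ a k)) = (\<Prod>j<length ns. ennreal (incr m (is ! j) \<omega> ^ (ns ! j)))"
      by (subst pre[of "\<lambda>k n. ennreal (incr m k \<omega> ^ n)"]) simp
    finally show ?thesis by simp
  qed
  then have "(\<integral>\<^sup>+\<omega>. (\<Prod>j<length ns. ennreal (incr m (is ! j) \<omega> ^ (ns ! j))) * ennreal (exp (- (u * \<sigma> 1 \<omega>))) \<partial>M) =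
     (\<integral>\<^sup>+\<omega>. (\<Prod>k<?N. ennreal (incr m k \<omega> ^ a k * exp (- (u * incr m k \<omega>)))) \<partial>M)"
    by (rule nn_integral_cong)
  also have "\<dots> = (\<Prod>k<?N. \<integral>\<^sup>+\<omega>. ennreal (\<sigma> (mesh m) \<omega> ^ a k * exp (- (u * \<sigma> (mesh m) \<omega>))) \<partial>M)"
    by (rule nn_integral_prod_incr[of "\<lambda>k z. ennreal (z ^ a k * exp (- (u * z)))"]) simp
  also have "\<dots> = (\<Prod>k<?N. ennreal (moment m (a k) u))" by (simp only: nn_moment[OF u])
  also have "\<dots> = ennreal (\<Prod>k<?N. moment m (a k) u)" by (intro prod_ennreal moment_nonneg)
  also have "(\<Prod>k<?N. moment m (a k) u) = (\<Prod>j<length ns. moment m (ns ! j) u) * moment m 0 u ^ (?N - length ns)"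
    using "is" by (subst pre[of "\<lambda>k n. moment m n u"]) (simp add: card_Diff_subset distinct_card)
  finally show ?thesis .
qed

lemma nn_integral_dsum_ext:
  assumes u: "0 < u" and ns: "\<forall>m\<in>set ns. Suc 0 \<le> m"
  shows "(\<integral>\<^sup>+\<omega>. dsum (ext m \<omega>) ns * ennreal (exp (- (u * \<sigma> 1 \<omega>))) \<partial>M) =
    ennreal (real (card {is. length is = length ns \<and> distinct is \<and> set is \<subseteq> {..<2 ^ m :: nat}}) *
      ((\<Prod>j<length ns. moment m (ns ! j) u) * moment m 0 u ^ (2 ^ m - length ns)))" (is "_ = ennreal (real (card ?A) * ?c)")
proof -
  have c: "0 \<le> ?c" using moment_nonneg by (intro mult_nonneg_nonneg prod_nonneg) auto
  have "(\<integral>\<^sup>+\<omega>. dsum (ext m \<omega>) ns * ennreal (exp (- (u * \<sigma> 1 \<omega>))) \<partial>M) =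
    (\<integral>\<^sup>+\<omega>. (\<Sum>is\<in>?A. (\<Prod>j<length ns. ennreal (incr m (is ! j) \<omega> ^ (ns ! j))) * ennreal (exp (- (u * \<sigma> 1 \<omega>)))) \<partial>M)"
    unfolding dsum_ext_finite[OF ns] sum_distrib_right ..
  also have "\<dots> = (\<Sum>is\<in>?A. \<integral>\<^sup>+\<omega>. (\<Prod>j<length ns. ennreal (incr m (is ! j) \<omega> ^ (ns ! j))) * ennreal (exp (- (u * \<sigma> 1 \<omega>))) \<partial>M)"
    by (rule nn_integral_sum) measurable
  also have "\<dots> = (\<Sum>is\<in>?A. ennreal ?c)" by (intro sum.cong refl nn_integral_tuple u) auto
  also have "\<dots> = ennreal (real (card ?A) * ?c)"
    using c by (simp add: ennreal_of_nat_eq_real_of_nat[symmetric] ennreal_mult')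
  finally show ?thesis .
qed

lemma two_power_filterlim: "filterlim (\<lambda>m. 2 ^ m :: nat) sequentially sequentially"
proof -
  have "m \<le> 2 ^ m" for m :: nat by (simp add: less_imp_le)
  then show ?thesis unfolding filterlim_at_top
    by (auto intro!: eventually_sequentiallyI intro: order_trans)
qed

text \<open>The count is a falling factorial of N = 2^m, squeezed between (N - k)^k and N^k.\<close>

lemma card_tuples_tendsto:
  "(\<lambda>m. real (card {is. length is = k \<and> distinct is \<and> set is \<subseteq> {..<2 ^ m :: nat}}) / (2 ^ m) ^ k) \<longlonglongrightarrow> 1"
proof -
  let ?f = "\<lambda>N. real (card {is. length is = k \<and> distinct is \<and> set is \<subseteq> {..<N :: nat}}) / real N ^ k"
  have "?f \<longlonglongrightarrow> 1"
  proof (rule tendsto_sandwich[where f = "\<lambda>N. (1 - real k / real N) ^ k" and h = "\<lambda>_. 1"])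
    have bound: "real (N - k) ^ k \<le> real (card {is. length is = k \<and> distinct is \<and> set is \<subseteq> {..<N}})"
      "real (card {is. length is = k \<and> distinct is \<and> set is \<subseteq> {..<N}}) \<le> real N ^ k" if "k \<le> N" for N
    proof -
      have card: "card {is. length is = k \<and> distinct is \<and> set is \<subseteq> {..<N}} = \<Prod>{N - k + 1..N}"
        using card_lists_distinct_length_eq[of "{..<N}" k] that by simp
      have "(\<Prod>i\<in>{N - k + 1..N}. N - k) \<le> \<Prod>{N - k + 1..N}" by (intro prod_mono) auto
      moreover have "\<Prod>{N - k + 1..N} \<le> (\<Prod>i\<in>{N - k + 1..N}. N)" by (intro prod_mono) auto
      ultimately have "(N - k) ^ k \<le> \<Prod>{N - k + 1..N}" "\<Prod>{N - k + 1..N} \<le> N ^ k" using that by simp_all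
      then show "real (N - k) ^ k \<le> real (card {is. length is = k \<and> distinct is \<and> set is \<subseteq> {..<N}})"
        "real (card {is. length is = k \<and> distinct is \<and> set is \<subseteq> {..<N}}) \<le> real N ^ k"
        unfolding card by (simp_all only: of_nat_power[symmetric] of_nat_le_iff)
    qed
    show "\<forall>\<^sub>F N in sequentially. (1 - real k / real N) ^ k \<le> ?f N"
      using eventually_ge_at_top[of "max 1 k"]
    proof eventually_elim
      case (elim N)
      then have "(1 - real k / real N) ^ k = real (N - k) ^ k / real N ^ k"
        by (simp add: power_divide[symmetric] of_nat_diff diff_divide_distrib)
      then show ?case using bound(1)[of N] elim by (simp add: divide_right_mono)
    qed
    show "\<forall>\<^sub>F N in sequentially. ?f N \<le> 1"
      using eventually_ge_at_top[of "max 1 k"]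
      by eventually_elim (use bound(2) in \<open>simp add: divide_le_eq_1\<close>)
    have "(\<lambda>N. (1 - real k / real N) ^ k) \<longlonglongrightarrow> (1 - 0) ^ k"
      by (intro tendsto_power tendsto_diff tendsto_const lim_const_over_n)
    then show "(\<lambda>N. (1 - real k / real N) ^ k) \<longlonglongrightarrow> 1" by simp
  qed simp
  from filterlim_compose[OF this two_power_filterlim] show ?thesis by simp
qed

lemma moment_0_power_tendsto:
  assumes u: "0 < u"
  shows "(\<lambda>m. moment m 0 u ^ (2 ^ m - k)) \<longlonglongrightarrow> exp (- (u powr \<alpha>))"
proof -
  have "(\<lambda>N. exp (- (real (N - k) / real N * u powr \<alpha>))) \<longlonglongrightarrow> exp (- (1 * u powr \<alpha>))"
  proof (intro tendsto_exp tendsto_minus tendsto_mult tendsto_const)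
    have "(\<lambda>N. 1 - real k / real N) \<longlonglongrightarrow> 1 - 0" by (intro tendsto_diff tendsto_const lim_const_over_n)
    moreover have "\<forall>\<^sub>F N in sequentially. 1 - real k / real N = real (N - k) / real N"
      using eventually_ge_at_top[of "max 1 k"] by eventually_elim (simp add: of_nat_diff diff_divide_distrib)
    ultimately show "(\<lambda>N. real (N - k) / real N) \<longlonglongrightarrow> 1" using Lim_transform_eventually by fastforce
  qed
  note lim = filterlim_compose[OF this two_power_filterlim]
  have "moment m 0 u ^ j = exp (- (real j / real (2 ^ m) * u powr \<alpha>))" for m j
    unfolding moment_0[OF u] exp_of_nat_mult[symmetric] by simp
  then show ?thesis using lim by (simp only: mult_1)
qed

text \<open>There are about 2^(m k) choices of k cells. Each chosen cell contributes 2^(-m) times a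
  damped Levy moment, and the remaining cells together give exp (- u^\<alpha>).\<close>

definition limit_value :: "nat list \<Rightarrow> real \<Rightarrow> real" where
  "limit_value ns u = (\<Prod>j<length ns. \<alpha> * rising \<alpha> (ns ! j) * u powr (\<alpha> - real (ns ! j))) * exp (- (u powr \<alpha>))"

lemma limit_value_tendsto:
  assumes u: "0 < u" and ns: "\<forall>m\<in>set ns. Suc 0 \<le> m"
  shows "(\<lambda>m. real (card {is. length is = length ns \<and> distinct is \<and> set is \<subseteq> {..<2 ^ m :: nat}}) *
      ((\<Prod>j<length ns. moment m (ns ! j) u) * moment m 0 u ^ (2 ^ m - length ns))) \<longlonglongrightarrow> limit_value ns u"
    (is "(\<lambda>m. ?C m * (?P m * ?Q m)) \<longlonglongrightarrow> _")
proof -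
  let ?k = "length ns"
  have "(\<lambda>m. \<Prod>j<?k. 2 ^ m * moment m (ns ! j) u) \<longlonglongrightarrow> (\<Prod>j<?k. \<alpha> * rising \<alpha> (ns ! j) * u powr (\<alpha> - real (ns ! j)))"
    using ns u by (intro tendsto_prod moment_tendsto) auto
  then have P: "(\<lambda>m. (2 ^ m) ^ ?k * ?P m) \<longlonglongrightarrow> (\<Prod>j<?k. \<alpha> * rising \<alpha> (ns ! j) * u powr (\<alpha> - real (ns ! j)))"
    by (simp add: prod.distrib)
  have Q: "?Q \<longlonglongrightarrow> exp (- (u powr \<alpha>))" by (rule moment_0_power_tendsto[OF u])
  have "(\<lambda>m. ?C m / (2 ^ m) ^ ?k * ((2 ^ m) ^ ?k * ?P m * ?Q m)) \<longlonglongrightarrow> 1 * limit_value ns u"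
    unfolding limit_value_def by (intro tendsto_mult card_tuples_tendsto P Q)
  moreover have "?C m / (2 ^ m) ^ ?k * ((2 ^ m) ^ ?k * ?P m * ?Q m) = ?C m * (?P m * ?Q m)" for m
    by (simp add: field_simps)
  ultimately show ?thesis by simp
qed

lemma power_sums_tendsto:
  assumes "\<omega> \<in> space M" "2 \<le> n"
  shows "(\<lambda>m. \<Sum>k<2 ^ m. incr m k \<omega> ^ n) \<longlonglongrightarrow> (\<Sum>i. rj \<omega> i ^ n)"
  unfolding incr_def rj_def
proof (rule jump_path.sum_incs_tendsto[OF path[OF assms(1)], where C = "\<lambda>z. z ^ (n - 2)"])
  show "\<bar>z ^ n\<bar> \<le> z ^ (n - 2) * z\<^sup>2" if "0 \<le> z" for z :: real
  proof -
    have "z ^ (n - 2) * z\<^sup>2 = z ^ n" using assms(2) by (metis power_add le_add_diff_inverse2)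
    then show ?thesis using that by simp
  qed
qed (auto intro: power_mono continuous_intros)

lemma summable_rj_power:
  assumes "\<omega> \<in> space M" "1 \<le> n"
  shows "summable (\<lambda>i. rj \<omega> i ^ n)"
proof (rule summable_comparison_test')
  let ?B = "\<Sum>i. rj \<omega> i"
  show "summable (\<lambda>i. ?B ^ (n - 1) * rj \<omega> i)" using rj_facts(3)[OF assms(1)] by (rule summable_mult)
  have le: "rj \<omega> i \<le> ?B" for i
    using sum_le_suminf[OF rj_facts(3)[OF assms(1)], of "{i}"] rj_facts(1)[OF assms(1)] by simp
  show "norm (rj \<omega> i ^ n) \<le> ?B ^ (n - 1) * rj \<omega> i" if "0 \<le> i" for i
  proof -
    have "rj \<omega> i ^ n = rj \<omega> i ^ (n - 1) * rj \<omega> i" using assms(2) by (metis power_minus_mult Suc_le_eq One_nat_def)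
    also have "\<dots> \<le> ?B ^ (n - 1) * rj \<omega> i"
      using le rj_facts(1)[OF assms(1)] by (intro mult_right_mono power_mono) auto
    finally show ?thesis using rj_facts(1)[OF assms(1)] by simp
  qed
qed

lemma dsum_rj:
  assumes "\<omega> \<in> space M" "\<forall>m\<in>set ns. Suc 0 \<le> m"
  shows "dsum (rj \<omega>) ns = ennreal (power_sum_poly (\<lambda>n. \<Sum>i. rj \<omega> i ^ n) ns)"
    "0 \<le> power_sum_poly (\<lambda>n. \<Sum>i. rj \<omega> i ^ n) ns"
  using dsum_eq_power_sum_poly[of "rj \<omega>" "\<lambda>n. \<Sum>i. rj \<omega> i ^ n" ns]
    rj_facts(1)[OF assms(1)] summable_rj_power[OF assms(1)] assms(2) by auto

lemma measurable_dsum_rj [measurable]: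
  assumes "\<forall>m\<in>set ns. Suc 0 \<le> m"
  shows "(\<lambda>\<omega>. dsum (rj \<omega>) ns) \<in> borel_measurable M"
proof -
  have "(\<lambda>\<omega>. ennreal (power_sum_poly (\<lambda>n. \<Sum>i. rj \<omega> i ^ n) ns)) \<in> borel_measurable M"
    by (intro measurable_compose[OF measurable_power_sum_poly measurable_ennreal]) measurable
  then show ?thesis by (rule measurable_cong[THEN iffD1, rotated]) (simp add: dsum_rj[OF _ assms])
qed

lemma sum_incr_powers_le:
  assumes "\<omega> \<in> space M" "1 \<le> n"
  shows "(\<Sum>k<2 ^ m. incr m k \<omega> ^ n) \<le> \<sigma> 1 \<omega> ^ n"
proof -
  have le: "incr m k \<omega> \<le> \<sigma> 1 \<omega>" if "k < 2 ^ m" for k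
    unfolding sum_incr[OF assms(1), of m, symmetric] using that incr_nonneg[OF assms(1)]
    by (intro member_le_sum) auto
  have n: "z ^ n = z ^ (n - 1) * z" for z :: real using assms(2) by (metis power_minus_mult Suc_le_eq One_nat_def)
  have "(\<Sum>k<2 ^ m. incr m k \<omega> ^ n) \<le> (\<Sum>k<2 ^ m. \<sigma> 1 \<omega> ^ (n - 1) * incr m k \<omega>)"
    unfolding n[of "incr m _ \<omega>"] using le incr_nonneg[OF assms(1)] by (intro sum_mono mult_right_mono power_mono) auto
  also have "\<dots> = \<sigma> 1 \<omega> ^ n" by (simp add: sum_distrib_left[symmetric] sum_incr[OF assms(1)] n)
  finally show ?thesis .
qed

lemma dsum_ext_le:
  assumes "\<omega> \<in> space M" "\<forall>m\<in>set ns. Suc 0 \<le> m"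
  shows "dsum (ext m \<omega>) ns \<le> ennreal (\<sigma> 1 \<omega> ^ sum_list ns)"
proof (rule dsum_le)
  show "summable (\<lambda>i. ext m \<omega> i ^ n)" "(\<Sum>i. ext m \<omega> i ^ n) \<le> \<sigma> 1 \<omega> ^ n" if "1 \<le> n" for n
    using ext_power_sums[OF that, of m \<omega>] sum_incr_powers_le[OF assms(1) that, of m] by (auto simp: sums_iff)
qed (use assms ext_nonneg sigma_nonneg in auto)

lemma damped_bound:
  assumes "\<omega> \<in> space M" "0 < u" "x \<le> ennreal (\<sigma> 1 \<omega> ^ n)"
  shows "x * ennreal (exp (- (u * \<sigma> 1 \<omega>))) \<le> ennreal (fact n / u ^ n)"
proof -
  have "x * ennreal (exp (- (u * \<sigma> 1 \<omega>))) \<le> ennreal (\<sigma> 1 \<omega> ^ n) * ennreal (exp (- (u * \<sigma> 1 \<omega>)))"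
    using assms(3) by (rule mult_right_mono) simp
  also have "\<dots> \<le> ennreal (fact n / u ^ n)"
    using sigma_nonneg[OF assms(1), of 1] assms(2)
    by (simp add: ennreal_mult'[symmetric] power_exp_bound ennreal_leI)
  finally show ?thesis .
qed

text \<open>Replaces the identity, which \<open>sum_incs_tendsto\<close> does not admit. It is
  quadratic at 0, and multiplied by exp (- u z) it is the difference of two damped first powers, at
  u and at u + K.\<close>

definition damped :: "real \<Rightarrow> real \<Rightarrow> real" where
  "damped K z = z * (1 - exp (- (K * z)))"

lemma damped_bounds:
  assumes "0 \<le> z" "0 \<le> K"
  shows "0 \<le> damped K z" "damped K z \<le> K * z\<^sup>2" "damped K z \<le> z"
proof -
  have e: "0 \<le> 1 - exp (- (K * z))" "1 - exp (- (K * z)) \<le> K * z" "1 - exp (- (K * z)) \<le> 1"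
    using exp_ge_add_one_self[of "- (K * z)"] assms by auto
  show "0 \<le> damped K z" unfolding damped_def using e assms by simp
  show "damped K z \<le> K * z\<^sup>2" unfolding damped_def
    using mult_left_mono[OF e(2) assms(1)] by (simp add: power2_eq_square mult_ac)
  show "damped K z \<le> z" unfolding damped_def using mult_left_mono[OF e(3) assms(1)] by simp
qed

lemma nn_integral_sum_damped:
  assumes u: "0 < u" and K: "0 < K"
  shows "(\<integral>\<^sup>+\<omega>. ennreal ((\<Sum>k<2 ^ m. damped K (incr m k \<omega>)) * exp (- (u * \<sigma> 1 \<omega>))) \<partial>M) =
    ennreal (2 ^ m * (moment m 1 u - moment m 1 (u + K)) * moment m 0 u ^ (2 ^ m - 1))"
proof -
  let ?N = "2 ^ m :: nat"
  let ?d = "moment m 1 u - moment m 1 (u + K)"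
  have dm: "(\<integral>\<^sup>+\<omega>. ennreal (damped K (\<sigma> (mesh m) \<omega>) * exp (- (u * \<sigma> (mesh m) \<omega>))) \<partial>M) = ennreal ?d" and d0: "0 \<le> ?d"
  proof -
    have i: "integrable M (\<lambda>\<omega>. \<sigma> (mesh m) \<omega> ^ 1 * exp (- (v * \<sigma> (mesh m) \<omega>)))" if "0 < v" for v
      using sigma_nonneg that by (intro integrable_laplace_moment) auto
    have eq: "damped K z * exp (- (u * z)) = z ^ 1 * exp (- (u * z)) - z ^ 1 * exp (- ((u + K) * z))" for z
      by (simp add: damped_def algebra_simps exp_add[symmetric])
    have int: "integrable M (\<lambda>\<omega>. damped K (\<sigma> (mesh m) \<omega>) * exp (- (u * \<sigma> (mesh m) \<omega>)))"
      unfolding eq using u K by (intro Bochner_Integration.integrable_diff i) auto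
    have nn: "AE \<omega> in M. 0 \<le> damped K (\<sigma> (mesh m) \<omega>) * exp (- (u * \<sigma> (mesh m) \<omega>))"
      using damped_bounds(1) sigma_nonneg K by (intro AE_I2) auto
    have val: "(\<integral>\<omega>. damped K (\<sigma> (mesh m) \<omega>) * exp (- (u * \<sigma> (mesh m) \<omega>)) \<partial>M) = ?d"
      unfolding eq moment_def using u K by (intro Bochner_Integration.integral_diff i) auto
    show "(\<integral>\<^sup>+\<omega>. ennreal (damped K (\<sigma> (mesh m) \<omega>) * exp (- (u * \<sigma> (mesh m) \<omega>))) \<partial>M) = ennreal ?d"
      using nn_integral_eq_integral[OF int nn] val by simp
    show "0 \<le> ?d" using integral_nonneg_AE[OF nn] val by simp
  qed
  have single: "(\<integral>\<^sup>+\<omega>. ennreal (damped K (incr m k \<omega>) * exp (- (u * \<sigma> 1 \<omega>))) \<partial>M) = ennreal (?d * moment m 0 u ^ (?N - 1))"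
    if k: "k < ?N" for k
  proof -
    \<comment> \<open>Only cell k carries the damped increment; every cell carries its share of exp
      (- u \<open>\<sigma> 1 \<omega>\<close>).\<close>
    define g where "g l z = ennreal ((if l = k then damped K z else 1) * exp (- (u * z)))" for l z
    have "ennreal (damped K (incr m k \<omega>) * exp (- (u * \<sigma> 1 \<omega>))) = (\<Prod>l<?N. g l (incr m l \<omega>))" if \<omega>: "\<omega> \<in> space M" for \<omega>
    proof -
      have nn: "0 \<le> (if l = k then damped K (incr m l \<omega>) else 1) * exp (- (u * incr m l \<omega>))" for l
        using damped_bounds(1) incr_nonneg[OF \<omega>] K by simp
      have "(\<Prod>l<?N. (if l = k then damped K (incr m l \<omega>) else 1) * exp (- (u * incr m l \<omega>))) =
         damped K (incr m k \<omega>) * exp (- (u * \<sigma> 1 \<omega>))"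
        using k by (simp add: prod.distrib exp_sigma_eq[OF \<omega>, of u m])
      then show ?thesis unfolding g_def by (simp add: prod_ennreal nn)
    qed
    then have "(\<integral>\<^sup>+\<omega>. ennreal (damped K (incr m k \<omega>) * exp (- (u * \<sigma> 1 \<omega>))) \<partial>M) = (\<integral>\<^sup>+\<omega>. (\<Prod>l<?N. g l (incr m l \<omega>)) \<partial>M)"
      by (rule nn_integral_cong)
    also have "\<dots> = (\<Prod>l<?N. \<integral>\<^sup>+\<omega>. g l (\<sigma> (mesh m) \<omega>) \<partial>M)"
    proof (rule nn_integral_prod_incr)
      show "g l \<in> borel_measurable borel" for l
        unfolding g_def[abs_def] damped_def by (cases "l = k") simp_all
    qed
    also have "\<dots> = (\<Prod>l<?N. if l = k then ennreal ?d else ennreal (moment m 0 u))"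
    proof (intro prod.cong refl)
      fix l show "(\<integral>\<^sup>+\<omega>. g l (\<sigma> (mesh m) \<omega>) \<partial>M) = (if l = k then ennreal ?d else ennreal (moment m 0 u))"
        using dm nn_moment[OF u, of m 0] by (simp add: g_def)
    qed
    also have "\<dots> = ennreal ?d * (\<Prod>l\<in>{..<?N} - {k}. ennreal (moment m 0 u))"
      using k by (subst prod.remove[of _ k]) auto
    also have "\<dots> = ennreal (?d * moment m 0 u ^ (?N - 1))"
      using k d0 moment_nonneg by (simp add: ennreal_mult ennreal_power)
    finally show ?thesis .
  qed
  have "(\<integral>\<^sup>+\<omega>. ennreal ((\<Sum>k<2 ^ m. damped K (incr m k \<omega>)) * exp (- (u * \<sigma> 1 \<omega>))) \<partial>M) =
     (\<integral>\<^sup>+\<omega>. (\<Sum>k<?N. ennreal (damped K (incr m k \<omega>) * exp (- (u * \<sigma> 1 \<omega>)))) \<partial>M)"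
    using damped_bounds(1) incr_nonneg K by (intro nn_integral_cong) (simp add: sum_distrib_right)
  also have "\<dots> = (\<Sum>k<?N. \<integral>\<^sup>+\<omega>. ennreal (damped K (incr m k \<omega>) * exp (- (u * \<sigma> 1 \<omega>))) \<partial>M)"
    by (rule nn_integral_sum) (simp add: damped_def)
  also have "\<dots> = (\<Sum>k<?N. ennreal (?d * moment m 0 u ^ (?N - 1)))" using single by (intro sum.cong) auto
  also have "\<dots> = ennreal (2 ^ m * ?d * moment m 0 u ^ (?N - 1))"
    using d0 moment_nonneg[of m 0 u] by (simp add: sum_ennreal mult.assoc del: sum_constant) simp
  finally show ?thesis .
qed

end

section \<open>Scaling and Gamma integrals\<close>

lemma dsum_scale:
  assumes "0 \<le> c" "\<And>i. 0 \<le> f i"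
  shows "dsum (\<lambda>i. c * f i) ns = ennreal (c ^ sum_list ns) * dsum f ns"
proof -
  have "(\<Prod>j<length ns. ennreal ((c * f (is ! j)) ^ (ns ! j))) =
      ennreal (c ^ sum_list ns) * (\<Prod>j<length ns. ennreal (f (is ! j) ^ (ns ! j)))" for "is"
  proof -
    have "(\<Prod>j<length ns. ennreal ((c * f (is ! j)) ^ (ns ! j))) =
       (\<Prod>j<length ns. ennreal (c ^ (ns ! j)) * ennreal (f (is ! j) ^ (ns ! j)))"
      using assms by (intro prod.cong refl) (simp add: power_mult_distrib ennreal_mult)
    also have "\<dots> = (\<Prod>j<length ns. ennreal (c ^ (ns ! j))) * (\<Prod>j<length ns. ennreal (f (is ! j) ^ (ns ! j)))"
      by (rule prod.distrib)
    also have "(\<Prod>j<length ns. ennreal (c ^ (ns ! j))) = ennreal (c ^ sum_list ns)"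
      using assms(1) by (simp add: prod_ennreal power_sum[symmetric] sum_list_sum_nth atLeast0LessThan)
    finally show ?thesis .
  qed
  then show ?thesis unfolding dsum_eq_nn_integral by (simp add: nn_integral_cmult)
qed

lemma nn_integral_Gamma_scaled:
  assumes s: "0 < s" and x: "0 < (x :: real)"
  shows "(\<integral>\<^sup>+u. ennreal (indicator {0..} u * u powr (s - 1) * exp (- (u * x))) \<partial>lborel) = ennreal (Gamma s * x powr (- s))"
proof -
  have "ennreal (Gamma s) = ennreal \<bar>x\<bar> * (\<integral>\<^sup>+u. ennreal (indicator {0..} (0 + x * u) * (0 + x * u) powr (s - 1) / exp (0 + x * u)) \<partial>lborel)"
    unfolding Gamma_conv_nn_integral_real[OF s] using x by (intro nn_integral_real_affine) auto
  also have "(\<integral>\<^sup>+u. ennreal (indicator {0..} (0 + x * u) * (0 + x * u) powr (s - 1) / exp (0 + x * u)) \<partial>lborel) =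
     (\<integral>\<^sup>+u. ennreal (x powr (s - 1)) * ennreal (indicator {0..} u * u powr (s - 1) * exp (- (u * x))) \<partial>lborel)"
    using x by (intro nn_integral_cong)
      (auto simp: indicator_def zero_le_mult_iff powr_mult exp_minus field_simps ennreal_mult'[symmetric])
  also have "\<dots> = ennreal (x powr (s - 1)) * (\<integral>\<^sup>+u. ennreal (indicator {0..} u * u powr (s - 1) * exp (- (u * x))) \<partial>lborel)"
    by (rule nn_integral_cmult) simp
  finally have "ennreal (Gamma s) = ennreal (x powr s) * (\<integral>\<^sup>+u. ennreal (indicator {0..} u * u powr (s - 1) * exp (- (u * x))) \<partial>lborel)"
    using x by (simp add: mult.assoc[symmetric] ennreal_mult'[symmetric] powr_mult_base)
  then have "ennreal (x powr (- s)) * ennreal (Gamma s) = ennreal (x powr (- s) * x powr s) * (\<integral>\<^sup>+u. ennreal (indicator {0..} u * u powr (s - 1) * exp (- (u * x))) \<partial>lborel)"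
    by (simp add: ennreal_mult' mult.assoc)
  then show ?thesis using x s by (simp add: powr_add[symmetric] ennreal_mult'[symmetric] mult.commute)
qed

lemma nn_integral_stretched_exp:
  assumes t: "0 < t" and \<alpha>: "0 < (\<alpha> :: real)"
  shows "(\<integral>\<^sup>+u. ennreal (indicator {0<..} u * (u powr (t - 1) * exp (- (u powr \<alpha>)))) \<partial>lborel) = ennreal (Gamma (t / \<alpha>) / \<alpha>)"
proof -
  define f where "f u = u powr (t - 1) * exp (- (u powr \<alpha>))" for u :: real
  \<comment> \<open>The substitution v = u^\<alpha>, written through its inverse.\<close>
  define g where "g v = v powr (1 / \<alpha>)" for v :: real
  define g' where "g' v = (1 / \<alpha>) * v powr (1 / \<alpha> - 1)" for v :: real
  have fg: "f (g v) * g' v = (1 / \<alpha>) * (v powr (t / \<alpha> - 1) * exp (- v))" if "0 < v" for v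
  proof -
    have "(v powr (1 / \<alpha>)) powr (t - 1) * v powr (1 / \<alpha> - 1) = v powr (t / \<alpha> - 1)"
      by (simp add: powr_powr powr_add[symmetric] right_diff_distrib)
    moreover have "(v powr (1 / \<alpha>)) powr \<alpha> = v" using that \<alpha> by (simp add: powr_powr)
    ultimately show ?thesis by (simp add: f_def g_def g'_def mult_ac)
  qed
  have ei: "einterval 0 \<infinity> = {0<..}" by (auto simp: einterval_def)
  define h where "h v = indicator {0<..} v * ((1 / \<alpha>) * (v powr (t / \<alpha> - 1) * exp (- v)))" for v :: real
  have t\<alpha>: "0 < t / \<alpha>" using t \<alpha> by simp
  have h_nn: "(\<integral>\<^sup>+v. ennreal (h v) \<partial>lborel) = ennreal (Gamma (t / \<alpha>) / \<alpha>)"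
  proof -
    have "(\<integral>\<^sup>+v. ennreal (h v) \<partial>lborel) = (\<integral>\<^sup>+v. ennreal (1 / \<alpha>) * ennreal (indicator {0..} v * v powr (t / \<alpha> - 1) * exp (- (v * 1))) \<partial>lborel)"
      using \<alpha> by (intro nn_integral_cong) (auto simp: h_def indicator_def ennreal_mult'[symmetric])
    also have "\<dots> = ennreal (1 / \<alpha>) * ennreal (Gamma (t / \<alpha>) * 1 powr (- (t / \<alpha>)))"
      by (subst nn_integral_cmult, simp, subst nn_integral_Gamma_scaled[OF t\<alpha>]) simp_all
    finally show ?thesis using \<alpha> by (simp add: ennreal_mult'[symmetric])
  qed
  have h0: "0 \<le> h v" for v using \<alpha> by (simp add: h_def indicator_def)
  have h_meas[measurable]: "h \<in> borel_measurable borel" unfolding h_def by measurable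
  have h_int: "integrable lborel h"
    using h0 by (intro integrableI_nonneg) (auto simp: h_nn)
  have h_eq: "indicator {0<..} v *\<^sub>R (f (g v) * g' v) = h v" for v
    using fg[of v] by (cases "0 < v") (auto simp: h_def)
  have int_fg: "set_integrable lborel (einterval 0 \<infinity>) (\<lambda>v. f (g v) * g' v)"
    unfolding set_integrable_def ei h_eq using h_int by simp
  have d: "DERIV g v :> g' v" if "0 < ereal v" "ereal v < \<infinity>" for v
    unfolding g_def[abs_def] g'_def using that(1) by (intro has_real_derivative_powr) simp
  have cf: "isCont f (g v)" if "0 < ereal v" "ereal v < \<infinity>" for v
  proof -
    have "0 < g v" using that(1) by (simp add: g_def)
    then show ?thesis unfolding f_def[abs_def] by (intro continuous_intros) auto
  qed
  have cg': "isCont g' v" if "0 < ereal v" "ereal v < \<infinity>" for v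
    using that(1) unfolding g'_def[abs_def] by (intro continuous_intros) auto
  have f0: "0 \<le> f (g v)" for v by (simp add: f_def)
  have g0: "0 \<le> g' v" for v using \<alpha> by (simp add: g'_def)
  have "(g \<longlongrightarrow> 0) (at_right 0)" unfolding g_def[abs_def] using \<alpha> by real_asymp
  then have A: "((ereal \<circ> g \<circ> real_of_ereal) \<longlongrightarrow> 0) (at_right 0)"
    unfolding zero_ereal_def ereal_tendsto_simps .
  have "filterlim g at_top at_top" unfolding g_def[abs_def] using \<alpha> by real_asymp
  then have B: "((ereal \<circ> g \<circ> real_of_ereal) \<longlongrightarrow> \<infinity>) (at_left \<infinity>)"
    unfolding ereal_tendsto_simps .
  have "(0::ereal) < \<infinity>" by simp
  note subst = interval_integral_substitution_nonneg[OF this d cf cg' f0 g0 A B int_fg]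
  have "(LINT u:{0<..}|lborel. f u) = (LINT v:{0<..}|lborel. f (g v) * g' v)"
    using subst(2) by (simp add: interval_lebesgue_integral_def ei)
  also have "\<dots> = (\<integral>v. h v \<partial>lborel)" unfolding set_lebesgue_integral_def h_eq ..
  also have "\<dots> = Gamma (t / \<alpha>) / \<alpha>"
    using h_nn h0 t\<alpha> \<alpha> by (intro integral_eq_nn_integral[THEN trans]) auto
  finally have val: "(LINT u:{0<..}|lborel. f u) = Gamma (t / \<alpha>) / \<alpha>" .
  have "(\<integral>\<^sup>+u. ennreal (indicator {0<..} u * f u) \<partial>lborel) = ennreal (\<integral>u. indicator {0<..} u * f u \<partial>lborel)"
    using subst(1) by (intro nn_integral_eq_integral) (simp_all add: set_integrable_def ei f_def)
  then show ?thesis using val by (simp add: set_lebesgue_integral_def f_def)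
qed

section \<open>Absence of drift and moments of the normalised jumps\<close>

context stable_process
begin

lemma sum_damped_tendsto:
  assumes "\<omega> \<in> space M" "0 < K"
  shows "(\<lambda>m. \<Sum>k<2 ^ m. damped K (incr m k \<omega>)) \<longlonglongrightarrow> (\<Sum>i. damped K (rj \<omega> i))"
  unfolding incr_def rj_def
proof (rule jump_path.sum_incs_tendsto[OF path[OF assms(1)], where C = "\<lambda>_. K"])
  show "\<bar>damped K z\<bar> \<le> K * z\<^sup>2" if "0 \<le> z" for z
    using damped_bounds[of z K] that assms(2) by simp
  show "continuous_on {0..} (damped K)" unfolding damped_def[abs_def] by (intro continuous_intros)
qed simp

lemma suminf_damped:
  assumes "\<omega> \<in> space M" "0 < K"
  shows "0 \<le> (\<Sum>i. damped K (rj \<omega> i))" "(\<Sum>i. damped K (rj \<omega> i)) \<le> (\<Sum>i. rj \<omega> i)"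
proof -
  have d: "0 \<le> damped K (rj \<omega> i)" "damped K (rj \<omega> i) \<le> rj \<omega> i" for i
    using damped_bounds[OF rj_facts(1)[OF assms(1)], of K i] assms(2) by auto
  have "summable (\<lambda>i. damped K (rj \<omega> i))"
    by (rule summable_comparison_test'[OF rj_facts(3)[OF assms(1)], of 0]) (use d in auto)
  then show "0 \<le> (\<Sum>i. damped K (rj \<omega> i))" "(\<Sum>i. damped K (rj \<omega> i)) \<le> (\<Sum>i. rj \<omega> i)"
    using d rj_facts(3)[OF assms(1)] by (auto intro!: suminf_nonneg suminf_le)
qed

lemma nn_integral_damped_jumps:
  assumes K: "0 < K"
  shows "(\<integral>\<^sup>+\<omega>. ennreal ((\<Sum>i. damped K (rj \<omega> i)) * exp (- (1 * \<sigma> 1 \<omega>))) \<partial>M) =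
    ennreal ((\<alpha> - \<alpha> * (1 + K) powr (\<alpha> - 1)) * exp (- 1))"
proof (rule LIMSEQ_unique)
  have [measurable]: "damped K \<in> borel_measurable borel" unfolding damped_def[abs_def] by measurable
  show "(\<lambda>m. \<integral>\<^sup>+\<omega>. ennreal ((\<Sum>k<2 ^ m. damped K (incr m k \<omega>)) * exp (- (1 * \<sigma> 1 \<omega>))) \<partial>M) \<longlonglongrightarrow>
    (\<integral>\<^sup>+\<omega>. ennreal ((\<Sum>i. damped K (rj \<omega> i)) * exp (- (1 * \<sigma> 1 \<omega>))) \<partial>M)"
  proof (rule nn_integral_dominated_convergence[where w = "\<lambda>_. ennreal (fact 1 / 1 ^ 1)"])
    show "AE \<omega> in M. ennreal ((\<Sum>k<2 ^ m. damped K (incr m k \<omega>)) * exp (- (1 * \<sigma> 1 \<omega>))) \<le> ennreal (fact 1 / 1 ^ 1)" for m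
    proof (rule AE_I2)
      fix \<omega> assume \<omega>: "\<omega> \<in> space M"
      have "(\<Sum>k<2 ^ m. damped K (incr m k \<omega>)) \<le> \<sigma> 1 \<omega> ^ 1"
        using damped_bounds(3) incr_nonneg[OF \<omega>] K unfolding sum_incr[OF \<omega>, of m, symmetric] power_one_right
        by (intro sum_mono) auto
      moreover have "0 \<le> (\<Sum>k<2 ^ m. damped K (incr m k \<omega>))"
        using damped_bounds(1) incr_nonneg[OF \<omega>] K by (intro sum_nonneg) auto
      ultimately show "ennreal ((\<Sum>k<2 ^ m. damped K (incr m k \<omega>)) * exp (- (1 * \<sigma> 1 \<omega>))) \<le> ennreal (fact 1 / 1 ^ 1)"
        using damped_bound[OF \<omega>, of 1 "ennreal (\<Sum>k<2 ^ m. damped K (incr m k \<omega>))" 1]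
        by (simp add: ennreal_mult ennreal_leI)
    qed
    show "AE \<omega> in M. (\<lambda>m. ennreal ((\<Sum>k<2 ^ m. damped K (incr m k \<omega>)) * exp (- (1 * \<sigma> 1 \<omega>)))) \<longlonglongrightarrow>
      ennreal ((\<Sum>i. damped K (rj \<omega> i)) * exp (- (1 * \<sigma> 1 \<omega>)))"
      using K by (intro AE_I2 tendsto_ennrealI tendsto_mult sum_damped_tendsto tendsto_const) auto
  qed (auto simp: emeasure_space_1)
  have m1: "(\<lambda>m. 2 ^ m * moment m 1 v) \<longlonglongrightarrow> \<alpha> * v powr (\<alpha> - 1)" if "0 < v" for v
    using moment_tendsto[OF that, of 1] by simp
  have "(\<lambda>m. (2 ^ m * moment m 1 1 - 2 ^ m * moment m 1 (1 + K)) * moment m 0 1 ^ (2 ^ m - 1)) \<longlonglongrightarrow>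
     (\<alpha> * 1 powr (\<alpha> - 1) - \<alpha> * (1 + K) powr (\<alpha> - 1)) * exp (- (1 powr \<alpha>))"
    using K by (intro tendsto_mult tendsto_diff m1 moment_0_power_tendsto) auto
  then have "(\<lambda>m. ennreal (2 ^ m * (moment m 1 1 - moment m 1 (1 + K)) * moment m 0 1 ^ (2 ^ m - 1))) \<longlonglongrightarrow>
     ennreal ((\<alpha> - \<alpha> * (1 + K) powr (\<alpha> - 1)) * exp (- 1))"
    by (intro tendsto_ennrealI) (simp add: right_diff_distrib)
  then show "(\<lambda>m. \<integral>\<^sup>+\<omega>. ennreal ((\<Sum>k<2 ^ m. damped K (incr m k \<omega>)) * exp (- (1 * \<sigma> 1 \<omega>))) \<partial>M) \<longlonglongrightarrow>
     ennreal ((\<alpha> - \<alpha> * (1 + K) powr (\<alpha> - 1)) * exp (- 1))"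
    unfolding nn_integral_sum_damped[OF zero_less_one K] .
qed

text \<open>The damped mean of \<open>\<sigma> 1\<close> is \<alpha> exp (- 1), and the damped jumps
  account for all of it except \<alpha> (1 + K)^(\<alpha> - 1) exp (- 1). As \<alpha> < 1, this gap
  closes when K tends to infinity, so the nonnegative defect vanishes almost surely.\<close>

lemma pure_jump: "AE \<omega> in M. (\<Sum>i. rj \<omega> i) = \<sigma> 1 \<omega>"
proof -
  define D where "D \<omega> = (\<sigma> 1 \<omega> - (\<Sum>i. rj \<omega> i)) * exp (- (1 * \<sigma> 1 \<omega>))" for \<omega>
  have [measurable]: "D \<in> borel_measurable M" unfolding D_def by measurable
  have [measurable]: "damped K \<in> borel_measurable borel" for K unfolding damped_def[abs_def] by measurable
  have D0: "0 \<le> D \<omega>" if "\<omega> \<in> space M" for \<omega> using rj_facts(4)[OF that] by (simp add: D_def)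
  have le: "(\<integral>\<^sup>+\<omega>. ennreal (D \<omega>) \<partial>M) \<le> ennreal (\<alpha> * (1 + K) powr (\<alpha> - 1) * exp (- 1))" if K: "0 < K" for K
  proof -
    let ?a = "\<alpha> * exp (- 1)" and ?b = "\<alpha> * (1 + K) powr (\<alpha> - 1) * exp (- 1)"
    have "(\<integral>\<^sup>+\<omega>. ennreal (D \<omega>) \<partial>M) + (\<integral>\<^sup>+\<omega>. ennreal ((\<Sum>i. damped K (rj \<omega> i)) * exp (- (1 * \<sigma> 1 \<omega>))) \<partial>M) =
       (\<integral>\<^sup>+\<omega>. ennreal (D \<omega>) + ennreal ((\<Sum>i. damped K (rj \<omega> i)) * exp (- (1 * \<sigma> 1 \<omega>))) \<partial>M)"
      by (rule nn_integral_add[symmetric]) measurable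
    also have "\<dots> \<le> (\<integral>\<^sup>+\<omega>. ennreal (\<sigma> (mesh 0) \<omega> ^ 1 * exp (- (1 * \<sigma> (mesh 0) \<omega>))) \<partial>M)"
    proof (rule nn_integral_mono)
      fix \<omega> assume \<omega>: "\<omega> \<in> space M"
      have "D \<omega> + (\<Sum>i. damped K (rj \<omega> i)) * exp (- (1 * \<sigma> 1 \<omega>)) \<le> \<sigma> 1 \<omega> * exp (- (1 * \<sigma> 1 \<omega>))"
        unfolding D_def distrib_right[symmetric] using suminf_damped[OF \<omega> K]
        by (intro mult_right_mono) auto
      then show "ennreal (D \<omega>) + ennreal ((\<Sum>i. damped K (rj \<omega> i)) * exp (- (1 * \<sigma> 1 \<omega>))) \<le> ennreal (\<sigma> (mesh 0) \<omega> ^ 1 * exp (- (1 * \<sigma> (mesh 0) \<omega>)))"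
        using D0[OF \<omega>] suminf_damped[OF \<omega> K] by (simp add: ennreal_plus[symmetric] ennreal_leI del: ennreal_plus)
    qed
    also have "\<dots> = ennreal ?a"
      unfolding nn_moment[OF zero_less_one] moment_eq[OF zero_less_one] by (simp add: stable_moment_def mult.commute)
    finally have *: "(\<integral>\<^sup>+\<omega>. ennreal (D \<omega>) \<partial>M) + ennreal (?a - ?b) \<le> ennreal ?a"
      unfolding nn_integral_damped_jumps[OF K] by (simp add: left_diff_distrib)
    have "(1 + K) powr (\<alpha> - 1) \<le> 1 powr (\<alpha> - 1)" using alpha K by (intro powr_mono2') auto
    then have b: "0 \<le> ?b" "?b \<le> ?a"
      using alpha by (simp_all add: mult_left_le)
    obtain r where r: "(\<integral>\<^sup>+\<omega>. ennreal (D \<omega>) \<partial>M) = ennreal r" "0 \<le> r"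
    proof (cases "\<integral>\<^sup>+\<omega>. ennreal (D \<omega>) \<partial>M")
      case top
      then show ?thesis using * by (simp add: top_unique)
    qed (use that in auto)
    have "ennreal (r + (?a - ?b)) \<le> ennreal ?a" using * r b by (simp add: ennreal_plus)
    then have "r \<le> ?b" using alpha by (subst (asm) ennreal_le_iff) auto
    then show ?thesis unfolding r by (rule ennreal_leI)
  qed
  have "((\<lambda>K. \<alpha> * (1 + K) powr (\<alpha> - 1) * exp (- 1)) \<longlongrightarrow> 0) at_top"
    using alpha by real_asymp
  then have "((\<lambda>K. ennreal (\<alpha> * (1 + K) powr (\<alpha> - 1) * exp (- 1))) \<longlongrightarrow> ennreal 0) at_top"
    by (rule tendsto_ennrealI)
  then have "(\<integral>\<^sup>+\<omega>. ennreal (D \<omega>) \<partial>M) \<le> ennreal 0"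
  proof (rule tendsto_lowerbound)
    show "\<forall>\<^sub>F K in at_top. (\<integral>\<^sup>+\<omega>. ennreal (D \<omega>) \<partial>M) \<le> ennreal (\<alpha> * (1 + K) powr (\<alpha> - 1) * exp (- 1))"
      using eventually_gt_at_top[of 0] by (rule eventually_mono) (rule le)
  qed simp
  then have "AE \<omega> in M. ennreal (D \<omega>) = 0" by (simp add: nn_integral_0_iff_AE)
  then show ?thesis
  proof (rule AE_mp, intro AE_I2 impI)
    fix \<omega> assume \<omega>: "\<omega> \<in> space M" "ennreal (D \<omega>) = 0"
    then have "D \<omega> = 0" using D0[OF \<omega>(1)] by (simp add: ennreal_eq_0_iff)
    then show "(\<Sum>i. rj \<omega> i) = \<sigma> 1 \<omega>" by (simp add: D_def)
  qed
qed

text \<open>The probability that an increment is 0 is at most its Laplace transform exp (- 2^(-m)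
  u^\<alpha>) at any u > 0, which tends to 0 as u grows.\<close>

lemma incr_pos: "AE \<omega> in M. 0 < incr m k \<omega>"
proof -
  have "(\<integral>\<^sup>+\<omega>. indicator {0} (\<sigma> (mesh m) \<omega>) \<partial>M) \<le> ennreal (exp (- mesh m * u powr \<alpha>))" if u: "0 < u" for u
  proof -
    have "(\<integral>\<^sup>+\<omega>. indicator {0} (\<sigma> (mesh m) \<omega>) \<partial>M) \<le> (\<integral>\<^sup>+\<omega>. ennreal (\<sigma> (mesh m) \<omega> ^ 0 * exp (- (u * \<sigma> (mesh m) \<omega>))) \<partial>M)"
      by (intro nn_integral_mono) (simp add: indicator_def)
    then show ?thesis unfolding nn_moment[OF u] moment_0[OF u] .
  qed
  note le = this
  have "((\<lambda>u. exp (- mesh m * u powr \<alpha>)) \<longlongrightarrow> 0) at_top"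
  proof -
    define c where "c = mesh m"
    have "0 < c" by (simp add: c_def)
    then have "((\<lambda>u. exp (- c * u powr \<alpha>)) \<longlongrightarrow> 0) at_top" using alpha by real_asymp
    then show ?thesis by (simp add: c_def)
  qed
  then have "((\<lambda>u. ennreal (exp (- mesh m * u powr \<alpha>))) \<longlongrightarrow> ennreal 0) at_top"
    by (rule tendsto_ennrealI)
  then have "(\<integral>\<^sup>+\<omega>. indicator {0} (\<sigma> (mesh m) \<omega>) \<partial>M) \<le> ennreal 0"
  proof (rule tendsto_lowerbound)
    show "\<forall>\<^sub>F u in at_top. (\<integral>\<^sup>+\<omega>. indicator {0} (\<sigma> (mesh m) \<omega>) \<partial>M) \<le> ennreal (exp (- mesh m * u powr \<alpha>))"
      using eventually_gt_at_top[of 0] by (rule eventually_mono) (rule le)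
  qed simp
  then have "(\<integral>\<^sup>+\<omega>. indicator {0} (incr m k \<omega>) \<partial>M) = (0::ennreal)"
    using nn_integral_incr[of "indicator {0}" m k] by simp
  then have "AE \<omega> in M. indicator {0} (incr m k \<omega>) = (0::ennreal)"
    by (subst (asm) nn_integral_0_iff_AE) auto
  then show ?thesis
  proof (rule AE_mp, intro AE_I2 impI)
    fix \<omega> assume "\<omega> \<in> space M" "indicator {0} (incr m k \<omega>) = (0::ennreal)"
    then show "0 < incr m k \<omega>" using incr_nonneg[of \<omega> m k] by (auto simp: indicator_def order_le_less split: if_splits)
  qed
qed

lemma sigma_pos: "AE \<omega> in M. 0 < \<sigma> 1 \<omega>"
  using incr_pos[of 0 0]
proof (rule AE_mp, intro AE_I2 impI)
  fix \<omega> assume "\<omega> \<in> space M" "0 < incr 0 0 \<omega>"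
  then show "0 < \<sigma> 1 \<omega>" using sum_incr[of \<omega> 0] by simp
qed

lemma rj_0_less: "AE \<omega> in M. rj \<omega> 0 < \<sigma> 1 \<omega>"
  using incr_pos[of 1 0] incr_pos[of 1 1] AE_space
proof eventually_elim
  case (elim \<omega>)
  have "incr 1 0 \<omega> + incr 1 1 \<omega> = \<sigma> 1 \<omega>" using sum_incr[OF elim(3), of 1] by (simp add: numeral_2_eq_2)
  then show ?case using rj_facts(5)[OF elim(3)] elim by simp
qed

lemma nn_integral_dsum_rj:
  assumes u: "0 < u" and ns: "\<forall>m\<in>set ns. Suc 0 \<le> m"
  shows "(\<integral>\<^sup>+\<omega>. dsum (rj \<omega>) ns * ennreal (exp (- (u * \<sigma> 1 \<omega>))) \<partial>M) = ennreal (limit_value ns u)"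
proof (rule LIMSEQ_unique)
  note [measurable] = measurable_dsum_rj[OF ns]
  have [measurable]: "(\<lambda>\<omega>. dsum (ext m \<omega>) ns) \<in> borel_measurable M" for m
    unfolding dsum_ext_finite[OF ns] by measurable
  show "(\<lambda>m. \<integral>\<^sup>+\<omega>. dsum (ext m \<omega>) ns * ennreal (exp (- (u * \<sigma> 1 \<omega>))) \<partial>M) \<longlonglongrightarrow>
    (\<integral>\<^sup>+\<omega>. dsum (rj \<omega>) ns * ennreal (exp (- (u * \<sigma> 1 \<omega>))) \<partial>M)"
  proof (rule nn_integral_dominated_convergence[where w = "\<lambda>_. ennreal (fact (sum_list ns) / u ^ sum_list ns)"])
    show "AE \<omega> in M. dsum (ext m \<omega>) ns * ennreal (exp (- (u * \<sigma> 1 \<omega>))) \<le> ennreal (fact (sum_list ns) / u ^ sum_list ns)" for m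
      by (intro AE_I2 damped_bound dsum_ext_le u ns)
    show "AE \<omega> in M. (\<lambda>m. dsum (ext m \<omega>) ns * ennreal (exp (- (u * \<sigma> 1 \<omega>)))) \<longlonglongrightarrow> dsum (rj \<omega>) ns * ennreal (exp (- (u * \<sigma> 1 \<omega>)))"
      using pure_jump AE_space
    proof eventually_elim
      case (elim \<omega>)
      have "(\<lambda>m. power_sum_poly (\<lambda>n. \<Sum>k<2 ^ m. incr m k \<omega> ^ n) ns) \<longlonglongrightarrow> power_sum_poly (\<lambda>n. \<Sum>i. rj \<omega> i ^ n) ns"
      proof (rule tendsto_power_sum_poly[OF _ ns])
        fix n :: nat assume "1 \<le> n"
        then consider "n = 1" | "2 \<le> n" by linarith
        then show "(\<lambda>m. \<Sum>k<2 ^ m. incr m k \<omega> ^ n) \<longlonglongrightarrow> (\<Sum>i. rj \<omega> i ^ n)"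
        proof cases
          case 1
          \<comment> \<open>For exponent 1 the increments sum to \<open>\<sigma> 1 \<omega>\<close>
            at every level, so convergence to the sum of the jumps is exactly
            \<open>pure_jump\<close>.\<close>
          then show ?thesis using elim sum_incr[OF elim(2)] by simp
        next
          case 2
          then show ?thesis by (rule power_sums_tendsto[OF elim(2)])
        qed
      qed
      then have "(\<lambda>m. dsum (ext m \<omega>) ns) \<longlonglongrightarrow> dsum (rj \<omega>) ns"
        unfolding dsum_ext(1)[OF elim(2) ns] dsum_rj(1)[OF elim(2) ns] by (rule tendsto_ennrealI)
      then show ?case
        by (intro tendsto_mult_ennreal tendsto_const) (auto simp: dsum_rj(1)[OF elim(2) ns])
    qed
  qed (auto simp: emeasure_space_1 ennreal_mult_less_top)
  show "(\<lambda>m. \<integral>\<^sup>+\<omega>. dsum (ext m \<omega>) ns * ennreal (exp (- (u * \<sigma> 1 \<omega>))) \<partial>M) \<longlonglongrightarrow> ennreal (limit_value ns u)"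
    unfolding nn_integral_dsum_ext[OF u ns] by (intro tendsto_ennrealI limit_value_tendsto u ns)
qed

text \<open>Homogeneity turns the normalisation into the power - s of \<open>\<sigma> 1\<close>,
  where s is the sum of the parts plus \<theta>; the Gamma integral expresses it by exponentials.
  The last integral over u converges because of the assumption on t, which for two parts and
  \<theta> = - \<alpha> - \<gamma> says \<gamma> < \<alpha>.\<close>

lemma nn_integral_dsum_normalised:
  assumes ns: "\<forall>m\<in>set ns. Suc 0 \<le> m" and s: "0 < real (sum_list ns) + \<theta>" and t: "0 < real (length ns) * \<alpha> + \<theta>"
  shows "(\<integral>\<^sup>+\<omega>. dsum (\<lambda>i. rj \<omega> i / \<sigma> 1 \<omega>) ns * ennreal (\<sigma> 1 \<omega> powr (- \<theta>)) \<partial>M) =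
    ennreal (\<alpha> ^ length ns * (\<Prod>n\<leftarrow>ns. rising \<alpha> n) * (Gamma (real (length ns) + \<theta> / \<alpha>) / \<alpha>) / Gamma (real (sum_list ns) + \<theta>))"
proof -
  let ?n = "sum_list ns" and ?k = "length ns"
  define s where "s = real ?n + \<theta>"
  define t where "t = real ?k * \<alpha> + \<theta>"
  have s0: "0 < s" and t0: "0 < t" using assms by (simp_all add: s_def t_def)
  have G: "0 < Gamma s" using s0 by (rule Gamma_real_pos)
  note [measurable] = measurable_dsum_rj[OF ns]
  define c where "c = \<alpha> ^ ?k * (\<Prod>n\<leftarrow>ns. rising \<alpha> n)"
  have c0: "0 \<le> c"
  proof -
    have "0 \<le> (\<Prod>n\<leftarrow>ns. rising \<alpha> n)" using rising_pos[OF alpha(2)] by (induction ns) (auto simp: less_imp_le)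
    then show ?thesis using alpha by (simp add: c_def)
  qed
  have "(\<integral>\<^sup>+\<omega>. dsum (\<lambda>i. rj \<omega> i / \<sigma> 1 \<omega>) ns * ennreal (\<sigma> 1 \<omega> powr (- \<theta>)) \<partial>M) =
     (\<integral>\<^sup>+\<omega>. (\<integral>\<^sup>+u. ennreal (1 / Gamma s) * (dsum (rj \<omega>) ns * ennreal (indicator {0..} u * u powr (s - 1) * exp (- (u * \<sigma> 1 \<omega>)))) \<partial>lborel) \<partial>M)"
  proof (intro nn_integral_cong_AE)
    show "AE \<omega> in M. dsum (\<lambda>i. rj \<omega> i / \<sigma> 1 \<omega>) ns * ennreal (\<sigma> 1 \<omega> powr (- \<theta>)) =
      (\<integral>\<^sup>+u. ennreal (1 / Gamma s) * (dsum (rj \<omega>) ns * ennreal (indicator {0..} u * u powr (s - 1) * exp (- (u * \<sigma> 1 \<omega>)))) \<partial>lborel)"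
      using sigma_pos AE_space
    proof eventually_elim
      case (elim \<omega>)
      have "dsum (\<lambda>i. rj \<omega> i / \<sigma> 1 \<omega>) ns = ennreal ((1 / \<sigma> 1 \<omega>) ^ ?n) * dsum (rj \<omega>) ns"
        using dsum_scale[of "1 / \<sigma> 1 \<omega>" "rj \<omega>" ns] elim rj_facts(1)[OF elim(2)] by simp
      moreover have "ennreal ((1 / \<sigma> 1 \<omega>) ^ ?n) * ennreal (\<sigma> 1 \<omega> powr (- \<theta>)) = ennreal (\<sigma> 1 \<omega> powr (- s))"
      proof -
        have "(1 / \<sigma> 1 \<omega>) ^ ?n = \<sigma> 1 \<omega> powr (- real ?n)"
          using elim by (simp add: powr_minus powr_realpow power_one_over inverse_eq_divide)
        then show ?thesis using elim by (simp add: ennreal_mult'[symmetric] powr_add[symmetric] s_def)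
      qed
      ultimately have 1: "dsum (\<lambda>i. rj \<omega> i / \<sigma> 1 \<omega>) ns * ennreal (\<sigma> 1 \<omega> powr (- \<theta>)) = dsum (rj \<omega>) ns * ennreal (\<sigma> 1 \<omega> powr (- s))"
      proof -
        assume a: "dsum (\<lambda>i. rj \<omega> i / \<sigma> 1 \<omega>) ns = ennreal ((1 / \<sigma> 1 \<omega>) ^ ?n) * dsum (rj \<omega>) ns"
          and b: "ennreal ((1 / \<sigma> 1 \<omega>) ^ ?n) * ennreal (\<sigma> 1 \<omega> powr (- \<theta>)) = ennreal (\<sigma> 1 \<omega> powr (- s))"
        show ?thesis unfolding a b[symmetric] by (simp only: mult_ac)
      qed
      have "(\<integral>\<^sup>+u. ennreal (1 / Gamma s) * (dsum (rj \<omega>) ns * ennreal (indicator {0..} u * u powr (s - 1) * exp (- (u * \<sigma> 1 \<omega>)))) \<partial>lborel) =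
         ennreal (1 / Gamma s) * (dsum (rj \<omega>) ns * ennreal (Gamma s * \<sigma> 1 \<omega> powr (- s)))"
        using nn_integral_Gamma_scaled[OF s0 elim(1)] by (simp add: nn_integral_cmult)
      also have "\<dots> = dsum (rj \<omega>) ns * (ennreal (1 / Gamma s) * ennreal (Gamma s * \<sigma> 1 \<omega> powr (- s)))"
        by (simp only: mult_ac)
      also have "ennreal (1 / Gamma s) * ennreal (Gamma s * \<sigma> 1 \<omega> powr (- s)) = ennreal (\<sigma> 1 \<omega> powr (- s))"
        using G by (simp add: ennreal_mult'[symmetric])
      finally show ?case using 1 by simp
    qed
  qed
  also have "\<dots> = (\<integral>\<^sup>+u. (\<integral>\<^sup>+\<omega>. ennreal (1 / Gamma s) * (dsum (rj \<omega>) ns * ennreal (indicator {0..} u * u powr (s - 1) * exp (- (u * \<sigma> 1 \<omega>)))) \<partial>M) \<partial>lborel)"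
  \<comment> \<open>Nonnegativity of the integrand makes Fubini free of integrability
    conditions.\<close>
  proof -
    interpret P: pair_sigma_finite lborel M ..
    show ?thesis by (rule P.Fubini') measurable
  qed
  also have "\<dots> = (\<integral>\<^sup>+u. ennreal (c / Gamma s) * ennreal (indicator {0<..} u * (u powr (t - 1) * exp (- (u powr \<alpha>)))) \<partial>lborel)"
  proof (intro nn_integral_cong)
    fix u :: real
    have "(\<integral>\<^sup>+\<omega>. ennreal (1 / Gamma s) * (dsum (rj \<omega>) ns * ennreal (indicator {0..} u * u powr (s - 1) * exp (- (u * \<sigma> 1 \<omega>)))) \<partial>M) =
       (\<integral>\<^sup>+\<omega>. ennreal (1 / Gamma s * (indicator {0..} u * u powr (s - 1))) * (dsum (rj \<omega>) ns * ennreal (exp (- (u * \<sigma> 1 \<omega>)))) \<partial>M)"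
    proof (intro nn_integral_cong)
      fix \<omega>
      have 1: "ennreal (indicator {0..} u * u powr (s - 1) * exp (- (u * \<sigma> 1 \<omega>))) =
          ennreal (indicator {0..} u * u powr (s - 1)) * ennreal (exp (- (u * \<sigma> 1 \<omega>)))"
        by (rule ennreal_mult'') simp
      have 2: "ennreal (1 / Gamma s * (indicator {0..} u * u powr (s - 1))) = ennreal (1 / Gamma s) * ennreal (indicator {0..} u * u powr (s - 1))"
        using G by (intro ennreal_mult') simp
      show "ennreal (1 / Gamma s) * (dsum (rj \<omega>) ns * ennreal (indicator {0..} u * u powr (s - 1) * exp (- (u * \<sigma> 1 \<omega>)))) =
        ennreal (1 / Gamma s * (indicator {0..} u * u powr (s - 1))) * (dsum (rj \<omega>) ns * ennreal (exp (- (u * \<sigma> 1 \<omega>))))"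
        unfolding 1 2 by (simp only: mult_ac)
    qed
    also have "\<dots> = ennreal (1 / Gamma s * (indicator {0..} u * u powr (s - 1))) * (\<integral>\<^sup>+\<omega>. dsum (rj \<omega>) ns * ennreal (exp (- (u * \<sigma> 1 \<omega>))) \<partial>M)"
      by (rule nn_integral_cmult) measurable
    also have "\<dots> = ennreal (c / Gamma s) * ennreal (indicator {0<..} u * (u powr (t - 1) * exp (- (u powr \<alpha>))))"
    proof (cases "0 < u")
      case True
      have "(\<Prod>j<?k. \<alpha> * rising \<alpha> (ns ! j) * u powr (\<alpha> - real (ns ! j))) = c * u powr (real ?k * \<alpha> - real ?n)"
      proof -
        have "(\<Prod>n\<leftarrow>ns. \<alpha> * rising \<alpha> n * u powr (\<alpha> - real n)) = \<alpha> ^ length ns * (\<Prod>n\<leftarrow>ns. rising \<alpha> n) * u powr (real (length ns) * \<alpha> - real (sum_list ns))" for ns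
        proof (induction ns)
          case (Cons n ns)
          have "u powr (\<alpha> - real n) * u powr (real (length ns) * \<alpha> - real (sum_list ns)) = u powr (real (length (n # ns)) * \<alpha> - real (sum_list (n # ns)))"
            by (simp add: powr_add[symmetric] algebra_simps)
          then show ?case using Cons by (simp add: mult_ac)
        qed (use True in simp)
        then show ?thesis by (simp add: c_def prod.list_conv_set_nth atLeast0LessThan)
      qed
      then have "limit_value ns u = c * u powr (real ?k * \<alpha> - real ?n) * exp (- (u powr \<alpha>))"
        by (simp add: limit_value_def)
      moreover have "u powr (s - 1) * u powr (real ?k * \<alpha> - real ?n) = u powr (t - 1)"
        by (simp add: powr_add[symmetric] s_def t_def algebra_simps)
      ultimately have "1 / Gamma s * u powr (s - 1) * limit_value ns u = c / Gamma s * (u powr (t - 1) * exp (- (u powr \<alpha>)))"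
        by (simp add: mult_ac)
      note eq = this
      have "ennreal (1 / Gamma s * u powr (s - 1)) * ennreal (limit_value ns u) =
        ennreal (c / Gamma s) * ennreal (u powr (t - 1) * exp (- (u powr \<alpha>)))"
        using arg_cong[OF eq, of ennreal] G c0 by (simp only: ennreal_mult' divide_nonneg_pos mult_nonneg_nonneg powr_ge_zero zero_le_one exp_ge_zero)
      then show ?thesis unfolding nn_integral_dsum_rj[OF True ns] using True by simp
    next
      case False
      then show ?thesis by (cases "u = 0") auto
    qed
    finally show "(\<integral>\<^sup>+\<omega>. ennreal (1 / Gamma s) * (dsum (rj \<omega>) ns * ennreal (indicator {0..} u * u powr (s - 1) * exp (- (u * \<sigma> 1 \<omega>)))) \<partial>M) =
      ennreal (c / Gamma s) * ennreal (indicator {0<..} u * (u powr (t - 1) * exp (- (u powr \<alpha>))))" .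
  qed
  also have "\<dots> = ennreal (c / Gamma s) * ennreal (Gamma (t / \<alpha>) / \<alpha>)"
    by (subst nn_integral_cmult) (simp_all add: nn_integral_stretched_exp[OF t0 alpha(1)])
  also have "\<dots> = ennreal (c * (Gamma (t / \<alpha>) / \<alpha>) / Gamma s)"
    using c0 G by (simp add: ennreal_mult'[symmetric] mult.commute)
  also have "t / \<alpha> = real ?k + \<theta> / \<alpha>" using alpha by (simp add: t_def add_divide_distrib)
  finally show ?thesis by (simp add: c_def s_def)
qed

end

section \<open>Mass partitions\<close>

lemma space_S_down: "space S_down_space = S_down"
  by (simp add: S_down_space_def space_restrict_space space_PiM)

lemma measurable_S_down_component: "(\<lambda>s. s i) \<in> borel_measurable S_down_space"
  unfolding S_down_space_def by (intro measurable_restrict_space1) simp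

lemma measurable_into_S_down:
  assumes "\<And>i. (\<lambda>\<omega>. f \<omega> i) \<in> borel_measurable N" "\<And>\<omega>. \<omega> \<in> space N \<Longrightarrow> f \<omega> \<in> S_down"
  shows "f \<in> measurable N S_down_space"
  unfolding S_down_space_def using assms
  by (intro measurable_restrict_space2 measurable_abs_UNIV[of "\<lambda>n \<omega>. f \<omega> n"]) auto

definition power_sums :: "(nat \<Rightarrow> real) \<Rightarrow> nat \<Rightarrow> real" where
  "power_sums s n = (\<Sum>i. s i ^ n)"

lemma measurable_power_sums [measurable]: "(\<lambda>s. power_sums s n) \<in> borel_measurable S_down_space"
  unfolding power_sums_def
  by (intro borel_measurable_suminf borel_measurable_power measurable_S_down_component)

lemma sets_proper: "{s \<in> space S_down_space. suminf s = 1 \<and> s 0 < 1} \<in> sets S_down_space"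
proof -
  define first :: "(nat \<Rightarrow> real) \<Rightarrow> real" where "first s = s 0" for s
  have [measurable]: "first \<in> borel_measurable S_down_space"
    unfolding first_def[abs_def] by (rule measurable_S_down_component)
  have "{s \<in> space S_down_space. power_sums s 1 = 1 \<and> first s < 1} \<in> sets S_down_space" by measurable
  then show ?thesis by (simp add: power_sums_def first_def)
qed

lemma S_down_facts:
  assumes "s \<in> S_down"
  shows "0 \<le> s i" "s i \<le> s 0" "s 0 \<le> 1" "1 \<le> n \<Longrightarrow> s i ^ n \<le> s i" "1 \<le> n \<Longrightarrow> summable (\<lambda>i. s i ^ n)" "summable s" "suminf s \<le> 1"
proof -
  show nn: "0 \<le> s i" for i using assms by (auto simp: S_down_def)
  show "summable s" "suminf s \<le> 1" using assms by (auto simp: S_down_def)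
  then have le1: "s i \<le> 1" for i
    using sum_le_suminf[of s "{i}"] nn by simp
  show "s 0 \<le> 1" by (rule le1)
  show "s i \<le> s 0" using assms by (auto simp: S_down_def decseq_def)
  show le: "s i ^ n \<le> s i" if "1 \<le> n" for i n
  proof -
    have "s i ^ n = s i ^ (n - 1) * s i" using that by (metis power_minus_mult Suc_le_eq One_nat_def)
    also have "\<dots> \<le> 1 * s i" using nn le1 by (intro mult_right_mono power_le_one) auto
    finally show ?thesis by simp
  qed
  show "summable (\<lambda>i. s i ^ n)" if "1 \<le> n"
    by (rule summable_comparison_test'[OF \<open>summable s\<close>, of 0]) (use le[OF that] nn in auto)
qed

lemma dsum_S_down:
  assumes "s \<in> S_down" "\<forall>m\<in>set ns. Suc 0 \<le> m"
  shows "dsum s ns = ennreal (power_sum_poly (power_sums s) ns)" "0 \<le> power_sum_poly (power_sums s) ns"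
  using dsum_eq_power_sum_poly[of s "power_sums s" ns] S_down_facts[OF assms(1)] assms(2)
  by (auto simp: power_sums_def)

lemma measurable_power_sum_poly_S_down [measurable]:
  "(\<lambda>s. power_sum_poly (power_sums s) ns) \<in> borel_measurable S_down_space"
  by (rule measurable_power_sum_poly) measurable

lemma measurable_dsum_S_down:
  assumes "\<forall>m\<in>set ns. Suc 0 \<le> m"
  shows "(\<lambda>s. dsum s ns) \<in> borel_measurable S_down_space"
proof -
  have "(\<lambda>s. ennreal (power_sum_poly (power_sums s) ns)) \<in> borel_measurable S_down_space" by measurable
  then show ?thesis
    by (rule measurable_cong[THEN iffD1, rotated]) (simp add: dsum_S_down[OF _ assms] space_S_down)
qed

text \<open>The sum over all pairs, which factorises, minus the diagonal.\<close>

lemma infsum_distinct_pairs: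
  assumes "s \<in> S_down"
  shows "(\<Sum>\<^sub>\<infinity>(i, j)\<in>{(i, j). i \<noteq> j}. s i * s j) = (power_sums s 1)\<^sup>2 - power_sums s 2"
proof -
  note s = S_down_facts[OF assms]
  let ?f = "\<lambda>(i, j). s i * s j"
  have sum_s: "infsum s UNIV = suminf s" "s summable_on UNIV"
    using norm_summable_imp_has_sum[of s "suminf s"] s by (auto simp: infsumI has_sum_imp_summable summable_sums)
  have f: "?f summable_on UNIV"
  proof (rule nonneg_bdd_above_summable_on)
    show "bdd_above (sum ?f ` {F. F \<subseteq> UNIV \<and> finite F})"
    proof (rule bdd_aboveI2)
      fix F :: "(nat \<times> nat) set" assume "F \<in> {F. F \<subseteq> UNIV \<and> finite F}"
      then have F: "finite F" by simp
      have "sum ?f F \<le> sum ?f (fst ` F \<times> snd ` F)"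
        using F s(1) by (intro sum_mono2) (auto intro: rev_image_eqI)
      also have "\<dots> = sum s (fst ` F) * sum s (snd ` F)" by (simp add: sum_product sum.cartesian_product)
      also have "\<dots> \<le> 1 * 1"
        using F s by (intro mult_mono order_trans[OF sum_le_suminf]) (auto intro: sum_nonneg)
      finally show "sum ?f F \<le> 1" by simp
    qed
  qed (use s(1) in auto)
  have "infsum ?f UNIV = (\<Sum>\<^sub>\<infinity>i. \<Sum>\<^sub>\<infinity>j. s i * s j)"
    using infsum_Sigma_banach[of ?f UNIV "\<lambda>_. UNIV"] f by simp
  also have "\<dots> = (suminf s)\<^sup>2"
    using sum_s by (simp add: infsum_cmult_right infsum_cmult_left power2_eq_square)
  finally have total: "infsum ?f UNIV = (suminf s)\<^sup>2" .
  have sq: "(\<lambda>i. (s i)\<^sup>2) summable_on UNIV" "infsum (\<lambda>i. (s i)\<^sup>2) UNIV = power_sums s 2"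
    using norm_summable_imp_has_sum[of "\<lambda>i. (s i)\<^sup>2" "power_sums s 2"] s(5)[of 2]
    by (auto simp: power_sums_def infsumI has_sum_imp_summable summable_sums)
  have diag: "infsum ?f (range (\<lambda>i. (i, i))) = power_sums s 2"
    using infsum_reindex[of "\<lambda>i :: nat. (i, i)" UNIV ?f] sq by (simp add: inj_on_def comp_def power2_eq_square)
  have "infsum ?f UNIV = infsum ?f {(i, j). i \<noteq> j} + infsum ?f (range (\<lambda>i. (i, i)))"
  proof -
    have "UNIV = {(i, j). i \<noteq> j} \<union> range (\<lambda>i :: nat. (i, i))" by auto
    then have "infsum ?f UNIV = infsum ?f ({(i, j). i \<noteq> j} \<union> range (\<lambda>i. (i, i)))" by simp
    also have "\<dots> = infsum ?f {(i, j). i \<noteq> j} + infsum ?f (range (\<lambda>i. (i, i)))"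
      by (intro infsum_Un_disjoint summable_on_subset_banach[OF f]) auto
    finally show ?thesis .
  qed
  then show ?thesis using total diag by (simp add: power_sums_def)
qed

section \<open>The measures PD*\<close>

text \<open>The exchangeable partition probability function of the two-parameter family with
  parameters \<alpha> and - \<alpha> - \<gamma>, stripped of all factors that depend neither on the
  parts nor on their number.\<close>

definition pd_moment :: "real \<Rightarrow> real \<Rightarrow> nat list \<Rightarrow> real" where
  "pd_moment \<alpha> \<gamma> ns = block_coeff \<alpha> \<gamma> (length ns) * (\<Prod>n\<leftarrow>ns. rising \<alpha> n) / Gamma (real (sum_list ns) - \<alpha> - \<gamma>)"

definition valid_parts :: "nat list \<Rightarrow> bool" where
  "valid_parts ns \<longleftrightarrow> 2 \<le> length ns \<and> (\<forall>m\<in>set ns. Suc 0 \<le> m)"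

lemma valid_parts_sum: "valid_parts ns \<Longrightarrow> 2 \<le> sum_list ns"
proof -
  have "length ns \<le> sum_list ns" if "\<forall>m\<in>set ns. Suc 0 \<le> m" using that by (induction ns) auto
  then show "valid_parts ns \<Longrightarrow> 2 \<le> sum_list ns" by (auto simp: valid_parts_def)
qed

text \<open>What the representation requires of PD*, in the binary and in the stable case alike.
  Only lists of at least two parts appear: the measures have infinite mass, concentrated near the
  sequence (1, 0, 0, ...).\<close>

locale pd_like =
  fixes \<alpha> \<gamma> A :: real and P :: "(nat \<Rightarrow> real) measure"
  assumes sets_P: "sets P = sets S_down_space"
    and proper_P: "AE s in P. suminf s = 1 \<and> s 0 < 1"
    and A_pos: "0 < A"
    and moments: "valid_parts ns \<Longrightarrow> (\<integral>\<^sup>+s. dsum s ns \<partial>P) = ennreal (A * pd_moment \<alpha> \<gamma> ns)"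

lemma Gamma_rising:
  assumes "\<alpha> < 1" "1 \<le> n"
  shows "Gamma (real n - \<alpha>) = Gamma (1 - \<alpha>) * rising \<alpha> n"
  using assms(2)
proof (induction n rule: dec_induct)
  case (step n)
  have "Gamma (real n - \<alpha> + 1) = (real n - \<alpha>) * Gamma (real n - \<alpha>)"
    using step assms by (intro Gamma_plus1) (auto elim!: nonpos_Ints_cases)
  then show ?case using step by (simp add: rising_Suc algebra_simps)
qed simp

text \<open>The Beta integral folded at 1/2 by x to 1 - x, since ranked two-block sequences have
  their larger block in [1/2, 1].\<close>

lemma nn_integral_Beta_half:
  assumes "0 < a" "0 < (b :: real)"
  shows "(\<integral>\<^sup>+x. ennreal (indicator {1/2..1} x * (x powr (a - 1) * (1 - x) powr (b - 1) + x powr (b - 1) * (1 - x) powr (a - 1))) \<partial>lborel) = ennreal (Beta a b)"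
proof -
  define h where "h x = x powr (a - 1) * (1 - x) powr (b - 1)" for x :: real
  have [measurable]: "h \<in> borel_measurable borel" unfolding h_def by measurable
  have h0: "0 \<le> h x" for x by (simp add: h_def)
  have "ennreal (Beta a b) = (\<integral>\<^sup>+x. ennreal (indicator {0..1} x * h x) \<partial>lborel)"
    using nn_integral_has_integral_lebesgue[OF _ has_integral_Beta_real[OF assms]] by (simp add: h_def)
  also have "\<dots> = (\<integral>\<^sup>+x. ennreal (indicator {1/2..1} x * h x) + ennreal (indicator {0..<1/2} x * h x) \<partial>lborel)"
    by (intro nn_integral_cong) (auto simp: indicator_def)
  also have "\<dots> = (\<integral>\<^sup>+x. ennreal (indicator {1/2..1} x * h x) \<partial>lborel) + (\<integral>\<^sup>+x. ennreal (indicator {0..<1/2} x * h x) \<partial>lborel)"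
    by (rule nn_integral_add) measurable
  also have "(\<integral>\<^sup>+x. ennreal (indicator {0..<1/2} x * h x) \<partial>lborel) = (\<integral>\<^sup>+x. ennreal (indicator {0..<1/2} (1 - x) * h (1 - x)) \<partial>lborel)"
    using nn_integral_real_affine[of "\<lambda>x. ennreal (indicator {0..<1/2} x * h x)" "-1" 1] by simp
  also have "\<dots> = (\<integral>\<^sup>+x. ennreal (indicator {1/2..1} x * h (1 - x)) \<partial>lborel)"
  proof (rule nn_integral_cong_AE)
    have "AE x in lborel. x \<noteq> (1/2 :: real)" by (rule AE_lborel_singleton)
    then show "AE x in lborel. ennreal (indicator {0..<1/2} (1 - x) * h (1 - x)) = ennreal (indicator {1/2..1} x * h (1 - x))"
      by eventually_elim (auto simp: indicator_def)
  qed
  also have "(\<integral>\<^sup>+x. ennreal (indicator {1/2..1} x * h x) \<partial>lborel) + \<dots> =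
      (\<integral>\<^sup>+x. ennreal (indicator {1/2..1} x * h x) + ennreal (indicator {1/2..1} x * h (1 - x)) \<partial>lborel)"
    by (rule nn_integral_add[symmetric]) measurable
  also have "\<dots> = (\<integral>\<^sup>+x. ennreal (indicator {1/2..1} x * (x powr (a - 1) * (1 - x) powr (b - 1) + x powr (b - 1) * (1 - x) powr (a - 1))) \<partial>lborel)"
    by (intro nn_integral_cong) (auto simp: indicator_def h_def mult.commute ennreal_plus[symmetric] simp del: ennreal_plus)
  finally show ?thesis by simp
qed

section \<open>The binary case and the stable case\<close>

definition two_blocks :: "real \<Rightarrow> nat \<Rightarrow> real" where
  "two_blocks x i = (if i = 0 then x else if i = 1 then 1 - x else 0)"

lemma sums_two_blocks: "1 \<le> n \<Longrightarrow> (\<lambda>i. two_blocks x i ^ n) sums (x ^ n + (1 - x) ^ n)"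
proof -
  assume "1 \<le> n"
  then have "(\<lambda>i. two_blocks x i ^ n) sums (\<Sum>i\<in>{0, 1}. two_blocks x i ^ n)"
    by (intro sums_finite) (auto simp: two_blocks_def)
  then show ?thesis by (simp add: two_blocks_def)
qed

lemma two_blocks_S_down: "1/2 \<le> x \<Longrightarrow> x \<le> 1 \<Longrightarrow> two_blocks x \<in> S_down"
proof -
  assume x: "1/2 \<le> x" "x \<le> 1"
  then have "decseq (two_blocks x)" "\<forall>i. 0 \<le> two_blocks x i" by (auto simp: decseq_def two_blocks_def)
  then show ?thesis using sums_two_blocks[of 1 x] by (simp add: S_down_def sums_iff)
qed

lemma dsum_two_blocks_2:
  assumes "1/2 \<le> x" "x \<le> 1" "1 \<le> m" "1 \<le> n"
  shows "dsum (two_blocks x) [m, n] = ennreal (x ^ m * (1 - x) ^ n + x ^ n * (1 - x) ^ m)"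
proof -
  have p: "power_sums (two_blocks x) k = x ^ k + (1 - x) ^ k" if "1 \<le> k" for k
    using sums_two_blocks[OF that, of x] by (simp add: power_sums_def sums_iff)
  show ?thesis using dsum_S_down[OF two_blocks_S_down[OF assms(1,2)], of "[m, n]"] assms
    by (simp add: p power_add algebra_simps)
qed

lemma dsum_two_blocks_3:
  assumes "3 \<le> length ns" "\<forall>m\<in>set ns. Suc 0 \<le> m"
  shows "dsum (two_blocks x) ns = 0"
  unfolding dsum_def
proof (rule infsum_0)
  fix "is" :: "nat list" assume "is": "is \<in> {is. length is = length ns \<and> distinct is}"
  have "\<not> set is \<subseteq> {0, 1}"
  proof
    assume "set is \<subseteq> {0, 1}"
    then have "card (set is) \<le> card {0, 1 :: nat}" by (intro card_mono) auto
    then show False using "is" assms(1) by (simp add: distinct_card)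
  qed
  then obtain i where "i \<in> set is" "i \<noteq> 0" "i \<noteq> 1" by blast
  then obtain j where j: "j < length ns" "is ! j \<noteq> 0" "is ! j \<noteq> 1" using "is" by (auto simp: in_set_conv_nth)
  moreover have "ns ! j \<noteq> 0" using assms(2) nth_mem[OF j(1)] by auto
  ultimately show "(\<Prod>j<length ns. ennreal (two_blocks x (is ! j) ^ (ns ! j))) = 0"
    by (intro prod_zero) (auto intro!: bexI[of _ j] simp: two_blocks_def)
qed

text \<open>For two parts the moment is Beta (m - \<alpha>) (n - \<alpha>), and
  \<open>Gamma_rising\<close> extracts the square of Gamma (1 - \<alpha>). For three or more parts
  both sides vanish: two blocks admit no three distinct indices, and \<open>block_coeff\<close>
  contains the factor \<alpha> - \<alpha>.\<close>

lemma pd_like_binary: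
  fixes M :: "'a measure"
  assumes \<alpha>: "0 \<le> \<alpha>" "\<alpha> < 1"
  shows "pd_like \<alpha> \<alpha> ((Gamma (1 - \<alpha>))\<^sup>2) (PD_star \<alpha> (- \<alpha> - \<alpha>) M \<sigma>)"
proof
  define g where "g x = x powr (- \<alpha> - 1) * (1 - x) powr (- \<alpha> - 1)" for x :: real
  define N where "N = restrict_space lborel {1/2..1::real}"
  define D where "D = density N (\<lambda>x. ennreal (g x))"
  have [measurable]: "g \<in> borel_measurable borel" unfolding g_def by measurable
  have PD: "PD_star \<alpha> (- \<alpha> - \<alpha>) M \<sigma> = distr D S_down_space two_blocks"
    by (simp add: PD_star_def D_def g_def N_def two_blocks_def[abs_def])
  have spaceN: "space N = {1/2..1}" "space D = {1/2..1}" by (simp_all add: D_def N_def space_restrict_space)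
  have gN[measurable]: "(\<lambda>x. ennreal (g x)) \<in> borel_measurable N"
    unfolding N_def by (rule measurable_restrict_space1) measurable
  have tb: "two_blocks \<in> measurable D S_down_space"
  proof (rule measurable_into_S_down)
    show "(\<lambda>x. two_blocks x i) \<in> borel_measurable D" for i
    proof -
      have "(\<lambda>x. two_blocks x i) \<in> borel_measurable lborel" unfolding two_blocks_def by measurable
      then have "(\<lambda>x. two_blocks x i) \<in> borel_measurable N" unfolding N_def by (rule measurable_restrict_space1)
      then show ?thesis by (simp add: D_def measurable_density_eq1 measurable_def)
    qed
  qed (auto simp: spaceN two_blocks_S_down)
  show "sets (PD_star \<alpha> (- \<alpha> - \<alpha>) M \<sigma>) = sets S_down_space" unfolding PD by simp
  show "AE s in PD_star \<alpha> (- \<alpha> - \<alpha>) M \<sigma>. suminf s = 1 \<and> s 0 < 1"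
  proof -
    have "AE x in D. suminf (two_blocks x) = 1 \<and> two_blocks x 0 < 1"
    proof -
      have "AE x in N. 0 < ennreal (g x) \<longrightarrow> suminf (two_blocks x) = 1 \<and> two_blocks x 0 < 1"
      proof (rule AE_I2, rule impI)
        fix x assume x: "x \<in> space N" "0 < ennreal (g x)"
        then have "x \<noteq> 1" by (auto simp: g_def)
        moreover have "suminf (two_blocks x) = 1" using sums_two_blocks[of 1 x] by (simp add: sums_iff)
        ultimately show "suminf (two_blocks x) = 1 \<and> two_blocks x 0 < 1"
          using x by (simp add: spaceN two_blocks_def)
      qed
      then show ?thesis unfolding D_def by (subst AE_density[OF gN])
    qed
    then show ?thesis unfolding PD by (subst AE_distr_iff[OF tb sets_proper])
  qed
  show "0 < (Gamma (1 - \<alpha>))\<^sup>2" using \<alpha> by (intro zero_less_power Gamma_real_pos) simp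
  fix ns assume ns: "valid_parts ns"
  have ns1: "\<forall>m\<in>set ns. Suc 0 \<le> m" "2 \<le> length ns" using ns by (auto simp: valid_parts_def)
  have "(\<integral>\<^sup>+s. dsum s ns \<partial>PD_star \<alpha> (- \<alpha> - \<alpha>) M \<sigma>) = (\<integral>\<^sup>+x. dsum (two_blocks x) ns \<partial>D)"
    unfolding PD by (rule nn_integral_distr[OF tb]) (simp add: measurable_dsum_S_down[OF ns1(1)])
  also have "\<dots> = (\<integral>\<^sup>+x. ennreal (g x) * dsum (two_blocks x) ns \<partial>N)"
  proof -
    have "(\<lambda>x. dsum (two_blocks x) ns) \<in> borel_measurable D"
      by (rule measurable_compose[OF tb measurable_dsum_S_down[OF ns1(1)]])
    then have "(\<lambda>x. dsum (two_blocks x) ns) \<in> borel_measurable N" by (simp add: D_def measurable_def)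
    then show ?thesis unfolding D_def by (rule nn_integral_density[OF gN])
  qed
  also have "\<dots> = (\<integral>\<^sup>+x. (ennreal (g x) * dsum (two_blocks x) ns) * indicator {1/2..1} x \<partial>lborel)"
    unfolding N_def by (rule nn_integral_restrict_space) simp
  also have "\<dots> = ennreal ((Gamma (1 - \<alpha>))\<^sup>2 * pd_moment \<alpha> \<alpha> ns)"
  proof (cases "length ns = 2")
    case True
    then obtain m n where mn: "ns = [m, n]" by (metis (no_types, opaque_lifting) One_nat_def Suc_1 Suc_length_conv length_0_conv)
    have 1: "1 \<le> m" "1 \<le> n" using ns1 mn by auto
    have "(\<integral>\<^sup>+x. (ennreal (g x) * dsum (two_blocks x) ns) * indicator {1/2..1} x \<partial>lborel) =
       (\<integral>\<^sup>+x. ennreal (indicator {1/2..1} x * (x powr (real m - \<alpha> - 1) * (1 - x) powr (real n - \<alpha> - 1) + x powr (real n - \<alpha> - 1) * (1 - x) powr (real m - \<alpha> - 1))) \<partial>lborel)"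
    proof (rule nn_integral_cong_AE)
      have "AE x in lborel. x \<noteq> (1 :: real)" by (rule AE_lborel_singleton)
      then show "AE x in lborel. (ennreal (g x) * dsum (two_blocks x) ns) * indicator {1/2..1} x = 
         ennreal (indicator {1/2..1} x * (x powr (real m - \<alpha> - 1) * (1 - x) powr (real n - \<alpha> - 1) + x powr (real n - \<alpha> - 1) * (1 - x) powr (real m - \<alpha> - 1)))"
      proof eventually_elim
        case (elim x)
        show ?case
        proof (cases "x \<in> {1/2..1}")
          case True
          then have x: "1/2 \<le> x" "x \<le> 1" "0 < x" "0 < 1 - x" using elim by auto
          have pw: "y powr (- \<alpha> - 1) * y ^ k = y powr (real k - \<alpha> - 1)" if "0 < y" for y k
            using that by (simp add: powr_realpow[symmetric] powr_add[symmetric] algebra_simps)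
          have "g x * (x ^ m * (1 - x) ^ n + x ^ n * (1 - x) ^ m) =
             (x powr (- \<alpha> - 1) * x ^ m) * ((1 - x) powr (- \<alpha> - 1) * (1 - x) ^ n) + (x powr (- \<alpha> - 1) * x ^ n) * ((1 - x) powr (- \<alpha> - 1) * (1 - x) ^ m)"
            by (simp add: g_def algebra_simps)
          also have "\<dots> = x powr (real m - \<alpha> - 1) * (1 - x) powr (real n - \<alpha> - 1) + x powr (real n - \<alpha> - 1) * (1 - x) powr (real m - \<alpha> - 1)"
            unfolding pw[OF x(3)] pw[OF x(4)] ..
          finally have "g x * (x ^ m * (1 - x) ^ n + x ^ n * (1 - x) ^ m) = \<dots>" .
          moreover have "ennreal (g x) * ennreal (x ^ m * (1 - x) ^ n + x ^ n * (1 - x) ^ m) =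
              ennreal (g x * (x ^ m * (1 - x) ^ n + x ^ n * (1 - x) ^ m))"
            by (rule ennreal_mult'[symmetric]) (simp add: g_def)
          ultimately show ?thesis using True
            unfolding mn dsum_two_blocks_2[OF x(1,2) 1] by (simp only: indicator_simps mult_1_left mult_1_right)
        qed simp
      qed
    qed
    also have "\<dots> = ennreal (Beta (real m - \<alpha>) (real n - \<alpha>))"
      using nn_integral_Beta_half[of "real m - \<alpha>" "real n - \<alpha>"] 1 \<alpha> by simp
    also have "Beta (real m - \<alpha>) (real n - \<alpha>) = (Gamma (1 - \<alpha>))\<^sup>2 * pd_moment \<alpha> \<alpha> ns"
      unfolding Beta_def Gamma_rising[OF \<alpha>(2) 1(1)] Gamma_rising[OF \<alpha>(2) 1(2)]
      by (simp add: pd_moment_def mn power2_eq_square algebra_simps numeral_2_eq_2[symmetric])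
    finally show ?thesis .
  next
    case False
    then have k: "3 \<le> length ns" using ns1 by simp
    then have "block_coeff \<alpha> \<alpha> (length ns) = 0"
      unfolding block_coeff_def by (intro prod_zero) (auto intro!: bexI[of _ 2])
    then show ?thesis using dsum_two_blocks_3[OF k ns1(1)] by (simp add: pd_moment_def)
  qed
  finally show "(\<integral>\<^sup>+s. dsum s ns \<partial>PD_star \<alpha> (- \<alpha> - \<alpha>) M \<sigma>) = ennreal ((Gamma (1 - \<alpha>))\<^sup>2 * pd_moment \<alpha> \<alpha> ns)" .
qed

text \<open>The functional equation of Gamma with \<alpha> (k - 1 - \<gamma> / \<alpha>) = (k - 1)
  \<alpha> - \<gamma>. It converts the Gamma value left by the stretched exponential into branch
  point weights and yields the constant of the stable case.\<close>

lemma Gamma_block_coeff: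
  assumes "0 < \<alpha>" "\<gamma> < \<alpha>" "2 \<le> k"
  shows "\<alpha> ^ (k - 1) * Gamma (real k - 1 - \<gamma> / \<alpha>) = \<alpha> * Gamma (1 - \<gamma> / \<alpha>) * block_coeff \<alpha> \<gamma> k"
  using assms(3)
proof (induction k rule: dec_induct)
  case (step k)
  have z: "0 < real k - 1 - \<gamma> / \<alpha>"
  proof -
    have "\<gamma> / \<alpha> < 1" using assms by (simp add: divide_less_eq)
    then show ?thesis using step by simp
  qed
  have "Gamma (real k - 1 - \<gamma> / \<alpha> + 1) = (real k - 1 - \<gamma> / \<alpha>) * Gamma (real k - 1 - \<gamma> / \<alpha>)"
    using z by (intro Gamma_plus1) (auto elim!: nonpos_Ints_cases)
  moreover have "\<alpha> ^ (Suc k - 1) = \<alpha> ^ (k - 1) * \<alpha>" using step by (metis One_nat_def Suc_diff_1 Suc_le_eq diff_Suc_1 power_Suc2 less_le_trans pos2)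
  ultimately have "\<alpha> ^ (Suc k - 1) * Gamma (real (Suc k) - 1 - \<gamma> / \<alpha>) = 
      (\<alpha> ^ (k - 1) * Gamma (real k - 1 - \<gamma> / \<alpha>)) * (\<alpha> * (real k - 1 - \<gamma> / \<alpha>))"
    by (simp add: add.commute[of _ 1] mult_ac)
  also have "\<alpha> * (real k - 1 - \<gamma> / \<alpha>) = (real k - 1) * \<alpha> - \<gamma>" using assms by (simp add: field_simps)
  finally show ?case using step by (simp add: block_coeff_Suc)
qed simp

lemma pd_like_stable:
  fixes M :: "'a measure"
  assumes stable: "stable_subordinator \<alpha> M \<sigma>" and \<alpha>: "\<alpha> < 1" "0 \<le> \<gamma>" "\<gamma> < \<alpha>"
  shows "pd_like \<alpha> \<gamma> (\<alpha> * Gamma (1 - \<gamma> / \<alpha>)) (PD_star \<alpha> (- \<alpha> - \<gamma>) M \<sigma>)"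
proof -
  interpret stable_process \<alpha> M \<sigma> using assms by unfold_locales auto
  define D where "D = density M (\<lambda>\<omega>. ennreal (\<sigma> 1 \<omega> powr (\<alpha> + \<gamma>)))"
  define X where "X \<omega> i = rj \<omega> i / \<sigma> 1 \<omega>" for \<omega> i
  have PD: "PD_star \<alpha> (- \<alpha> - \<gamma>) M \<sigma> = distr D S_down_space X"
    using \<alpha> by (simp add: PD_star_def D_def X_def[abs_def] rj_def add.commute)
  have [measurable]: "(\<lambda>\<omega>. X \<omega> i) \<in> borel_measurable M" for i unfolding X_def by measurable
  have XM: "X \<in> measurable M S_down_space"
  proof (rule measurable_into_S_down)
    fix \<omega> assume \<omega>: "\<omega> \<in> space M"
    have s0: "0 \<le> \<sigma> 1 \<omega>" using sigma_nonneg[OF \<omega>] by simp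
    have "(\<Sum>i. X \<omega> i) = (\<Sum>i. rj \<omega> i) / \<sigma> 1 \<omega>"
      unfolding X_def using rj_facts(3)[OF \<omega>] by (rule suminf_divide)
    \<comment> \<open>Where \<open>\<sigma> 1 \<omega>\<close> is 0, division by zero makes X the
      zero sequence, which still belongs to \<open>S_down\<close>.\<close>
    also have "\<dots> \<le> 1" using rj_facts(4)[OF \<omega>] s0 by (cases "\<sigma> 1 \<omega> = 0") (auto simp: divide_le_eq_1)
    finally have "(\<Sum>i. X \<omega> i) \<le> 1" .
    moreover have "summable (X \<omega>)" unfolding X_def[abs_def] using rj_facts(3)[OF \<omega>] by (rule summable_divide)
    moreover have "decseq (X \<omega>)" using rj_facts(2)[OF \<omega>] s0 by (auto simp: decseq_def X_def divide_right_mono)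
    moreover have "\<forall>i. 0 \<le> X \<omega> i" using rj_facts(1)[OF \<omega>] s0 by (simp add: X_def)
    ultimately show "X \<omega> \<in> S_down" by (simp add: S_down_def)
  qed measurable
  then have XD: "X \<in> measurable D S_down_space" by (simp add: D_def)
  show ?thesis
  proof
    show "sets (PD_star \<alpha> (- \<alpha> - \<gamma>) M \<sigma>) = sets S_down_space" by (simp add: PD)
    show "AE s in PD_star \<alpha> (- \<alpha> - \<gamma>) M \<sigma>. suminf s = 1 \<and> s 0 < 1"
    proof -
      have "AE \<omega> in M. suminf (X \<omega>) = 1 \<and> X \<omega> 0 < 1"
        using pure_jump rj_0_less sigma_pos AE_space
      proof eventually_elim
        case (elim \<omega>)
        have "(\<Sum>i. X \<omega> i) = (\<Sum>i. rj \<omega> i) / \<sigma> 1 \<omega>"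
          unfolding X_def using rj_facts(3)[OF elim(4)] by (rule suminf_divide)
        then have "suminf (X \<omega>) = 1" using elim by simp
        then show ?case using elim by (simp add: X_def)
      qed
      then have "AE \<omega> in D. suminf (X \<omega>) = 1 \<and> X \<omega> 0 < 1"
        unfolding D_def by (subst AE_density) auto
      then show ?thesis unfolding PD by (subst AE_distr_iff[OF XD sets_proper])
    qed
    have \<gamma>\<alpha>: "\<gamma> / \<alpha> < 1" using alpha \<alpha> by (simp add: divide_less_eq)
    then show "0 < \<alpha> * Gamma (1 - \<gamma> / \<alpha>)" using alpha Gamma_real_pos[of "1 - \<gamma> / \<alpha>"] by simp
    fix ns assume ns: "valid_parts ns"
    have ns1: "\<forall>m\<in>set ns. Suc 0 \<le> m" "2 \<le> length ns" using ns by (auto simp: valid_parts_def)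
    have n2: "2 \<le> sum_list ns" using valid_parts_sum[OF ns] .
    have "(\<integral>\<^sup>+s. dsum s ns \<partial>PD_star \<alpha> (- \<alpha> - \<gamma>) M \<sigma>) = (\<integral>\<^sup>+\<omega>. dsum (X \<omega>) ns \<partial>D)"
      unfolding PD by (rule nn_integral_distr[OF XD]) (simp add: measurable_dsum_S_down[OF ns1(1)])
    also have "\<dots> = (\<integral>\<^sup>+\<omega>. ennreal (\<sigma> 1 \<omega> powr (\<alpha> + \<gamma>)) * dsum (X \<omega>) ns \<partial>M)"
      unfolding D_def
      by (rule nn_integral_density) (measurable, rule measurable_compose[OF XM measurable_dsum_S_down[OF ns1(1)]])
    also have "\<dots> = (\<integral>\<^sup>+\<omega>. dsum (\<lambda>i. rj \<omega> i / \<sigma> 1 \<omega>) ns * ennreal (\<sigma> 1 \<omega> powr (- (- \<alpha> - \<gamma>))) \<partial>M)"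
      by (intro nn_integral_cong) (simp add: X_def[abs_def] mult.commute add.commute)
    also have "\<dots> = ennreal (\<alpha> ^ length ns * (\<Prod>n\<leftarrow>ns. rising \<alpha> n) * (Gamma (real (length ns) + (- \<alpha> - \<gamma>) / \<alpha>) / \<alpha>) / Gamma (real (sum_list ns) + (- \<alpha> - \<gamma>)))"
    proof (rule nn_integral_dsum_normalised[OF ns1(1)])
      show "0 < real (sum_list ns) + (- \<alpha> - \<gamma>)" using n2 \<alpha> by linarith
      have "2 * \<alpha> \<le> real (length ns) * \<alpha>" using ns1 alpha by (intro mult_right_mono) auto
      then show "0 < real (length ns) * \<alpha> + (- \<alpha> - \<gamma>)" using \<alpha> by linarith
    qed
    also have "\<alpha> ^ length ns * (\<Prod>n\<leftarrow>ns. rising \<alpha> n) * (Gamma (real (length ns) + (- \<alpha> - \<gamma>) / \<alpha>) / \<alpha>) / Gamma (real (sum_list ns) + (- \<alpha> - \<gamma>)) =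
       \<alpha> * Gamma (1 - \<gamma> / \<alpha>) * pd_moment \<alpha> \<gamma> ns"
    proof -
      have 1: "real (length ns) + (- \<alpha> - \<gamma>) / \<alpha> = real (length ns) - 1 - \<gamma> / \<alpha>"
        using alpha by (simp add: diff_divide_distrib)
      have 2: "\<alpha> ^ length ns / \<alpha> = \<alpha> ^ (length ns - 1)"
        using alpha ns1(2) by (simp add: power_diff)
      have 3: "real (sum_list ns) + (- \<alpha> - \<gamma>) = real (sum_list ns) - \<alpha> - \<gamma>" by simp
      have 4: "\<alpha> ^ length ns * p * (G / \<alpha>) / H = (\<alpha> ^ length ns / \<alpha> * G) * p / H" for p G H :: real
        by simp
      show ?thesis
        unfolding 4 unfolding 1 2 3 Gamma_block_coeff[OF alpha(1) \<alpha>(3) ns1(2)] pd_moment_def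
        by (simp only: mult.assoc times_divide_eq_right)
    qed
    finally show "(\<integral>\<^sup>+s. dsum s ns \<partial>PD_star \<alpha> (- \<alpha> - \<gamma>) M \<sigma>) = ennreal (\<alpha> * Gamma (1 - \<gamma> / \<alpha>) * pd_moment \<alpha> \<gamma> ns)" .
  qed
qed

section \<open>The integral representation\<close>

context pd_like
begin

definition weight :: "(nat \<Rightarrow> real) \<Rightarrow> real" where
  "weight s = \<gamma> + (1 - \<alpha> - \<gamma>) * (\<Sum>\<^sub>\<infinity>(i, j)\<in>{(i, j). i \<noteq> j}. s i * s j)"

definition \<nu> :: "(nat \<Rightarrow> real) measure" where
  "\<nu> = density P (\<lambda>s. ennreal (weight s))"

text \<open>The normalising constant in closed form (\<open>normalisation_nu\<close>). It vanishes
  at n = 1, where the telescoping sum starts.\<close>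

definition scale :: "nat \<Rightarrow> real" where
  "scale n = A * rising \<alpha> n * (real n * (real n - 1)) / Gamma (real n + 2 - \<alpha> - \<gamma>)"

end

locale pd_like_range = pd_like +
  assumes range: "0 \<le> \<alpha>" "\<alpha> < 1" "0 \<le> \<gamma>" "\<gamma> \<le> \<alpha>"
begin

lemma space_P: "space P = S_down"
  using sets_eq_imp_space_eq[OF sets_P] by (simp add: space_S_down)

lemma measurable_P: "f \<in> measurable S_down_space N \<Longrightarrow> f \<in> measurable P N"
  using measurable_cong_sets[OF sets_P refl] by blast

lemma weight_eq: "s \<in> S_down \<Longrightarrow> weight s = \<gamma> + (1 - \<alpha> - \<gamma>) * ((power_sums s 1)\<^sup>2 - power_sums s 2)"
  unfolding weight_def by (simp add: infsum_distinct_pairs)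

lemma measurable_weight [measurable]: "weight \<in> borel_measurable P"
proof (rule measurable_P)
  have "(\<lambda>s. \<gamma> + (1 - \<alpha> - \<gamma>) * ((power_sums s 1)\<^sup>2 - power_sums s 2)) \<in> borel_measurable S_down_space"
    by measurable
  then show "weight \<in> borel_measurable S_down_space"
    by (rule measurable_cong[THEN iffD1, rotated]) (simp add: weight_eq space_S_down)
qed

lemma measurable_psp [measurable]: "(\<lambda>s. power_sum_poly (power_sums s) ns) \<in> borel_measurable P"
  by (rule measurable_P) measurable

lemma proper_power_sum:
  assumes "s \<in> S_down" "suminf s = 1" "1 \<le> n"
  shows "0 \<le> power_sums s n" "power_sums s n \<le> 1" "power_sums s 1 = 1"
proof -
  note f = S_down_facts[OF assms(1)]
  show "power_sums s 1 = 1" using assms by (simp add: power_sums_def)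
  show "0 \<le> power_sums s n" unfolding power_sums_def using f assms(3) by (intro suminf_nonneg) auto
  have "power_sums s n \<le> suminf s" unfolding power_sums_def using f assms(3) by (intro suminf_le) auto
  then show "power_sums s n \<le> 1" using assms(2) by simp
qed

lemma weight_proper:
  assumes "s \<in> S_down" "suminf s = 1"
  shows "weight s = \<gamma> + (1 - \<alpha> - \<gamma>) * (1 - power_sums s 2)" "0 \<le> weight s"
proof -
  note p = proper_power_sum[OF assms, of 2]
  show eq: "weight s = \<gamma> + (1 - \<alpha> - \<gamma>) * (1 - power_sums s 2)"
    unfolding weight_eq[OF assms(1)] using p by simp
  \<comment> \<open>The coefficient 1 - \<alpha> - \<gamma> may be negative; regrouped by the second
    power sum and its complement, both coefficients are nonnegative.\<close>
  have "weight s = \<gamma> * power_sums s 2 + (1 - \<alpha>) * (1 - power_sums s 2)"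
    unfolding eq by (simp add: algebra_simps)
  then show "0 \<le> weight s" using p range by simp
qed

lemma integral_psp:
  assumes "valid_parts ns"
  shows "integrable P (\<lambda>s. power_sum_poly (power_sums s) ns)"
    "(\<integral>s. power_sum_poly (power_sums s) ns \<partial>P) = A * pd_moment \<alpha> \<gamma> ns"
proof -
  have ns: "\<forall>m\<in>set ns. Suc 0 \<le> m" using assms by (simp add: valid_parts_def)
  have nn: "0 \<le> power_sum_poly (power_sums s) ns" if "s \<in> space P" for s
    using dsum_S_down(2)[OF _ ns] that space_P by simp
  have val: "(\<integral>\<^sup>+s. ennreal (power_sum_poly (power_sums s) ns) \<partial>P) = ennreal (A * pd_moment \<alpha> \<gamma> ns)"
    unfolding moments[OF assms, symmetric] using dsum_S_down(1)[OF _ ns] space_P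
    by (intro nn_integral_cong) simp
  have n2: "2 \<le> sum_list ns" using valid_parts_sum[OF assms] .
  have "0 \<le> pd_moment \<alpha> \<gamma> ns"
  proof -
    have "0 \<le> (\<Prod>n\<leftarrow>ns. rising \<alpha> n)" using rising_pos[OF range(2)] by (induction ns) (auto simp: less_imp_le)
    moreover have "0 \<le> block_coeff \<alpha> \<gamma> (length ns)"
      unfolding block_coeff_def
    proof (intro prod_nonneg)
      fix j assume "j \<in> {2..<length ns}"
      then have "1 * \<alpha> \<le> (real j - 1) * \<alpha>" using range by (intro mult_right_mono) auto
      then show "0 \<le> (real j - 1) * \<alpha> - \<gamma>" using range by linarith
    qed
    moreover have "0 < Gamma (real (sum_list ns) - \<alpha> - \<gamma>)" using n2 range by (intro Gamma_real_pos) linarith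
    ultimately show ?thesis by (simp add: pd_moment_def)
  qed
  then have v0: "0 \<le> A * pd_moment \<alpha> \<gamma> ns" using A_pos by simp
  show int: "integrable P (\<lambda>s. power_sum_poly (power_sums s) ns)"
    using nn val by (intro integrableI_nonneg AE_I2) auto
  show "(\<integral>s. power_sum_poly (power_sums s) ns \<partial>P) = A * pd_moment \<alpha> \<gamma> ns"
    using val v0 nn by (intro integral_eq_nn_integral[THEN trans] AE_I2) auto
qed

text \<open>Multiplying by \<open>power_sums s 2\<close> inserts one more part of size 2 or enlarges a part by 2,
  so that the weighted moments reduce to the moments of \<open>P\<close>.\<close>

lemma weighted_moment:
  assumes "valid_parts ns"
  shows "(\<gamma> + (1 - \<alpha> - \<gamma>)) * pd_moment \<alpha> \<gamma> ns - (1 - \<alpha> - \<gamma>) * (pd_moment \<alpha> \<gamma> (2 # ns) + (\<Sum>j<length ns. pd_moment \<alpha> \<gamma> (ns[j := ns ! j + 2])))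
    = scale (sum_list ns) / A * ag_ppf \<alpha> \<gamma> (mset ns)"
proof -
  let ?n = "sum_list ns" and ?k = "length ns" and ?\<delta> = "1 - \<alpha> - \<gamma>"
  define N where "N = real ?n"
  define u where "u = \<alpha> + \<gamma>"
  define R where "R = (\<Prod>n\<leftarrow>ns. rising \<alpha> n)"
  define B where "B = block_coeff \<alpha> \<gamma> ?k"
  define G where "G = Gamma (N - u)"
  define S where "S = cross_sum (mset ns)"
  have ns: "\<forall>m\<in>set ns. Suc 0 \<le> m" "2 \<le> ?k" using assms by (auto simp: valid_parts_def)
  have n2: "2 \<le> ?n" using valid_parts_sum[OF assms] .
  have Nu: "0 < N - u" using n2 range by (simp add: N_def u_def)
  have G0: "G \<noteq> 0" using Gamma_real_pos[OF Nu] by (simp add: G_def)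
  have G2: "Gamma (N + 2 - u) = (N - u + 1) * (N - u) * G"
  proof -
    have "Gamma (N - u + 1) = (N - u) * G" unfolding G_def using Nu by (intro Gamma_plus1) (auto elim!: nonpos_Ints_cases)
    moreover have "Gamma (N - u + 1 + 1) = (N - u + 1) * Gamma (N - u + 1)" using Nu by (intro Gamma_plus1) (auto elim!: nonpos_Ints_cases)
    moreover have "N + 2 - u = N - u + 1 + 1" by simp
    ultimately show ?thesis by (simp only: mult.assoc)
  qed
  have m0: "pd_moment \<alpha> \<gamma> ns = B * R / G"
    by (simp add: pd_moment_def B_def R_def G_def N_def u_def diff_diff_eq)
  have m2: "pd_moment \<alpha> \<gamma> (2 # ns) = B * R * (((real ?k - 1) * \<alpha> - \<gamma>) * (1 - \<alpha>)) / ((N - u + 1) * (N - u) * G)"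
  proof -
    have "rising \<alpha> 2 = 1 - \<alpha>" by (simp add: rising_def numeral_2_eq_2)
    moreover have "real (sum_list (2 # ns)) - \<alpha> - \<gamma> = N + 2 - u" by (simp add: N_def u_def)
    ultimately show ?thesis using ns(2) unfolding pd_moment_def
      by (simp add: block_coeff_Suc B_def R_def G2 mult_ac del: sum_list.Cons)
  qed
  have mj: "pd_moment \<alpha> \<gamma> (ns[j := ns ! j + 2]) = B * R * ((real (ns ! j) - \<alpha>) * (real (ns ! j) + 1 - \<alpha>)) / ((N - u + 1) * (N - u) * G)"
    if j: "j < ?k" for j
  proof -
    have mset: "mset ns = add_mset (ns ! j) (mset ns - {#ns ! j#})" using j by simp
    have upd: "mset (ns[j := ns ! j + 2]) = add_mset (ns ! j + 2) (mset ns - {#ns ! j#})" using j by (rule mset_update)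
    have nj: "1 \<le> ns ! j" using ns(1) nth_mem[OF j] by simp
    have sum: "sum_list (ns[j := ns ! j + 2]) = ?n + 2"
    proof -
      have "\<Sum>\<^sub># (mset (ns[j := ns ! j + 2])) = ns ! j + 2 + \<Sum>\<^sub># (mset ns - {#ns ! j#})" unfolding upd by simp
      moreover have "\<Sum>\<^sub># (mset ns) = ns ! j + \<Sum>\<^sub># (mset ns - {#ns ! j#})" by (subst mset) simp
      ultimately show ?thesis by (simp add: sum_mset_sum_list)
    qed
    have pl: "(\<Prod>n\<leftarrow>xs. rising \<alpha> n) = (\<Prod>n\<in>#mset xs. rising \<alpha> n)" for xs
      by (metis mset_map prod_mset_prod_list)
    have prod: "(\<Prod>n\<leftarrow>ns[j := ns ! j + 2]. rising \<alpha> n) = R * ((real (ns ! j) - \<alpha>) * (real (ns ! j) + 1 - \<alpha>))"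
    proof -
      have "rising \<alpha> (ns ! j + 2) = rising \<alpha> (ns ! j) * ((real (ns ! j) - \<alpha>) * (real (ns ! j) + 1 - \<alpha>))"
        using nj rising_Suc[of "Suc (ns ! j)" \<alpha>] rising_Suc[of "ns ! j" \<alpha>] by (simp add: algebra_simps)
      moreover have "R = rising \<alpha> (ns ! j) * (\<Prod>n\<in>#mset ns - {#ns ! j#}. rising \<alpha> n)"
        unfolding R_def pl by (subst mset) simp
      ultimately show ?thesis unfolding pl upd by (simp add: mult_ac)
    qed
    have "real (sum_list (ns[j := ns ! j + 2])) - \<alpha> - \<gamma> = N + 2 - u" unfolding sum by (simp add: N_def u_def)
    then show ?thesis unfolding pd_moment_def prod G2[symmetric] by (simp add: B_def mult_ac)
  qed
  have sums: "(\<Sum>j<?k. (real (ns ! j) - \<alpha>) * (real (ns ! j) + 1 - \<alpha>)) = (1 - 2 * \<alpha>) * N + (N\<^sup>2 - S) - \<alpha> * (1 - \<alpha>) * real ?k"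
  proof -
    have "(\<Sum>j<?k. (real (ns ! j) - \<alpha>) * (real (ns ! j) + 1 - \<alpha>)) = (\<Sum>x\<in>#mset ns. (real x - \<alpha>) * (real x + 1 - \<alpha>))"
      by (metis (no_types, lifting) atLeast0LessThan mset_map sum_list_sum_nth sum_mset_sum_list length_map nth_map sum.cong lessThan_iff)
    also have "\<dots> = (\<Sum>x\<in>#mset ns. (1 - 2 * \<alpha>) * real x + 1 * (real x)\<^sup>2 + (- \<alpha> * (1 - \<alpha>)))"
      by (intro arg_cong[where f=sum_mset] image_mset_cong) (simp add: power2_eq_square algebra_simps)
    also have "\<dots> = (1 - 2 * \<alpha>) * N + (N\<^sup>2 - S) - \<alpha> * (1 - \<alpha>) * real ?k"
      unfolding sum_mset_weighted by (simp add: N_def S_def sum_mset_sum_list)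
    finally show ?thesis .
  qed
  \<comment> \<open>Inserting mass 2 raises the argument of Gamma by 2, and Q is the factor so
    produced. It is the common denominator of all three kinds of terms.\<close>
  define Q where "Q = (N - u + 1) * (N - u)"
  have Q0: "Q \<noteq> 0" using Nu by (simp add: Q_def)
  have gen: "a * (T / G) - b * (T * X / (Q * G) + T * Y / (Q * G)) = T / (Q * G) * (a * Q - b * (X + Y))" for a b T X Y
    using Q0 G0 by (simp add: field_simps)
  have mjs: "(\<Sum>j<?k. pd_moment \<alpha> \<gamma> (ns[j := ns ! j + 2])) = B * R * (\<Sum>j<?k. (real (ns ! j) - \<alpha>) * (real (ns ! j) + 1 - \<alpha>)) / (Q * G)"
    unfolding sum_distrib_left sum_divide_distrib Q_def by (intro sum.cong refl mj) simp
  have "(\<gamma> + ?\<delta>) * pd_moment \<alpha> \<gamma> ns - ?\<delta> * (pd_moment \<alpha> \<gamma> (2 # ns) + (\<Sum>j<?k. pd_moment \<alpha> \<gamma> (ns[j := ns ! j + 2])))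
     = B * R / (Q * G) * ((\<gamma> + ?\<delta>) * Q - ?\<delta> * (((real ?k - 1) * \<alpha> - \<gamma>) * (1 - \<alpha>) + ((1 - 2 * \<alpha>) * N + (N\<^sup>2 - S) - \<alpha> * (1 - \<alpha>) * real ?k)))"
    unfolding m0 m2 mjs Q_def[symmetric] sums by (rule gen)
  \<comment> \<open>The number of parts cancels, since the new part brings k \<alpha> (1 - \<alpha>)
    and the enlarged parts bring its negative. What remains is n (n - 1) times the first factor of
    the closed formula.\<close>
  also have "(\<gamma> + ?\<delta>) * Q - ?\<delta> * (((real ?k - 1) * \<alpha> - \<gamma>) * (1 - \<alpha>) + ((1 - 2 * \<alpha>) * N + (N\<^sup>2 - S) - \<alpha> * (1 - \<alpha>) * real ?k)) = \<gamma> * (N * (N - 1)) + ?\<delta> * S"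
    unfolding Q_def u_def by (simp add: power2_eq_square algebra_simps)
  also have "B * R / (Q * G) * (\<gamma> * (N * (N - 1)) + ?\<delta> * S) = scale ?n / A * ag_ppf \<alpha> \<gamma> (mset ns)"
  proof -
    have s: "\<Sum>\<^sub># (mset ns) = ?n" by (simp add: sum_mset_sum_list)
    have "prod_rising \<alpha> (mset ns) = R" unfolding prod_rising_def R_def by (metis mset_map prod_mset_prod_list)
    moreover have "rising \<alpha> ?n \<noteq> 0" using rising_pos[OF range(2), of ?n] by simp
    moreover have "N + 2 - \<alpha> - \<gamma> = N + 2 - u" by (simp add: u_def)
    then have "Gamma (N + 2 - \<alpha> - \<gamma>) = Q * G" by (simp only: G2 Q_def)
    moreover have "1 < N" using n2 unfolding N_def by linarith
    then have "N * (N - 1) \<noteq> 0" by simp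
    ultimately show ?thesis unfolding ag_ppf_eq[OF s] scale_def
      using A_pos Q0 G0 by (simp add: B_def S_def N_def[symmetric] divide_simps)
  qed
  finally show ?thesis .
qed

lemma scale_pos: "2 \<le> n \<Longrightarrow> 0 < scale n"
  unfolding scale_def using A_pos range rising_pos[OF range(2), of n] Gamma_real_pos[of "real n + 2 - \<alpha> - \<gamma>"]
  by (intro divide_pos_pos mult_pos_pos) auto

lemma proper_nu: "AE s in \<nu>. s \<in> S_down \<and> suminf s = 1 \<and> s 0 < 1"
  unfolding \<nu>_def
proof (subst AE_density)
  show "AE s in P. 0 < ennreal (weight s) \<longrightarrow> s \<in> S_down \<and> suminf s = 1 \<and> s 0 < 1"
    using proper_P AE_space by eventually_elim (simp add: space_P)
qed measurable

text \<open>The reduction to unweighted moments has terms of both signs. It is therefore carried out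
  for the real polynomial F with Bochner integrals, and F equals the nonnegative integrand almost
  everywhere.\<close>

lemma paintbox_nu:
  assumes "valid_parts ns"
  shows "paintbox_integral \<nu> ns = ennreal (scale (sum_list ns) * ag_ppf \<alpha> \<gamma> (mset ns))" "0 \<le> ag_ppf \<alpha> \<gamma> (mset ns)"
proof -
  let ?\<delta> = "1 - \<alpha> - \<gamma>"
  let ?p = "\<lambda>ns s. power_sum_poly (power_sums s) ns"
  have ns: "\<forall>m\<in>set ns. Suc 0 \<le> m" using assms by (simp add: valid_parts_def)
  have v2: "valid_parts (2 # ns)" "valid_parts (ns[j := ns ! j + 2])" for j
    using assms list_update_ge_1[OF ns, of j 2] by (simp_all add: valid_parts_def)
  define F where "F s = (\<gamma> + ?\<delta>) * ?p ns s - ?\<delta> * (?p (2 # ns) s + (\<Sum>j<length ns. ?p (ns[j := ns ! j + 2]) s))" for s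
  have F_int: "integrable P F"
    unfolding F_def[abs_def]
    by (intro Bochner_Integration.integrable_diff Bochner_Integration.integrable_add Bochner_Integration.integrable_sum
        integrable_mult_right integral_psp assms v2)
  have F_val: "(\<integral>s. F s \<partial>P) = A * ((\<gamma> + ?\<delta>) * pd_moment \<alpha> \<gamma> ns - ?\<delta> * (pd_moment \<alpha> \<gamma> (2 # ns) + (\<Sum>j<length ns. pd_moment \<alpha> \<gamma> (ns[j := ns ! j + 2]))))"
  proof -
    have "(\<integral>s. F s \<partial>P) = (\<gamma> + ?\<delta>) * (\<integral>s. ?p ns s \<partial>P) - ?\<delta> * ((\<integral>s. ?p (2 # ns) s \<partial>P) + (\<Sum>j<length ns. (\<integral>s. ?p (ns[j := ns ! j + 2]) s \<partial>P)))"
      unfolding F_def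
      by (subst Bochner_Integration.integral_diff Bochner_Integration.integral_add Bochner_Integration.integral_sum integral_mult_right_zero |
          intro Bochner_Integration.integrable_diff Bochner_Integration.integrable_add Bochner_Integration.integrable_sum
        integrable_mult_right integral_psp assms v2 refl)+
    then show ?thesis unfolding integral_psp(2)[OF assms] integral_psp(2)[OF v2(1)] integral_psp(2)[OF v2(2)]
      by (simp add: sum_distrib_left[symmetric] algebra_simps)
  qed
  have F_eq: "AE s in P. ennreal (weight s) * dsum s ns = ennreal (F s) \<and> 0 \<le> F s"
    using proper_P AE_space
  proof eventually_elim
    case (elim s)
    then have s: "s \<in> S_down" "suminf s = 1" by (auto simp: space_P)
    have "power_sums s 2 * ?p ns s = ?p (2 # ns) s + (\<Sum>j<length ns. ?p (ns[j := ns ! j + 2]) s)" by simp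
    then have "F s = weight s * ?p ns s"
      unfolding weight_proper(1)[OF s] F_def by (simp add: algebra_simps)
    then show ?case using weight_proper(2)[OF s] dsum_S_down[OF s(1) ns] by (simp add: ennreal_mult')
  qed
  have "paintbox_integral \<nu> ns = (\<integral>\<^sup>+s. dsum s ns \<partial>\<nu>)" by (simp add: paintbox_integral_def dsum_def)
  also have "\<dots> = (\<integral>\<^sup>+s. ennreal (weight s) * dsum s ns \<partial>P)"
    unfolding \<nu>_def by (rule nn_integral_density) (measurable, rule measurable_P[OF measurable_dsum_S_down[OF ns]])
  also have "\<dots> = (\<integral>\<^sup>+s. ennreal (F s) \<partial>P)" using F_eq by (intro nn_integral_cong_AE) auto
  also have "\<dots> = ennreal (\<integral>s. F s \<partial>P)" using F_eq by (intro nn_integral_eq_integral F_int) auto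
  finally have pb: "paintbox_integral \<nu> ns = ennreal (\<integral>s. F s \<partial>P)" .
  have val: "(\<integral>s. F s \<partial>P) = scale (sum_list ns) * ag_ppf \<alpha> \<gamma> (mset ns)"
    unfolding F_val weighted_moment[OF assms] using A_pos by simp
  show "paintbox_integral \<nu> ns = ennreal (scale (sum_list ns) * ag_ppf \<alpha> \<gamma> (mset ns))" using pb val by simp
  have "0 \<le> (\<integral>s. F s \<partial>P)" using F_eq by (intro integral_nonneg_AE) auto
  then show "0 \<le> ag_ppf \<alpha> \<gamma> (mset ns)" unfolding val using scale_pos[OF valid_parts_sum[OF assms]]
    by (simp add: zero_le_mult_iff)
qed

text \<open>By \<open>paintbox_nu\<close>, the left side is the value of the paintbox integral for
  (m, 1), so this is the step of the telescoping sum. With C = m + 2 - \<alpha> - \<gamma> it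
  reduces to \<gamma> (m + 1) + 2 (1 - \<alpha> - \<gamma>) = (m - \<alpha>) (m + 1) - (m - 1)
  C.\<close>

lemma scale_increment:
  assumes "1 \<le> m"
  shows "scale (Suc m) * ag_ppf \<alpha> \<gamma> {#m, 1#} = scale (Suc m) - scale m"
proof -
  define N where "N = real m"
  define G where "G = Gamma (N + 2 - \<alpha> - \<gamma>)"
  define r where "r = rising \<alpha> m"
  have pos: "0 < N + 2 - \<alpha> - \<gamma>" "0 < N - \<alpha>" "0 < N" using assms range by (auto simp: N_def)
  have G0: "0 < G" unfolding G_def using pos by (intro Gamma_real_pos)
  have r0: "0 < r" unfolding r_def using rising_pos[OF range(2)] .
  have "Gamma (real (Suc m) + 2 - \<alpha> - \<gamma>) = Gamma (N + 2 - \<alpha> - \<gamma> + 1)" by (simp add: N_def algebra_simps)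
  also have "\<dots> = (N + 2 - \<alpha> - \<gamma>) * G" unfolding G_def using pos by (intro Gamma_plus1) (auto elim!: nonpos_Ints_cases)
  finally have G1: "Gamma (real (Suc m) + 2 - \<alpha> - \<gamma>) = (N + 2 - \<alpha> - \<gamma>) * G" .
  have S1: "scale (Suc m) = A * (r * (N - \<alpha>)) * ((N + 1) * N) / ((N + 2 - \<alpha> - \<gamma>) * G)"
    unfolding scale_def G1 rising_Suc[OF assms] by (simp add: r_def N_def)
  have S0: "scale m = A * r * (N * (N - 1)) / G" by (simp add: scale_def r_def N_def G_def)
  have pair: "(N - \<alpha>) * ag_ppf \<alpha> \<gamma> {#m, 1#} = \<gamma> + 2 * (1 - \<alpha> - \<gamma>) / (N + 1)"
    unfolding N_def by (rule ag_ppf_pair[OF range(2) assms])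
  define C where "C = N + 2 - \<alpha> - \<gamma>"
  have C0: "C \<noteq> 0" using pos by (simp add: C_def)
  have "scale (Suc m) * ag_ppf \<alpha> \<gamma> {#m, 1#} = A * r * N / (C * G) * ((N + 1) * ((N - \<alpha>) * ag_ppf \<alpha> \<gamma> {#m, 1#}))"
    unfolding S1 C_def[symmetric] by (simp add: mult_ac)
  also have "(N + 1) * ((N - \<alpha>) * ag_ppf \<alpha> \<gamma> {#m, 1#}) = \<gamma> * (N + 1) + 2 * (1 - \<alpha> - \<gamma>)"
  proof -
    have "(N + 1) * (d / (N + 1)) = d" for d using pos by simp
    then show ?thesis by (simp only: pair distrib_left[of "N + 1"] mult.commute[of "N + 1" \<gamma>])
  qed
  also have "\<dots> = (N - \<alpha>) * (N + 1) - (N - 1) * C"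
    unfolding C_def by (simp add: algebra_simps)
  also have "A * r * N / (C * G) * ((N - \<alpha>) * (N + 1) - (N - 1) * C) = scale (Suc m) - scale m"
  proof -
    have "scale m = A * r * N / (C * G) * ((N - 1) * C)" unfolding S0 using C0 by simp
    moreover have "scale (Suc m) = A * r * N / (C * G) * ((N - \<alpha>) * (N + 1))"
      unfolding S1 C_def[symmetric] by (simp add: mult_ac)
    ultimately show ?thesis by (simp only: right_diff_distrib)
  qed
  finally show ?thesis .
qed

text \<open>Almost everywhere the first power sum is 1, so 1 minus the n-th power sum is the sum of
  successive differences, each a paintbox sum for (m, 1).\<close>

lemma normalisation_nu:
  assumes "1 \<le> n"
  shows "normalisation \<nu> n = ennreal (scale n)"
proof -
  have v: "valid_parts [m, 1]" if "1 \<le> m" for m using that by (simp add: valid_parts_def)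
  have meas: "(\<lambda>s. dsum s [m, 1]) \<in> borel_measurable \<nu>" if "1 \<le> m" for m
    unfolding \<nu>_def using measurable_P[OF measurable_dsum_S_down[of "[m, 1]"]] that by simp
  have "normalisation \<nu> n = (\<integral>\<^sup>+s. (\<Sum>m=1..<n. dsum s [m, 1]) \<partial>\<nu>)"
    unfolding normalisation_def
  proof (rule nn_integral_cong_AE)
    show "AE s in \<nu>. ennreal (1 - (\<Sum>i. s i ^ n)) = (\<Sum>m=1..<n. dsum s [m, 1])"
      using proper_nu
    proof eventually_elim
      case (elim s)
      then have s: "s \<in> S_down" "suminf s = 1" by auto
      note p = proper_power_sum[OF s]
      have d: "dsum s [m, 1] = ennreal (power_sums s m - power_sums s (Suc m))" "0 \<le> power_sums s m - power_sums s (Suc m)"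
        if "1 \<le> m" for m
        using dsum_S_down[OF s(1), of "[m, 1]"] that p(3)[OF that] by simp_all
      have "(\<Sum>m=1..<n. dsum s [m, 1]) = (\<Sum>m=1..<n. ennreal (power_sums s m - power_sums s (Suc m)))"
        using d by (intro sum.cong) auto
      also have "\<dots> = ennreal (\<Sum>m=1..<n. power_sums s m - power_sums s (Suc m))"
        using d by (intro sum_ennreal) auto
      also have "(\<Sum>m=1..<n. power_sums s m - power_sums s (Suc m)) = 1 - power_sums s n"
        using sum_Suc_diff'[OF assms, of "\<lambda>m. - power_sums s m"] p(3)[OF assms] by simp
      finally show ?case by (simp add: power_sums_def)
    qed
  qed
  also have "\<dots> = (\<Sum>m=1..<n. \<integral>\<^sup>+s. dsum s [m, 1] \<partial>\<nu>)" using meas by (intro nn_integral_sum) auto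
  also have "\<dots> = (\<Sum>m=1..<n. paintbox_integral \<nu> [m, 1])" by (simp add: paintbox_integral_def dsum_def)
  also have "\<dots> = (\<Sum>m=1..<n. ennreal (scale (Suc m) - scale m))"
    using paintbox_nu(1)[OF v] scale_increment by (intro sum.cong) auto
  also have "\<dots> = ennreal (\<Sum>m=1..<n. scale (Suc m) - scale m)"
  proof (intro sum_ennreal)
    fix m assume m: "m \<in> {1..<n}"
    then have "0 \<le> ag_ppf \<alpha> \<gamma> {#m, 1#}" using paintbox_nu(2)[OF v, of m] by simp
    then show "0 \<le> scale (Suc m) - scale m"
      using scale_increment[of m] scale_pos[of "Suc m"] m by (metis atLeastLessThan_iff mult_nonneg_nonneg less_imp_le Suc_le_mono numeral_2_eq_2 One_nat_def)
  qed
  \<comment> \<open>The lower end drops out because \<open>scale 1\<close> is 0.\<close>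
  also have "(\<Sum>m=1..<n. scale (Suc m) - scale m) = scale n"
    using sum_Suc_diff'[OF assms, of scale] by (simp add: scale_def)
  finally show ?thesis .
qed

lemma dislocation_nu: "dislocation_measure \<nu>"
  unfolding dislocation_measure_def
proof (intro conjI)
  show "sets \<nu> = sets S_down_space" by (simp add: \<nu>_def sets_P)
  define e :: "nat \<Rightarrow> real" where "e = (\<lambda>i. if i = 0 then 1 else 0)"
  have "AE s in \<nu>. s \<notin> {e}" using proper_nu by eventually_elim (auto simp: e_def)
  then have "emeasure \<nu> {e} = 0"
  \<comment> \<open>A set outside the sigma-algebra has \<open>emeasure\<close> 0 by convention, so
    measurability of the singleton need not be decided.\<close>
  proof (cases "{e} \<in> sets \<nu>")
    case True
    then show ?thesis using \<open>AE s in \<nu>. s \<notin> {e}\<close> by (simp add: AE_iff_null_sets[symmetric] null_setsD1 AE_iff_null_sets)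
  qed (rule emeasure_notin_sets)
  then show "emeasure \<nu> {\<lambda>i. if i = 0 then 1 else 0} = 0" by (simp add: e_def)
  have "(\<integral>\<^sup>+ s. ennreal (1 - s 0) \<partial>\<nu>) \<le> normalisation \<nu> 2"
    unfolding normalisation_def
  proof (rule nn_integral_mono_AE)
    show "AE s in \<nu>. ennreal (1 - s 0) \<le> ennreal (1 - (\<Sum>i. s i ^ 2))"
      using proper_nu
    proof eventually_elim
      case (elim s)
      then have s: "s \<in> S_down" "suminf s = 1" by auto
      note f = S_down_facts[OF s(1)]
      \<comment> \<open>Since s 0 is the largest entry and the total is 1, the sum of squares is at
        most s 0. Finiteness thus follows from that of the normalising constant for n = 2.\<close>
      have "(\<Sum>i. s i ^ 2) \<le> (\<Sum>i. s 0 * s i)"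
      proof (rule suminf_le)
        show "s i ^ 2 \<le> s 0 * s i" for i
          unfolding power2_eq_square using f(1,2) by (intro mult_right_mono)
        show "summable (\<lambda>i. s i ^ 2)" by (rule f(5)) simp
        show "summable (\<lambda>i. s 0 * s i)" using f(6) by (rule summable_mult)
      qed
      also have "\<dots> = s 0" using suminf_mult[OF f(6), of "s 0"] s(2) by simp
      finally show ?case by (intro ennreal_leI) simp
    qed
  qed
  also have "\<dots> < \<infinity>" by (simp add: normalisation_nu)
  finally show "(\<integral>\<^sup>+ s. ennreal (1 - s 0) \<partial>\<nu>) < \<infinity>" .
qed

end

text \<open>The splitting rule carries the multinomial coefficient divided by
  \<open>multiplicity_fact\<close>, and \<open>partition_pf\<close> multiplies by the reciprocal. A
  strict bound on \<alpha> is required for the closed formula.\<close>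

lemma (in alpha_gamma) partition_pf_q_seq:
  assumes "\<alpha> < 1" "valid_parts ns"
  shows "partition_pf (q_seq \<alpha> \<gamma>) ns = ag_ppf \<alpha> \<gamma> (mset ns)"
proof -
  let ?\<mu> = "mset ns" and ?n = "sum_list ns"
  have \<mu>: "?\<mu> \<in> parts_of ?n"
    using assms(2) by (auto simp: valid_parts_def parts_of_def sum_mset_sum_list)
  have n2: "2 \<le> ?n" using valid_parts_sum[OF assms(2)] .
  have sum: "\<Sum>\<^sub># ?\<mu> = ?n" by (simp add: sum_mset_sum_list)
  have q: "q_seq \<alpha> \<gamma> (rev (sort ns)) = multinom ?\<mu> * ag_ppf \<alpha> \<gamma> ?\<mu> / multiplicity_fact ?\<mu>"
  proof -
    have "sorted_wrt (\<ge>) (rev (sort ns))" by (simp add: sorted_wrt_rev)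
    moreover have "sum_list (rev (sort ns)) = ?n" by (metis mset_rev mset_sort sum_mset_sum_list)
    ultimately show ?thesis using q_seq_eq[of "rev (sort ns)"] n2 ag_comp_eq[OF assms(1) ag(1) \<mu>, of \<gamma>] by simp
  qed
  have mult: "(\<Prod>r=1..?n. fact (count_list ns r)) = multiplicity_fact ?\<mu>"
  proof -
    have "set ns \<subseteq> {1..?n}"
      using assms(2) by (auto simp: valid_parts_def Suc_le_eq intro: member_le_sum_list)
    then have "(\<Prod>r=1..?n. fact (count_list ns r)) = (\<Prod>r\<in>set ns. fact (count_list ns r) :: real)"
      by (intro prod.mono_neutral_right) (auto simp: count_list_0_iff)
    then show ?thesis by (simp add: multiplicity_fact_def count_mset)
  qed
  have "multinom ?\<mu> = fact ?n / (\<Prod>m\<leftarrow>ns. fact m)"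
    unfolding multinom_def sum by (metis mset_map prod_mset_prod_list)
  moreover have "multinom ?\<mu> \<noteq> 0"
    using prod_fact_pos[of ?\<mu>] by (simp add: multinom_eq[OF sum])
  ultimately show ?thesis using multiplicity_fact_pos[of ?\<mu>]
    unfolding partition_pf_def Let_def q mult by simp
qed

lemma nu_ag_eq:
  assumes "pd_like \<alpha> \<gamma> A (PD_star \<alpha> (- \<alpha> - \<gamma>) M \<sigma>)"
  shows "nu_ag \<alpha> \<gamma> M \<sigma> = pd_like.\<nu> \<alpha> \<gamma> (PD_star \<alpha> (- \<alpha> - \<gamma>) M \<sigma>)"
  unfolding nu_ag_def pd_like.\<nu>_def[OF assms] pd_like.weight_def[OF assms] ..

lemma (in alpha_gamma) integral_representation:
  fixes M :: "'a measure"
  assumes "\<alpha> < 1" "\<gamma> < \<alpha> \<longrightarrow> stable_subordinator \<alpha> M \<sigma>"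
  shows "dislocation_measure (nu_ag \<alpha> \<gamma> M \<sigma>)"
    "2 \<le> n \<Longrightarrow> 0 < normalisation (nu_ag \<alpha> \<gamma> M \<sigma>) n \<and> normalisation (nu_ag \<alpha> \<gamma> M \<sigma>) n < \<infinity>"
    "valid_parts ns \<Longrightarrow> ennreal (partition_pf (q_seq \<alpha> \<gamma>) ns) =
       paintbox_integral (nu_ag \<alpha> \<gamma> M \<sigma>) ns / normalisation (nu_ag \<alpha> \<gamma> M \<sigma>) (sum_list ns)"
proof -
  \<comment> \<open>The parameter - \<alpha> - \<gamma> equals - 2 \<alpha> exactly if \<gamma> =
    \<alpha>, which decides the branch of \<open>PD_star\<close>. In particular \<alpha> = 0 forces
    \<gamma> = 0 and falls under the binary case.\<close>
  obtain A where A: "pd_like \<alpha> \<gamma> A (PD_star \<alpha> (- \<alpha> - \<gamma>) M \<sigma>)"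
  proof (cases "\<gamma> = \<alpha>")
    case True
    then show ?thesis using that pd_like_binary[OF ag(1) assms(1), of M \<sigma>] by simp
  next
    case False
    then show ?thesis using that pd_like_stable[of \<alpha> M \<sigma> \<gamma>] assms ag by simp
  qed
  interpret pd_like \<alpha> \<gamma> A "PD_star \<alpha> (- \<alpha> - \<gamma>) M \<sigma>" by (rule A)
  interpret pd_like_range \<alpha> \<gamma> A "PD_star \<alpha> (- \<alpha> - \<gamma>) M \<sigma>"
    using ag assms(1) by unfold_locales auto
  note eq = nu_ag_eq[OF A]
  show "dislocation_measure (nu_ag \<alpha> \<gamma> M \<sigma>)" unfolding eq by (rule dislocation_nu)
  show "0 < normalisation (nu_ag \<alpha> \<gamma> M \<sigma>) n \<and> normalisation (nu_ag \<alpha> \<gamma> M \<sigma>) n < \<infinity>" if "2 \<le> n"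
    unfolding eq using normalisation_nu[of n] scale_pos[OF that] that by simp
  assume ns: "valid_parts ns"
  note n2 = valid_parts_sum[OF ns]
  have "ennreal (scale (sum_list ns) * ag_ppf \<alpha> \<gamma> (mset ns)) / ennreal (scale (sum_list ns)) = ennreal (ag_ppf \<alpha> \<gamma> (mset ns))"
    using scale_pos[OF n2] paintbox_nu(2)[OF ns] by (subst divide_ennreal) auto
  then show "ennreal (partition_pf (q_seq \<alpha> \<gamma>) ns) =
       paintbox_integral (nu_ag \<alpha> \<gamma> M \<sigma>) ns / normalisation (nu_ag \<alpha> \<gamma> M \<sigma>) (sum_list ns)"
    unfolding eq partition_pf_q_seq[OF assms(1) ns] paintbox_nu(1)[OF ns] using normalisation_nu n2 by simp
qed

theorem theorem2:
  fixes \<alpha> \<gamma> :: real and M :: "'a measure" and \<sigma> :: "real \<Rightarrow> 'a \<Rightarrow> real"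
  assumes "0 \<le> \<alpha>" and "\<alpha> \<le> 1" and "0 \<le> \<gamma>" and "\<gamma> \<le> \<alpha>"
  shows "splitting_rule (q_seq \<alpha> \<gamma>) \<and> sampling_consistent (q_seq \<alpha> \<gamma>) \<and>
    (\<alpha> < 1 \<and> (\<gamma> < \<alpha> \<longrightarrow> stable_subordinator \<alpha> M \<sigma>) \<longrightarrow>
      dislocation_measure (nu_ag \<alpha> \<gamma> M \<sigma>) \<and>
      (\<forall>n\<ge>2. 0 < normalisation (nu_ag \<alpha> \<gamma> M \<sigma>) n \<and> normalisation (nu_ag \<alpha> \<gamma> M \<sigma>) n < \<infinity>) \<and>
      (\<forall>ns. 2 \<le> length ns \<and> (\<forall>m\<in>set ns. 1 \<le> m) \<longrightarrow>
        ennreal (partition_pf (q_seq \<alpha> \<gamma>) ns) =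
          paintbox_integral (nu_ag \<alpha> \<gamma> M \<sigma>) ns / normalisation (nu_ag \<alpha> \<gamma> M \<sigma>) (sum_list ns)))"
proof -
  interpret alpha_gamma \<alpha> \<gamma> using assms by unfold_locales
  show ?thesis
    using splitting_rule_q_seq sampling_consistent_q_seq integral_representation[of M \<sigma>]
    by (simp add: valid_parts_def)
qed

end
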